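(* Let $u, v \in H^2(\mathbb{T})$ be outer functions which are an admissible Toeplitz pair. Then $T_uT_{\overline{v}}$ is bounded on $H^2(\mathbb{T})$ if and only if $$\sup_{|w|<1} P_w\left(|u|^2\right) P_w\left(|v|^2\right) < \infty .$$
   Context: $\mathbb{D}$ is the open unit disc, $\mathbb{T}$ the unit circle, $m$ normalised Lebesgue measure on $\mathbb{T}$, $L^p(\mathbb{T}) = L^p(\mathbb{T}, m)$. $B_\epsilon(\zeta)$ is the open ball of radius $\epsilon$ centred at $\zeta$ in $\mathbb{C}$. For $0<p<\infty$, $H^p(\mathbb{T})$ is the Hardy space of analytic functions on $\mathbb{D}$, identified with their radial boundary values on $\mathbb{T}$ and hence viewed inside $L^p(\mathbb{T})$. For a set $X$ of analytic functions, $\overline{X}$ is the set of their complex conjugates; $zH^2(\mathbb{T})=\{z h(z): h\in H^2(\mathbb{T})\}$. $P_w(\rho)=\int_{\mathbb{T}}\frac{1-|w|^2}{|\zeta-w|^2}\rho(\zeta)\,dm(\zeta)$ is the Poisson extension of $\rho\in L^1(\mathbb{T})$ at $w\in\mathbb{D}$. $H(\mathbb{T})$ is the space of holomorphic functions on $\mathbb{D}$ that have a.e. defined radial boundary values on $\mathbb{T}$. Elements of $H(\mathbb{T})$ are also regarded as functions on $\mathbb{T}$ through these boundary values. Riesz projection: for $f \in L^1(\mathbb{T})$, $(Pf)(z)=\int_{\mathbb{T}} \frac{f(\zeta)}{1-\overline{\zeta}z}\,dm(\zeta)$, $z\in\mathbb{D}$; $P$ maps $L^1(\mathbb{T})$ into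 $H^s(\mathbb{T})$ for every $0<s<1$. Toeplitz product: for $f\in H^2(\mathbb{T})$, $T_uT_{\overline v} f := u\,P(\overline{v}f)$, an element of $H(\mathbb{T})$. "Bounded on $H^2(\mathbb{T})$" means that it is a bounded linear map from $H^2(\mathbb{T})$ to $H^2(\mathbb{T})$. Poles: $\zeta \in \mathbb{T}$ is a pole of $f \in H(\mathbb{T})$ if for all $\epsilon>0$, $f \notin L^\infty(B_\epsilon(\zeta)\cap\mathbb{T})$. Write $v \in L^2(\mathbb{T})$ as $v=\overline{v_-}+v_+$ with $v_+ \in H^2(\mathbb{T})$ and $\overline{v_-}\in\overline{zH^2(\mathbb{T})}$; the poles of $v$ are the union of the poles of $v_-$ and of $v_+$. A pole $\zeta$ of $f$ is simple if there is $n \in \mathbb{N}$ such that $(z-\zeta)^n f(z) \in L^\infty(\mathbb{T}\cap B_\epsilon(\zeta))$ for some $\epsilon>0$; the smallest such $n$ is the order of the pole. The same terminology is used for $f=v\in L^2(\mathbb{T})$. Admissible Toeplitz pair: $u \in H(\mathbb{T})$, $v \in L^2(\mathbb{T})$ are an admissible Toeplitz pair if (a) both $u$ and $v$ have finitely many poles, each pole being simple; (b) $u$ is analytic at the poles of $v$; (c) writing $v=\overline{v_-}+v_+$ with $v_+ \in H^2(\mathbb{T})$ and $\overline{v_-}\in\overline{zH^2(\mathbb{T})}$, both $v_-$ and $v_+$ are analytic at the poles of $u$; (d) one of the following holds: (1) $v \in \overline{H^2(\mathbb{T})}$; or (2) for every $t \in \mathbb{T}$ which is a pole of $u$ of order $j$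 and for all $0\le i<j$, whenever the function $\frac{v(z)}{(z-t)^i}$ has value $0$ at $t$, the functions $\frac{v_+(z)}{(z-t)^i}$ and $\frac{\overline{v_-(z)}}{(z-t)^i}$ also have value $0$ at $t$ (values at $t$ being understood as limits as $z\to t$ along $\mathbb{T}$). *)

theory Defs
  imports "HOL-Analysis.Analysis"
begin

text \<open>
  Analytic functions on the disc are maps on the whole complex plane of which only the values on
  the open unit disc are relevant. Elements of the Lebesgue spaces of the circle are maps of which
  only the values on the unit circle are relevant, up to null sets.
\<close>

abbreviation unit_disc :: "complex set" where
  "unit_disc \<equiv> ball 0 1"

abbreviation unit_circle :: "complex set" where
  "unit_circle \<equiv> sphere 0 1"

definition circle_measure :: "complex measure" where
  "circle_measure =
     distr (uniform_measure lborel {0..2 * pi}) (restrict_space borel unit_circle) cis"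

definition Lp :: "real \<Rightarrow> (complex \<Rightarrow> complex) set" where
  "Lp p = {f \<in> borel_measurable circle_measure.
             integrable circle_measure (\<lambda>\<zeta>. norm (f \<zeta>) powr p)}"

definition Lp_norm :: "real \<Rightarrow> (complex \<Rightarrow> complex) \<Rightarrow> real" where
  "Lp_norm p f = (LINT \<zeta>|circle_measure. norm (f \<zeta>) powr p) powr (1 / p)"

text \<open>\<open>Linfty A\<close> is the space of essentially bounded functions on \<open>A \<inter> unit_circle\<close>.\<close>

definition Linfty :: "complex set \<Rightarrow> (complex \<Rightarrow> complex) set" where
  "Linfty A = {f. set_borel_measurable circle_measure A f \<and>
                  (\<exists>C. AE \<zeta> in circle_measure. \<zeta> \<in> A \<longrightarrow> norm (f \<zeta>) \<le> C)}"

text \<open>Where the radial limit does not exist, the value is an unspecified constant.\<close>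

definition bdry :: "(complex \<Rightarrow> complex) \<Rightarrow> complex \<Rightarrow> complex" where
  "bdry f \<zeta> = Lim (at_left (1::real)) (\<lambda>r. f (of_real r * \<zeta>))"

definition HT :: "(complex \<Rightarrow> complex) set" where
  "HT = {f. f holomorphic_on unit_disc \<and>
            (AE \<zeta> in circle_measure.
               \<exists>l. ((\<lambda>r. f (of_real r * \<zeta>)) \<longlongrightarrow> l) (at_left (1::real)))}"

definition hardy :: "real \<Rightarrow> (complex \<Rightarrow> complex) set" where
  "hardy p = {f. f holomorphic_on unit_disc \<and>
                 bdd_above ((\<lambda>r. LINT \<zeta>|circle_measure. norm (f (of_real r * \<zeta>)) powr p)
                              ` {0..<1})}"

definition outer :: "(complex \<Rightarrow> complex) \<Rightarrow> bool" where
  "outer f \<longleftrightarrow>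
     (\<exists>c \<phi>. norm c = 1 \<and> \<phi> \<in> borel_measurable circle_measure \<and>
        (AE \<zeta> in circle_measure. \<phi> \<zeta> > (0::real)) \<and>
        integrable circle_measure (\<lambda>\<zeta>. ln (\<phi> \<zeta>)) \<and>
        (\<forall>z\<in>unit_disc.
           f z = c * exp (LINT \<zeta>|circle_measure. (\<zeta> + z) / (\<zeta> - z) * of_real (ln (\<phi> \<zeta>)))))"

definition poisson :: "(complex \<Rightarrow> real) \<Rightarrow> complex \<Rightarrow> real" where
  "poisson \<rho> w =
     (LINT \<zeta>|circle_measure. (1 - (norm w)\<^sup>2) / (norm (\<zeta> - w))\<^sup>2 * \<rho> \<zeta>)"

definition riesz_projection :: "(complex \<Rightarrow> complex) \<Rightarrow> complex \<Rightarrow> complex" where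
  "riesz_projection f z = (LINT \<zeta>|circle_measure. f \<zeta> / (1 - cnj \<zeta> * z))"

text \<open>
  \<open>toeplitz_product u v\<close> is the operator with symbols \<open>u\<close> and \<^emph>\<open>conjugated\<close> \<open>v\<close>. Here \<open>u\<close> and \<open>f\<close>
  are functions on the disc, whereas \<open>v\<close> is a function on the circle.
\<close>

definition toeplitz_product ::
    "(complex \<Rightarrow> complex) \<Rightarrow> (complex \<Rightarrow> complex) \<Rightarrow> (complex \<Rightarrow> complex) \<Rightarrow> complex \<Rightarrow> complex" where
  "toeplitz_product u v f z = u z * riesz_projection (\<lambda>\<zeta>. cnj (v \<zeta>) * bdry f \<zeta>) z"

definition bounded_on_H2 :: "((complex \<Rightarrow> complex) \<Rightarrow> complex \<Rightarrow> complex) \<Rightarrow> bool" where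
  "bounded_on_H2 T \<longleftrightarrow>
     (\<forall>f\<in>hardy 2. T f \<in> hardy 2) \<and>
     (\<forall>f\<in>hardy 2. \<forall>g\<in>hardy 2. \<forall>z\<in>unit_disc. T (\<lambda>x. f x + g x) z = T f z + T g z) \<and>
     (\<forall>f\<in>hardy 2. \<forall>a. \<forall>z\<in>unit_disc. T (\<lambda>x. a * f x) z = a * T f z) \<and>
     (\<exists>C. \<forall>f\<in>hardy 2. Lp_norm 2 (bdry (T f)) \<le> C * Lp_norm 2 (bdry f))"

text \<open>
  A function on the disc is analytic at a point of the circle if it continues analytically to a
  neighbourhood of that point.
\<close>

definition analytic_at_bdry :: "(complex \<Rightarrow> complex) \<Rightarrow> complex \<Rightarrow> bool" where
  "analytic_at_bdry f t \<longleftrightarrow>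
     (\<exists>e>0. \<exists>g. g holomorphic_on ball t e \<and> (\<forall>z\<in>ball t e \<inter> unit_disc. g z = f z))"

text \<open>
  Poles, simplicity and order refer to functions on the circle; for a function \<open>f\<close> on the disc they
  are applied to \<open>bdry f\<close>. A simple pole may have any finite order.
\<close>

definition poles :: "(complex \<Rightarrow> complex) \<Rightarrow> complex set" where
  "poles f = {\<zeta> \<in> unit_circle. \<forall>\<epsilon>>0. f \<notin> Linfty (ball \<zeta> \<epsilon>)}"

definition simple_at :: "(complex \<Rightarrow> complex) \<Rightarrow> complex \<Rightarrow> bool" where
  "simple_at f \<zeta> \<longleftrightarrow> (\<exists>n::nat. \<exists>\<epsilon>>0. (\<lambda>z. (z - \<zeta>) ^ n * f z) \<in> Linfty (ball \<zeta> \<epsilon>))"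

definition pole_order :: "(complex \<Rightarrow> complex) \<Rightarrow> complex \<Rightarrow> nat" where
  "pole_order f \<zeta> = (LEAST n. \<exists>\<epsilon>>0. (\<lambda>z. (z - \<zeta>) ^ n * f z) \<in> Linfty (ball \<zeta> \<epsilon>))"

text \<open>
  \<open>f\<close> tends to \<open>0\<close> at \<open>t\<close> along the circle. The limit is an essential one, so that it does not depend
  on the choice of a representative.
\<close>

definition value_zero_at :: "(complex \<Rightarrow> complex) \<Rightarrow> complex \<Rightarrow> bool" where
  "value_zero_at f t \<longleftrightarrow>
     (\<forall>e>0. \<exists>d>0. AE z in circle_measure. z \<in> ball t d \<longrightarrow> norm (f z) < e)"

text \<open>
  \<open>L2_split v vm vp\<close>: \<open>v\<close> is the sum of the conjugate of \<open>vm\<close> and of \<open>vp\<close>. On the disc, \<open>vm\<close> and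
  \<open>vp\<close> are determined by \<open>v\<close>.
\<close>

definition L2_split ::
    "(complex \<Rightarrow> complex) \<Rightarrow> (complex \<Rightarrow> complex) \<Rightarrow> (complex \<Rightarrow> complex) \<Rightarrow> bool" where
  "L2_split v vm vp \<longleftrightarrow>
     vp \<in> hardy 2 \<and> (\<exists>h\<in>hardy 2. \<forall>z\<in>unit_disc. vm z = z * h z) \<and>
     (AE \<zeta> in circle_measure. v \<zeta> = cnj (bdry vm \<zeta>) + bdry vp \<zeta>)"

definition admissible_pair :: "(complex \<Rightarrow> complex) \<Rightarrow> (complex \<Rightarrow> complex) \<Rightarrow> bool" where
  "admissible_pair u v \<longleftrightarrow>
     u \<in> HT \<and> v \<in> Lp 2 \<and>
     (\<exists>vm vp. L2_split v vm vp \<and>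
       (let pu = poles (bdry u); pv = poles (bdry vm) \<union> poles (bdry vp) in
         finite pu \<and> (\<forall>t\<in>pu. simple_at (bdry u) t) \<and>
         finite pv \<and> (\<forall>t\<in>pv. simple_at v t) \<and>
         (\<forall>t\<in>pv. analytic_at_bdry u t) \<and>
         (\<forall>t\<in>pu. analytic_at_bdry vm t \<and> analytic_at_bdry vp t) \<and>
         ((\<exists>h\<in>hardy 2. AE \<zeta> in circle_measure. v \<zeta> = cnj (bdry h \<zeta>)) \<or>
          (\<forall>t\<in>pu. \<forall>i<pole_order (bdry u) t.
             value_zero_at (\<lambda>z. v z / (z - t) ^ i) t \<longrightarrow>
             value_zero_at (\<lambda>z. bdry vp z / (z - t) ^ i) t \<and>
             value_zero_at (\<lambda>z. cnj (bdry vm z) / (z - t) ^ i) t))))"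

end

theory Submission
  imports Defs "HOL-Probability.Probability_Measure" "HOL-Complex_Analysis.Complex_Analysis"
begin

text \<open>
  Necessity is Sarason's argument. For the Blaschke factor \<open>\<phi>\<close> at \<open>w\<close> and the Szego kernel \<open>k\<close> at \<open>w\<close>,
  the operator \<open>T - \<phi> T P cnj \<phi>\<close> built from \<open>T = T_u T_(cnj v)\<close> has rank one; applied to \<open>k v\<close> it gives
  the multiple \<open>P_w(|v|\<^sup>2)\<close> of \<open>k u\<close>, and comparing norms yields the bound.

  For sufficiency, the condition implies that \<open>u v\<close> is bounded on the disc. At a pole of one of the two
  functions the other one is analytic and not identically zero, hence has a zero of finite order there,
  and this order controls the pole. With the polynomials \<open>p\<close> and \<open>q\<close> carrying the zeros of \<open>v\<close> at the
  poles of \<open>u\<close> and vice versa, \<open>u p / q\<close> and \<open>v q / p\<close> are bounded, and moving \<open>p\<close> and \<open>q\<close> through \<open>P\<close>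
  produces errors which \<open>u / q\<close>, still an element of \<open>H\<^sup>2\<close>, absorbs.

  Radial limits of \<open>H\<^sup>2\<close> functions exist by Fatou's theorem; the maximal inequality behind it is proved
  on \<open>L\<^sup>2\<close> by the \<open>TT*\<close> method, from the semigroup property of the Poisson kernel.
\<close>

section \<open>The measure on the circle\<close>

text \<open>No boundary function is available until Fatou's theorem is proved. The early estimates
  therefore use the dilations \<open>f (of_real r * \<zeta>)\<close> with r < 1, whose Fourier
  series converge absolutely, and carry all norms as \<open>mean2\<close>. The maximal inequality
  must not depend on the set of radii. This works because two Poisson kernels integrate to a single
  kernel at the product radius, which is at most 8 times the kernel of smaller radius; hence the
  constant 256 = 4 * 8^2. In the sufficiency part the product \<open>cnj v * f\<close> is merely
  integrable, where P offers no square mean bound. Polynomials can still be moved through P: the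
  Lipschitz factor in the commutator cancels the singularity of the Cauchy kernel. An inequality on
  the circle does not enter the disc for arbitrary holomorphic functions either. That
  \<open>u / q\<close> lies in H^2 therefore serves twice: it absorbs the error, and it makes the
  Poisson formula applicable to \<open>u p / q\<close>.\<close>

abbreviation "\<mu> \<equiv> circle_measure"

lemma space_circle_measure [simp]: "space \<mu> = unit_circle"
  by (simp add: circle_measure_def space_restrict_space)

lemma sets_circle_measure [measurable_cong]:
  "sets \<mu> = sets (restrict_space borel unit_circle)"
  by (simp add: circle_measure_def)

lemma cis_measurable_circle [measurable]: "cis \<in> borel \<rightarrow>\<^sub>M restrict_space borel unit_circle"
  by (rule measurable_restrict_space2)
     (use borel_measurable_continuous_onI[OF continuous_on_cis[OF continuous_on_id]] in auto)

lemma emeasure_two_pi: "emeasure lborel {0..2 * pi} = ennreal (2 * pi)"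
  by simp

interpretation circle: prob_space \<mu>
proof -
  have "prob_space (uniform_measure lborel {0..2 * pi})"
    by (rule prob_space_uniform_measure) (auto simp: emeasure_two_pi)
  then show "prob_space \<mu>"
    unfolding circle_measure_def
    by (rule prob_space.prob_space_distr) simp
qed

lemma borel_measurable_circle:
  "f \<in> borel_measurable borel \<Longrightarrow> f \<in> borel_measurable \<mu>"
  by (subst measurable_cong_sets[OF sets_circle_measure refl]) (rule measurable_restrict_space1)

lemma borel_measurable_circle_continuous:
  fixes f :: "complex \<Rightarrow> 'a::topological_space"
  shows "continuous_on unit_circle f \<Longrightarrow> f \<in> borel_measurable \<mu>"
  by (subst measurable_cong_sets[OF sets_circle_measure refl])
     (rule borel_measurable_continuous_on_restrict)

lemma id_measurable_circle [measurable]: "(\<lambda>\<zeta>. \<zeta>) \<in> borel_measurable \<mu>"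
  by (rule borel_measurable_circle) simp

text \<open>Makes the fundamental theorem of calculus available for integrals over the
  circle.\<close>

lemma integral_circle_measure:
  fixes f :: "complex \<Rightarrow> 'a::{banach, second_countable_topology}"
  assumes "f \<in> borel_measurable \<mu>"
  shows "(LINT \<zeta>|\<mu>. f \<zeta>) = (1 / (2 * pi)) *\<^sub>R (LINT t:{0..2 * pi}|lborel. f (cis t))"
proof -
  have f: "f \<in> borel_measurable (restrict_space borel unit_circle)"
    using assms by (subst measurable_cong_sets[OF sets_circle_measure[symmetric] refl])
  have "(LINT \<zeta>|\<mu>. f \<zeta>) = (LINT t|uniform_measure lborel {0..2 * pi}. f (cis t))"
    unfolding circle_measure_def by (rule integral_distr) (use f in auto)
  also have "\<dots> = (LINT t|density lborel (\<lambda>t. ennreal (indicator {0..2 * pi} t / (2 * pi))). f (cis t))"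
  proof -
    have "(indicator {0..2 * pi} t :: ennreal) / ennreal (2 * pi) = ennreal (indicator {0..2 * pi} t / (2 * pi))" for t
      using divide_ennreal[of 1 "2 * pi"] by (auto simp: indicator_def)
    then show ?thesis by (simp only: uniform_measure_def emeasure_two_pi)
  qed
  also have "\<dots> = (LINT t|lborel. (indicator {0..2 * pi} t / (2 * pi)) *\<^sub>R f (cis t))"
    by (rule integral_density) (use f in \<open>auto intro!: measurable_compose[OF _ f]\<close>)
  also have "\<dots> = (LINT t|lborel. (1 / (2 * pi)) *\<^sub>R (indicator {0..2 * pi} t *\<^sub>R f (cis t)))"
    by simp
  also have "\<dots> = (1 / (2 * pi)) *\<^sub>R (LINT t:{0..2 * pi}|lborel. f (cis t))"
    unfolding set_lebesgue_integral_def by (rule integral_scaleR_right)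
  finally show ?thesis .
qed

text \<open>The fibre of \<open>cis\<close> over a point is countable, hence Lebesgue null. Later
  this removes the finitely many zeros of the auxiliary polynomials from consideration on the
  circle.\<close>

lemma AE_circle_neq: "AE \<zeta> in \<mu>. \<zeta> \<noteq> t"
proof -
  have *: "{\<zeta>\<in>space (restrict_space borel unit_circle). \<zeta> \<noteq> t} \<in> sets (restrict_space borel unit_circle)"
    by measurable
  have "countable {s::real. cis s = t}"
  proof (rule countable_subset)
    show "{s::real. cis s = t} \<subseteq> (\<lambda>n::int. Arg t + 2 * of_int n * pi) ` UNIV"
    proof
      fix s assume "s \<in> {s. cis s = t}"
      then have "cis s = t" by auto
      then have "cis s = cis (Arg t)"
        using cis_Arg[of t] norm_cis[of s] by (auto simp: sgn_eq)
      then have "sin s = sin (Arg t) \<and> cos s = cos (Arg t)" by (simp add: complex_eq_iff)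
      then obtain n::int where "s = Arg t + 2 * of_int n * pi"
        by (auto simp: sin_cos_eq_iff)
      then show "s \<in> (\<lambda>n::int. Arg t + 2 * of_int n * pi) ` UNIV" by blast
    qed
  qed auto
  then have n: "{s::real. cis s = t} \<in> null_sets lborel" by (rule countable_imp_null_set_lborel)
  have "AE s in lborel. cis s \<noteq> t"
    by (rule AE_I'[OF n]) auto
  then have "AE s in uniform_measure lborel {0..2 * pi}. cis s \<noteq> t"
    by (intro AE_uniform_measureI) (auto elim: eventually_mono)
  then show ?thesis
    unfolding circle_measure_def
    by (subst AE_distr_iff) (use * in auto)
qed

text \<open>The antiderivative \<open>cis (n * t) / (\<i> * n)\<close> takes equal values at 0 and 2
  pi; n > 0 permits the division.\<close>

lemma integral_circle_power:
  assumes "n > 0" shows "(LINT \<zeta>|\<mu>. \<zeta> ^ n) = 0"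
proof -
  have d: "((\<lambda>t. cis (n * t) / (\<i> * n)) has_vector_derivative cis (n * t)) (at t within S)" for t :: real and S
  proof -
    have "((\<lambda>z. exp (\<i> * n * z) / (\<i> * n)) has_field_derivative exp (\<i> * n * of_real t)) (at (of_real t))"
      using assms by (auto intro!: derivative_eq_intros)
    from has_vector_derivative_real_field[OF this, of S] show ?thesis
      by (simp add: cis_conv_exp mult_ac)
  qed
  have "(LINT t:{0..2 * pi}|lborel. cis t ^ n) = cis (real n * (2 * pi)) / (\<i> * n) - cis (real n * 0) / (\<i> * n)"
    unfolding set_lebesgue_integral_def Complex.DeMoivre
    by (rule integral_FTC_atLeastAtMost) (auto intro!: d continuous_intros)
  also have "cis (real n * (2 * pi)) = 1"
    using Complex.DeMoivre[of "2 * pi" n] by (simp only: cis_2pi power_one)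
  finally have "(LINT t:{0..2 * pi}|lborel. cis t ^ n) = 0" by simp
  then show ?thesis
    by (subst integral_circle_measure) auto
qed

section \<open>Square integrable functions and the Riesz projection\<close>

abbreviation norm_sq :: "(complex \<Rightarrow> complex) \<Rightarrow> real" where
  "norm_sq g \<equiv> (LINT \<zeta>|\<mu>. (norm (g \<zeta>))\<^sup>2)"

abbreviation mean2 :: "(complex \<Rightarrow> complex) \<Rightarrow> real \<Rightarrow> real" where
  "mean2 f r \<equiv> (LINT \<zeta>|\<mu>. (norm (f (of_real r * \<zeta>)))\<^sup>2)"

text \<open>The same set as \<open>Lp 2\<close>, with a square in place of \<open>powr\<close> so
  that the algebra stays elementary.\<close>

definition L2 :: "(complex \<Rightarrow> complex) set" where
  "L2 = {G \<in> borel_measurable \<mu>. integrable \<mu> (\<lambda>\<zeta>. (norm (G \<zeta>))\<^sup>2)}"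

text \<open>Only the frequencies n >= 0 are recorded, since \<open>riesz_projection\<close> depends
  on no others.\<close>

definition fourier_coeff :: "(complex \<Rightarrow> complex) \<Rightarrow> nat \<Rightarrow> complex" where
  "fourier_coeff G n = (LINT \<zeta>|\<mu>. G \<zeta> * cnj \<zeta> ^ n)"

lemma L2_measurable: "G \<in> L2 \<Longrightarrow> G \<in> borel_measurable \<mu>"
  and L2_integrable: "G \<in> L2 \<Longrightarrow> integrable \<mu> (\<lambda>\<zeta>. (norm (G \<zeta>))\<^sup>2)"
  by (auto simp: L2_def)

lemma norm_powr_2: "norm x powr 2 = (norm x)\<^sup>2"
  by (cases "x = 0") (auto simp: powr_numeral)

lemma Lp_norm_2: "Lp_norm 2 f = sqrt (norm_sq f)"
  by (simp add: Lp_norm_def norm_powr_2 powr_half_sqrt)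

lemma hardy2_iff:
  "f \<in> hardy 2 \<longleftrightarrow> f holomorphic_on unit_disc \<and> (\<exists>B. \<forall>r. 0 \<le> r \<longrightarrow> r < 1 \<longrightarrow> mean2 f r \<le> B)"
  by (force simp: hardy_def bdd_above_def norm_powr_2)

lemma integrable_mult_AE_bounded:
  fixes f g :: "complex \<Rightarrow> 'a::{real_normed_field, second_countable_topology, banach}"
  assumes "integrable M f" "g \<in> borel_measurable M" "AE x in M. norm (g x) \<le> C"
  shows "integrable M (\<lambda>x. g x * f x)"
proof (rule Bochner_Integration.integrable_bound)
  show "integrable M (\<lambda>x. C * norm (f x))" using assms by auto
  show "(\<lambda>x. g x * f x) \<in> borel_measurable M" using assms by measurable
  show "AE x in M. norm (g x * f x) \<le> norm (C * norm (f x))"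
    using assms(3)
  proof eventually_elim
    case (elim x)
    then have "norm (g x) * norm (f x) \<le> C * norm (f x)" by (rule mult_right_mono) simp
    then show ?case by (simp add: norm_mult)
  qed
qed

lemma L2_mult_bounded:
  assumes "f \<in> L2" "g \<in> borel_measurable \<mu>" "AE \<zeta> in \<mu>. norm (g \<zeta>) \<le> C"
  shows "(\<lambda>\<zeta>. g \<zeta> * f \<zeta>) \<in> L2"
proof -
  have [measurable]: "f \<in> borel_measurable \<mu>" "g \<in> borel_measurable \<mu>"
    using assms L2_measurable by auto
  have "integrable \<mu> (\<lambda>\<zeta>. (norm (g \<zeta>))\<^sup>2 * (norm (f \<zeta>))\<^sup>2)"
  proof (rule integrable_mult_AE_bounded)
    show "AE \<zeta> in \<mu>. norm ((norm (g \<zeta>))\<^sup>2) \<le> C\<^sup>2"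
      using assms(3) by eventually_elim (auto intro: power_mono)
  qed (use assms L2_integrable in auto)
  then show ?thesis by (auto simp: L2_def norm_mult power_mult_distrib)
qed

lemma L2_integrable_mult:
  assumes "f \<in> L2" "g \<in> L2"
  shows "integrable \<mu> (\<lambda>\<zeta>. f \<zeta> * g \<zeta>)"
proof -
  have [measurable]: "f \<in> borel_measurable \<mu>" "g \<in> borel_measurable \<mu>"
    using assms L2_measurable by auto
  show ?thesis
  proof (rule Bochner_Integration.integrable_bound)
    show "integrable \<mu> (\<lambda>\<zeta>. (norm (f \<zeta>))\<^sup>2 + (norm (g \<zeta>))\<^sup>2)"
      using assms L2_integrable by auto
    have "norm (f x * g x) \<le> (norm (f x))\<^sup>2 + (norm (g x))\<^sup>2" for x
      using sum_squares_bound[of "norm (f x)" "norm (g x)"]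
        mult_nonneg_nonneg[OF norm_ge_zero norm_ge_zero, of "f x" "g x"] unfolding norm_mult by linarith
    then show "AE x in \<mu>. norm (f x * g x) \<le> norm ((norm (f x))\<^sup>2 + (norm (g x))\<^sup>2)"
      by auto
  qed auto
qed

lemma L2_bounded:
  assumes "g \<in> borel_measurable \<mu>" "AE \<zeta> in \<mu>. norm (g \<zeta>) \<le> C"
  shows "g \<in> L2"
  using L2_mult_bounded[of "\<lambda>_. 1" g C] assms by (simp add: L2_def)

lemma L2_continuous:
  assumes "continuous_on unit_circle g"
  shows "g \<in> L2"
proof -
  have "compact (g ` unit_circle)" using assms by (intro compact_continuous_image) auto
  then obtain C where "\<forall>x\<in>unit_circle. norm (g x) \<le> C"
    by (auto dest!: compact_imp_bounded simp: bounded_iff)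
  then show ?thesis using assms by (intro L2_bounded[where C=C] borel_measurable_circle_continuous) (auto intro!: AE_I2)
qed

lemma continuous_on_circle_dilation:
  fixes F :: "complex \<Rightarrow> complex"
  assumes "F holomorphic_on unit_disc" "0 \<le> r" "r < 1"
  shows "continuous_on unit_circle (\<lambda>\<zeta>. F (of_real r * \<zeta>))"
  using assms(2,3)
  by (intro continuous_on_compose2[OF holomorphic_on_imp_continuous_on[OF assms(1)]] continuous_intros)
    (auto simp: norm_mult)

lemma L2_dilation:
  "F holomorphic_on unit_disc \<Longrightarrow> 0 \<le> r \<Longrightarrow> r < 1 \<Longrightarrow> (\<lambda>\<zeta>. F (of_real r * \<zeta>)) \<in> L2"
  by (intro L2_continuous continuous_on_circle_dilation)

lemma L2_integrable_self: "G \<in> L2 \<Longrightarrow> integrable \<mu> G"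
  using L2_integrable_mult[of G "\<lambda>_. 1"] by (simp add: L2_def)

lemma borel_measurable_cnj [measurable (raw)]:
  "f \<in> borel_measurable M \<Longrightarrow> (\<lambda>x. cnj (f x)) \<in> borel_measurable M"
  by (rule measurable_compose[of f M borel]) (auto intro: borel_measurable_continuous_onI continuous_intros)

lemma L2_cnj: "G \<in> L2 \<Longrightarrow> (\<lambda>\<zeta>. cnj (G \<zeta>)) \<in> L2"
  by (auto simp: L2_def)

lemma L2_cmult: "G \<in> L2 \<Longrightarrow> (\<lambda>\<zeta>. c * G \<zeta>) \<in> L2"
  using L2_mult_bounded[of G "\<lambda>_. c" "norm c"] by auto

lemma L2_add:
  assumes "f \<in> L2" "g \<in> L2"
  shows "(\<lambda>\<zeta>. f \<zeta> + g \<zeta>) \<in> L2"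
proof -
  have [measurable]: "f \<in> borel_measurable \<mu>" "g \<in> borel_measurable \<mu>"
    using assms L2_measurable by auto
  have "integrable \<mu> (\<lambda>\<zeta>. (norm (f \<zeta> + g \<zeta>))\<^sup>2)"
  proof (rule Bochner_Integration.integrable_bound)
    show "integrable \<mu> (\<lambda>\<zeta>. 2 * (norm (f \<zeta>))\<^sup>2 + 2 * (norm (g \<zeta>))\<^sup>2)"
      using assms L2_integrable by auto
    have "(norm (f x + g x))\<^sup>2 \<le> 2 * (norm (f x))\<^sup>2 + 2 * (norm (g x))\<^sup>2" for x
      using power_mono[OF norm_triangle_ineq[of "f x" "g x"], of 2]
        sum_squares_bound[of "norm (f x)" "norm (g x)"] by (simp add: power2_sum)
    then show "AE x in \<mu>. norm ((norm (f x + g x))\<^sup>2)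
        \<le> norm (2 * (norm (f x))\<^sup>2 + 2 * (norm (g x))\<^sup>2)" by auto
  qed auto
  then show ?thesis by (auto simp: L2_def)
qed

lemma L2_diff: "f \<in> L2 \<Longrightarrow> g \<in> L2 \<Longrightarrow> (\<lambda>\<zeta>. f \<zeta> - g \<zeta>) \<in> L2"
  using L2_add[of f "\<lambda>\<zeta>. -1 * g \<zeta>"] L2_cmult[of g "-1"] by simp

text \<open>Nonnegativity of the square of s |f| - |g|, integrated for every real s, followed by a
  choice of s.\<close>

lemma L2_cauchy_schwarz:
  assumes "f \<in> L2" "g \<in> L2"
  shows "(LINT \<zeta>|\<mu>. norm (f \<zeta> * g \<zeta>))\<^sup>2
    \<le> (norm_sq f) * (norm_sq g)"
proof -
  let ?c = "LINT \<zeta>|\<mu>. norm (f \<zeta> * g \<zeta>)"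
  let ?a = "LINT \<zeta>|\<mu>. (norm (f \<zeta>))\<^sup>2" and ?b = "LINT \<zeta>|\<mu>. (norm (g \<zeta>))\<^sup>2"
  note i = L2_integrable[OF assms(1)] L2_integrable[OF assms(2)]
    integrable_norm[OF L2_integrable_mult[OF assms]]
  have q: "2 * s * ?c \<le> s\<^sup>2 * ?a + ?b" for s
  proof -
    have "2 * s * ?c = (LINT \<zeta>|\<mu>. 2 * s * norm (f \<zeta> * g \<zeta>))" using i by simp
    also have "\<dots> \<le> (LINT \<zeta>|\<mu>. s\<^sup>2 * (norm (f \<zeta>))\<^sup>2 + (norm (g \<zeta>))\<^sup>2)"
    proof (rule integral_mono)
      fix x
      show "2 * s * norm (f x * g x) \<le> s\<^sup>2 * (norm (f x))\<^sup>2 + (norm (g x))\<^sup>2"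
        using sum_squares_bound[of "s * norm (f x)" "norm (g x)"]
        by (simp add: norm_mult power_mult_distrib algebra_simps)
    qed (use i in auto)
    also have "\<dots> = s\<^sup>2 * ?a + ?b" using i by simp
    finally show ?thesis .
  qed
  have a: "?a \<ge> 0" and c: "?c \<ge> 0" by auto
  show ?thesis
  proof (cases "?a = 0")
    case True
    have "?c = 0"
    proof (rule ccontr)
      assume "?c \<noteq> 0"
      \<comment> \<open>For \<open>?a = 0\<close> the inequality \<open>q\<close> bounds 2 s c by b
        for every s; this s makes the left side b + 1.\<close>
      with q[of "(?b + 1) / (2 * ?c)"] True show False by auto
    qed
    then show ?thesis using True by simp
  next
    case False
    with a have "?a > 0" by linarith
    \<comment> \<open>The minimiser of s^2 a - 2 s c.\<close>
    with q[of "?c / ?a"] show ?thesis by (simp add: field_simps power2_eq_square)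
  qed
qed

section \<open>Fourier coefficients: orthogonality, Bessel's inequality, Parseval's identity\<close>

lemma integral_circle_monomials:
  "(LINT \<zeta>|\<mu>. \<zeta> ^ m * cnj \<zeta> ^ n) = (if m = n then 1 else 0)"
proof (induction m n rule: linorder_wlog)
  case (le m n)
  have "(LINT \<zeta>|\<mu>. \<zeta> ^ m * cnj \<zeta> ^ n) = (LINT \<zeta>|\<mu>. cnj (\<zeta> ^ (n - m)))"
  proof (rule Bochner_Integration.integral_cong)
    fix \<zeta> assume "\<zeta> \<in> space \<mu>"
    then have "\<zeta> * cnj \<zeta> = 1" by (simp add: complex_norm_square[symmetric])
    then have "\<zeta> ^ m * cnj \<zeta> ^ m = 1" by (simp add: power_mult_distrib[symmetric])
    then show "\<zeta> ^ m * cnj \<zeta> ^ n = cnj (\<zeta> ^ (n - m))"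
      using le by (metis complex_cnj_power le_add_diff_inverse mult.assoc mult_1 power_add)
  qed simp
  also have "\<dots> = cnj (LINT \<zeta>|\<mu>. \<zeta> ^ (n - m))" by (rule Bochner_Integration.integral_cnj)
  also have "\<dots> = (if m = n then 1 else 0)"
    using le integral_circle_power[of "n - m"] by (auto simp: circle.prob_space[unfolded space_circle_measure])
  finally show ?case .
next
  case (sym m n)
  have "(LINT \<zeta>|\<mu>. \<zeta> ^ n * cnj \<zeta> ^ m) = cnj (LINT \<zeta>|\<mu>. \<zeta> ^ m * cnj \<zeta> ^ n)"
    by (subst Bochner_Integration.integral_cnj[symmetric]) (simp add: mult.commute)
  then show ?case using sym by auto
qed

lemma L2_poly: "(\<lambda>\<zeta>. \<Sum>n<N. c n * \<zeta> ^ n) \<in> L2"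
  by (rule L2_continuous) (intro continuous_intros)

lemma fourier_coeff_poly: "fourier_coeff (\<lambda>\<zeta>. \<Sum>n<N. c n * \<zeta> ^ n) m = (if m < N then c m else 0)"
proof -
  have i: "integrable \<mu> (\<lambda>\<zeta>. c n * (\<zeta> ^ n * cnj \<zeta> ^ m))" for n
    by (intro L2_integrable_self L2_continuous continuous_intros)
  have "fourier_coeff (\<lambda>\<zeta>. \<Sum>n<N. c n * \<zeta> ^ n) m
      = (LINT \<zeta>|\<mu>. (\<Sum>n<N. c n * (\<zeta> ^ n * cnj \<zeta> ^ m)))"
    by (simp add: fourier_coeff_def sum_distrib_right mult.assoc)
  also have "\<dots> = (\<Sum>n<N. c n * (if n = m then 1 else 0))"
    using i by (simp add: integral_circle_monomials)
  finally show ?thesis by (simp add: if_distrib cong: if_cong)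
qed

lemma integral_cnj_poly_mult:
  assumes "G \<in> L2"
  shows "(LINT \<zeta>|\<mu>. cnj (\<Sum>n<N. c n * \<zeta> ^ n) * G \<zeta>) = (\<Sum>n<N. cnj (c n) * fourier_coeff G n)"
proof -
  have i: "integrable \<mu> (\<lambda>\<zeta>. cnj (c n) * (G \<zeta> * cnj \<zeta> ^ n))" for n
    by (intro integrable_mult_right L2_integrable_mult assms) (intro L2_continuous continuous_intros)
  have "(LINT \<zeta>|\<mu>. cnj (\<Sum>n<N. c n * \<zeta> ^ n) * G \<zeta>) =
      (LINT \<zeta>|\<mu>. (\<Sum>n<N. cnj (c n) * (G \<zeta> * cnj \<zeta> ^ n)))"
    by (simp add: sum_distrib_left sum_distrib_right mult_ac)
  then show ?thesis
    using i by (simp add: fourier_coeff_def)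
qed

text \<open>Kept for arbitrary coefficients because two choices are used: the Fourier coefficients
  of \<open>G\<close> give Bessel's inequality, and \<open>G = 0\<close> gives Parseval's identity
  for polynomials.\<close>

lemma L2_dist_poly:
  assumes "G \<in> L2"
  shows "(LINT \<zeta>|\<mu>. (norm (G \<zeta> - (\<Sum>n<N. c n * \<zeta> ^ n)))\<^sup>2) =
    (norm_sq G) - 2 * (\<Sum>n<N. Re (cnj (c n) * fourier_coeff G n))
    + (\<Sum>n<N. (norm (c n))\<^sup>2)"
proof -
  let ?S = "\<lambda>\<zeta>. \<Sum>n<N. c n * \<zeta> ^ n"
  have *: "(norm (a - b))\<^sup>2 = (norm a)\<^sup>2 - 2 * Re (cnj b * a) + Re (cnj b * b)" for a b :: complex
    unfolding cmod_power2 by (simp add: algebra_simps power2_eq_square)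
  have i: "integrable \<mu> (\<lambda>\<zeta>. cnj (?S \<zeta>) * G \<zeta>)"
     "integrable \<mu> (\<lambda>\<zeta>. cnj (?S \<zeta>) * ?S \<zeta>)"
    by (intro L2_integrable_mult L2_cnj assms L2_poly)+
  have "(LINT \<zeta>|\<mu>. (norm (G \<zeta> - ?S \<zeta>))\<^sup>2) =
     (norm_sq G) - 2 * (LINT \<zeta>|\<mu>. Re (cnj (?S \<zeta>) * G \<zeta>)) +
      (LINT \<zeta>|\<mu>. Re (cnj (?S \<zeta>) * ?S \<zeta>))"
    unfolding * using integrable_Re[OF i(1)] integrable_Re[OF i(2)] L2_integrable[OF assms]
    by (simp del: cnj_sum Re_sum times_complex.sel)
  also have "(LINT \<zeta>|\<mu>. Re (cnj (?S \<zeta>) * G \<zeta>)) = (\<Sum>n<N. Re (cnj (c n) * fourier_coeff G n))"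
    unfolding integral_Re[OF i(1)] integral_cnj_poly_mult[OF assms] by simp
  also have "(LINT \<zeta>|\<mu>. Re (cnj (?S \<zeta>) * ?S \<zeta>)) = (\<Sum>n<N. (norm (c n))\<^sup>2)"
    unfolding integral_Re[OF i(2)] integral_cnj_poly_mult[OF L2_poly]
    unfolding cmod_power2 by (simp add: fourier_coeff_poly power2_eq_square)
  finally show ?thesis .
qed

lemma bessel:
  assumes "G \<in> L2"
  shows "(\<Sum>n<N. (norm (fourier_coeff G n))\<^sup>2) \<le> norm_sq G"
proof -
  have "0 \<le> (LINT \<zeta>|\<mu>. (norm (G \<zeta> - (\<Sum>n<N. fourier_coeff G n * \<zeta> ^ n)))\<^sup>2)" by simp
  also have "\<dots> = (norm_sq G) - (\<Sum>n<N. (norm (fourier_coeff G n))\<^sup>2)"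
    unfolding L2_dist_poly[OF assms] by (simp add: cmod_power2 power2_eq_square flip: cmod_power2[unfolded power2_eq_square])
  finally show ?thesis by simp
qed

lemma norm_poly_integral: "(LINT \<zeta>|\<mu>. (norm (\<Sum>n<N. c n * \<zeta> ^ n))\<^sup>2) = (\<Sum>n<N. (norm (c n))\<^sup>2)"
  using L2_dist_poly[of "\<lambda>_. 0" c N] by (simp add: L2_def fourier_coeff_def)

text \<open>Geometric expansion of the Cauchy kernel, integrated term by term; the ratio has modulus
  |z| < 1 on the circle. Integrability of \<open>G\<close> suffices, which matters because
  \<open>cnj v * f\<close> need not be square integrable.\<close>

lemma riesz_projection_sums:
  assumes G: "integrable \<mu> G" and z: "z \<in> unit_disc"
  shows "(\<lambda>n. fourier_coeff G n * z ^ n) sums riesz_projection G z"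
proof -
  have [measurable]: "G \<in> borel_measurable \<mu>" using G by auto
  have nz: "norm z < 1" using z by simp
  have cn: "norm (cnj \<zeta> * z) < 1" if "\<zeta> \<in> unit_circle" for \<zeta>
    using that nz by (simp add: norm_mult)
  have int: "integrable \<mu> (\<lambda>\<zeta>. G \<zeta> * (cnj \<zeta> * z) ^ n)" for n
  proof -
    have "integrable \<mu> (\<lambda>\<zeta>. (cnj \<zeta> * z) ^ n * G \<zeta>)"
    proof (rule integrable_mult_AE_bounded[OF G])
      show "AE \<zeta> in \<mu>. norm ((cnj \<zeta> * z) ^ n) \<le> 1"
      proof (intro AE_I2)
        fix \<zeta> assume "\<zeta> \<in> space \<mu>"
        then have "norm (cnj \<zeta> * z) \<le> 1" using cn[of \<zeta>] by (intro less_imp_le) simp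
        then show "norm ((cnj \<zeta> * z) ^ n) \<le> 1" unfolding norm_power by (intro power_le_one) auto
      qed
    qed measurable
    then show ?thesis by (simp add: mult.commute)
  qed
  have "(\<lambda>n. LINT \<zeta>|\<mu>. G \<zeta> * (cnj \<zeta> * z) ^ n) sums
     (LINT \<zeta>|\<mu>. (\<Sum>n. G \<zeta> * (cnj \<zeta> * z) ^ n))"
  proof (rule sums_integral[OF int])
    show "AE \<zeta> in \<mu>. summable (\<lambda>n. norm (G \<zeta> * (cnj \<zeta> * z) ^ n))"
      using cn by (intro AE_I2) (auto simp: norm_mult norm_power intro!: summable_mult summable_geometric)
    have "(LINT \<zeta>|\<mu>. norm (G \<zeta> * (cnj \<zeta> * z) ^ n)) =
       (LINT \<zeta>|\<mu>. norm (G \<zeta>)) * norm z ^ n" for n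
      by (subst integral_mult_left_zero[symmetric], rule Bochner_Integration.integral_cong)
        (auto simp: norm_mult norm_power)
    then show "summable (\<lambda>n. LINT \<zeta>|\<mu>. norm (G \<zeta> * (cnj \<zeta> * z) ^ n))"
      using nz by (auto intro!: summable_mult summable_geometric)
  qed
  also have "(LINT \<zeta>|\<mu>. (\<Sum>n. G \<zeta> * (cnj \<zeta> * z) ^ n)) = riesz_projection G z"
    unfolding riesz_projection_def using cn
    by (intro Bochner_Integration.integral_cong)
      (auto simp: suminf_geometric suminf_mult summable_geometric divide_inverse)
  also have "(\<lambda>n. LINT \<zeta>|\<mu>. G \<zeta> * (cnj \<zeta> * z) ^ n) = (\<lambda>n. fourier_coeff G n * z ^ n)"
    by (simp add: fourier_coeff_def power_mult_distrib mult.assoc[symmetric])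
  finally show ?thesis .
qed

lemma riesz_projection_holomorphic:
  assumes "integrable \<mu> G"
  shows "riesz_projection G holomorphic_on unit_disc"
  by (rule power_series_holomorphic[where a="fourier_coeff G"])
    (use riesz_projection_sums[OF assms] in simp)

text \<open>Continuity comes from the Weierstrass M-test. The other two claims pass from partial
  sums to the limit by dominated convergence, with the sum of all \<open>norm (c n)\<close> as
  dominating constant.\<close>

lemma absolutely_summable_parseval:
  assumes c: "summable (\<lambda>n. norm (c n))" and F: "\<And>\<zeta>. \<zeta> \<in> unit_circle \<Longrightarrow> (\<lambda>n. c n * \<zeta> ^ n) sums F \<zeta>"
  shows "continuous_on unit_circle F" "fourier_coeff F n = c n"
    "(\<lambda>n. (norm (c n))\<^sup>2) sums (norm_sq F)"
proof -
  let ?S = "\<lambda>N \<zeta>. \<Sum>n<N. c n * \<zeta> ^ n"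
  have ul: "uniform_limit unit_circle ?S (\<lambda>\<zeta>. \<Sum>n. c n * \<zeta> ^ n) sequentially"
    by (rule Weierstrass_m_test[OF _ c]) (auto simp: norm_mult norm_power)
  have "continuous_on unit_circle (\<lambda>\<zeta>. \<Sum>n. c n * \<zeta> ^ n)"
    by (rule uniform_limit_theorem[OF _ ul]) (auto intro!: always_eventually continuous_intros)
  then show cont: "continuous_on unit_circle F"
    by (rule continuous_on_eq) (use F in \<open>auto simp: sums_iff\<close>)
  then have F2: "F \<in> L2" by (rule L2_continuous)
  have m[measurable]: "F \<in> borel_measurable \<mu>" "?S N \<in> borel_measurable \<mu>" for N
    using L2_measurable F2 L2_poly by auto
  have lim: "(\<lambda>N. ?S N \<zeta>) \<longlonglongrightarrow> F \<zeta>" if "\<zeta> \<in> unit_circle" for \<zeta>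
    using F[OF that] by (simp add: sums_def)
  have bd: "norm (?S N \<zeta>) \<le> suminf (\<lambda>n. norm (c n))" if "\<zeta> \<in> unit_circle" for N \<zeta>
  proof -
    have "norm (?S N \<zeta>) \<le> (\<Sum>n<N. norm (c n))"
      using that by (intro order.trans[OF norm_sum] sum_mono) (auto simp: norm_mult norm_power)
    also have "\<dots> \<le> suminf (\<lambda>n. norm (c n))" by (rule sum_le_suminf[OF c]) auto
    finally show ?thesis .
  qed
  have "(\<lambda>N. fourier_coeff (?S N) n) \<longlonglongrightarrow> fourier_coeff F n"
    unfolding fourier_coeff_def
  proof (rule integral_dominated_convergence[where w="\<lambda>_. suminf (\<lambda>n. norm (c n))"])
    show "AE \<zeta> in \<mu>. (\<lambda>N. ?S N \<zeta> * cnj \<zeta> ^ n) \<longlonglongrightarrow> F \<zeta> * cnj \<zeta> ^ n"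
      using lim by (auto intro!: AE_I2 tendsto_intros)
    show "AE \<zeta> in \<mu>. norm (?S N \<zeta> * cnj \<zeta> ^ n) \<le> suminf (\<lambda>n. norm (c n))" for N
      using bd by (auto intro!: AE_I2 simp: norm_mult norm_power)
  qed (use m in \<open>auto intro!: borel_measurable_times borel_measurable_power\<close>)
  moreover have "(\<lambda>N. fourier_coeff (?S N) n) \<longlonglongrightarrow> c n"
    unfolding fourier_coeff_poly
    by (rule tendsto_eventually) (rule eventually_mono[OF eventually_gt_at_top[of n]], simp)
  ultimately show "fourier_coeff F n = c n" by (rule LIMSEQ_unique)
  have "(\<lambda>N. LINT \<zeta>|\<mu>. (norm (?S N \<zeta>))\<^sup>2) \<longlonglongrightarrow> (norm_sq F)"
  proof (rule integral_dominated_convergence[where w="\<lambda>_. (suminf (\<lambda>n. norm (c n)))\<^sup>2"])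
    show "AE \<zeta> in \<mu>. (\<lambda>N. (norm (?S N \<zeta>))\<^sup>2) \<longlonglongrightarrow> (norm (F \<zeta>))\<^sup>2"
      using lim by (auto intro!: AE_I2 tendsto_intros)
    show "AE \<zeta> in \<mu>. norm ((norm (?S N \<zeta>))\<^sup>2) \<le> (suminf (\<lambda>n. norm (c n)))\<^sup>2" for N
      using bd by (auto intro!: AE_I2 power_mono)
  qed auto
  then show "(\<lambda>n. (norm (c n))\<^sup>2) sums (norm_sq F)"
    unfolding norm_poly_integral by (simp add: sums_def)
qed

lemma power_series_means:
  assumes f: "\<And>z. z \<in> unit_disc \<Longrightarrow> (\<lambda>n. a n * z ^ n) sums f z" and r: "0 \<le> r" "r < 1"
  shows "continuous_on unit_circle (\<lambda>\<zeta>. f (of_real r * \<zeta>))"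
    "fourier_coeff (\<lambda>\<zeta>. f (of_real r * \<zeta>)) n = a n * of_real r ^ n"
    "(\<lambda>n. (norm (a n))\<^sup>2 * r ^ (2 * n)) sums mean2 f r"
proof -
  \<comment> \<open>Convergence of the power series at a radius strictly above r gives absolute
    convergence at r.\<close>
  define s where "s = (1 + r) / 2"
  have s: "r < s" "s < 1" "0 < s" using r by (auto simp: s_def)
  have "summable (\<lambda>n. a n * of_real s ^ n)" using f[of "of_real s"] s by (auto simp: sums_iff)
  from powser_insidea[OF this, of "of_real r"] have c: "summable (\<lambda>n. norm (a n * of_real r ^ n))"
    using s r by simp
  have F: "(\<lambda>n. a n * of_real r ^ n * \<zeta> ^ n) sums f (of_real r * \<zeta>)" if "\<zeta> \<in> unit_circle" for \<zeta>
    using f[of "of_real r * \<zeta>"] that r by (simp add: norm_mult power_mult_distrib mult.assoc)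
  note P = absolutely_summable_parseval[OF c F]
  show "continuous_on unit_circle (\<lambda>\<zeta>. f (of_real r * \<zeta>))" by (rule P(1))
  show "fourier_coeff (\<lambda>\<zeta>. f (of_real r * \<zeta>)) n = a n * of_real r ^ n" by (rule P(2))
  show "(\<lambda>n. (norm (a n))\<^sup>2 * r ^ (2 * n)) sums mean2 f r"
    using P(3) r by (simp add: norm_mult norm_power power_mult_distrib power_mult[symmetric] mult.commute)
qed

text \<open>Together with the converse \<open>sum_coeffs_le_mean2\<close> this identifies bounded
  means with square summable Taylor coefficients, with the same constant.\<close>

lemma mean2_le_sum_coeffs:
  assumes f: "\<And>z. z \<in> unit_disc \<Longrightarrow> (\<lambda>n. a n * z ^ n) sums f z" and r: "0 \<le> r" "r < 1"
    and B: "\<And>N. (\<Sum>n<N. (norm (a n))\<^sup>2) \<le> B"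
  shows "mean2 f r \<le> B"
proof -
  have s: "(\<lambda>n. (norm (a n))\<^sup>2 * r ^ (2 * n)) sums mean2 f r" by (rule power_series_means(3)) (use f r in auto)
  have "(\<Sum>n<N. (norm (a n))\<^sup>2 * r ^ (2 * n)) \<le> B" for N
  proof -
  have "(\<Sum>n<N. (norm (a n))\<^sup>2 * r ^ (2 * n)) \<le> (\<Sum>n<N. (norm (a n))\<^sup>2)"
    by (intro sum_mono mult_left_le) (use r in \<open>auto intro!: power_le_one\<close>)
    with B[of N] show ?thesis by simp
  qed
  from suminf_le_const[OF sums_summable[OF s] this] show ?thesis using s by (simp add: sums_iff)
qed

lemma sum_coeffs_le_mean2:
  assumes f: "\<And>z. z \<in> unit_disc \<Longrightarrow> (\<lambda>n. a n * z ^ n) sums f z"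
    and B: "\<And>r. 0 \<le> r \<Longrightarrow> r < 1 \<Longrightarrow> mean2 f r \<le> B"
  shows "(\<Sum>n<N. (norm (a n))\<^sup>2) \<le> B"
proof -
  \<comment> \<open>For fixed N the weighted sum is a polynomial in r, so r may tend to 1 without
    any uniformity in N.\<close>
  have "((\<lambda>r. \<Sum>n<N. (norm (a n))\<^sup>2 * r ^ (2 * n)) \<longlongrightarrow> (\<Sum>n<N. (norm (a n))\<^sup>2 * 1 ^ (2 * n))) (at_left (1::real))"
    by (intro tendsto_intros)
  moreover have "\<forall>\<^sub>F r in at_left (1::real). (\<Sum>n<N. (norm (a n))\<^sup>2 * r ^ (2 * n)) \<le> B"
    unfolding eventually_at_left_field
  proof (intro exI[of _ 0] conjI allI impI)
    fix r :: real assume r: "0 < r" "r < 1"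
    have s: "(\<lambda>n. (norm (a n))\<^sup>2 * r ^ (2 * n)) sums mean2 f r"
      by (rule power_series_means(3)) (use f r in auto)
    have "(\<Sum>n<N. (norm (a n))\<^sup>2 * r ^ (2 * n)) \<le> mean2 f r"
      unfolding sums_unique[OF s]
      using s r by (intro sum_le_suminf) (auto simp: sums_iff)
    also have "\<dots> \<le> B" using B r by simp
    finally show "(\<Sum>n<N. (norm (a n))\<^sup>2 * r ^ (2 * n)) \<le> B" .
  qed simp
  ultimately show ?thesis by (auto dest: tendsto_upperbound)
qed

text \<open>The Taylor coefficients of the projection are the Fourier coefficients of
  \<open>G\<close>, so Bessel's inequality applies. This is the contractivity of P, stated without
  boundary values.\<close>

lemma riesz_projection_mean2_le:
  assumes "G \<in> L2" "0 \<le> r" "r < 1"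
  shows "mean2 (riesz_projection G) r \<le> norm_sq G"
  by (rule mean2_le_sum_coeffs[where a="fourier_coeff G"])
    (use assms in \<open>auto intro: riesz_projection_sums L2_integrable_self bessel\<close>)

lemma riesz_projection_hardy: "G \<in> L2 \<Longrightarrow> riesz_projection G \<in> hardy 2"
  using riesz_projection_mean2_le[of G] riesz_projection_holomorphic[of G] L2_integrable_self
  unfolding hardy2_iff by blast

section \<open>The Poisson kernel\<close>

text \<open>The reproducing kernel of H^2 at \<open>w\<close>: on the circle its conjugate is the
  kernel that \<open>riesz_projection\<close> integrates against at \<open>w\<close>.\<close>

definition szego :: "complex \<Rightarrow> complex \<Rightarrow> complex" where
  "szego w z = 1 / (1 - cnj w * z)"

definition poisson_kernel :: "complex \<Rightarrow> complex \<Rightarrow> real" where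
  "poisson_kernel w \<zeta> = (1 - (norm w)\<^sup>2) / (norm (\<zeta> - w))\<^sup>2"

lemma szego_denominator_nonzero:
  assumes "norm w < 1" "norm z \<le> 1" shows "1 - cnj w * z \<noteq> 0"
proof
  assume "1 - cnj w * z = 0"
  then have "norm (cnj w * z) = 1" by simp
  moreover have "norm (cnj w * z) \<le> norm w" using assms by (auto simp: norm_mult intro: mult_left_le)
  ultimately show False using assms by simp
qed

lemma norm_circle_szego_denominator:
  assumes "\<zeta> \<in> unit_circle" shows "norm (1 - cnj w * \<zeta>) = norm (\<zeta> - w)"
proof -
  have "\<zeta> * cnj \<zeta> = 1" using assms by (simp add: complex_norm_square[symmetric])
  then have "1 - cnj w * \<zeta> = \<zeta> * cnj (\<zeta> - w)" by (simp add: algebra_simps)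
  then have "norm (1 - cnj w * \<zeta>) = norm \<zeta> * norm (\<zeta> - w)"
    by (simp only: norm_mult complex_mod_cnj)
  then show ?thesis using assms by simp
qed

lemma norm_szego_sq:
  assumes "\<zeta> \<in> unit_circle" "w \<in> unit_disc"
  shows "(1 - (norm w)\<^sup>2) * (norm (szego w \<zeta>))\<^sup>2 = poisson_kernel w \<zeta>"
  using assms norm_circle_szego_denominator[of \<zeta> w]
  by (simp add: szego_def poisson_kernel_def norm_divide power_divide)

lemma poisson_kernel_pos:
  assumes "\<zeta> \<in> unit_circle" "w \<in> unit_disc" shows "poisson_kernel w \<zeta> > 0"
proof -
  have "(norm w)\<^sup>2 < 1" using assms by (simp add: power_less_one_iff abs_square_less_1)
  moreover have "\<zeta> \<noteq> w" using assms by auto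
  ultimately show ?thesis by (auto simp: poisson_kernel_def intro!: divide_pos_pos)
qed

lemma szego_holomorphic: "w \<in> unit_disc \<Longrightarrow> szego w holomorphic_on unit_disc"
  unfolding szego_def by (intro holomorphic_intros) (use szego_denominator_nonzero in auto)

lemma szego_continuous_circle: "w \<in> unit_disc \<Longrightarrow> continuous_on unit_circle (szego w)"
  unfolding szego_def by (intro continuous_intros) (use szego_denominator_nonzero in auto)

lemma poisson_kernel_continuous: "w \<in> unit_disc \<Longrightarrow> continuous_on unit_circle (poisson_kernel w)"
  unfolding poisson_kernel_def by (intro continuous_intros) auto

lemma szego_cnj_circle:
  assumes "\<zeta> \<in> unit_circle"
  shows "cnj (szego w \<zeta>) = 1 / (1 - cnj \<zeta> * w)"
  by (simp add: szego_def mult.commute)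

text \<open>The left side is the squared modulus of the Szego kernel, and \<open>szego w w\<close>
  is the inverse of 1 - |w|^2. This is what turns Cauchy's formula into Poisson's.\<close>

lemma szego_poisson_kernel:
  assumes z: "\<zeta> \<in> unit_circle" and w: "w \<in> unit_disc"
  shows "szego w \<zeta> / (1 - cnj \<zeta> * w) = szego w w * of_real (poisson_kernel w \<zeta>)"
proof -
  have nw: "norm w < 1" using w by simp
  have "of_real (1 - (norm w)\<^sup>2) * (szego w \<zeta> * cnj (szego w \<zeta>)) = of_real (poisson_kernel w \<zeta>)"
    unfolding norm_szego_sq[OF z w, symmetric] complex_norm_square[symmetric] by simp
  moreover have "szego w w * of_real (1 - (norm w)\<^sup>2) = 1"
    using szego_denominator_nonzero[OF nw, of w] nw complex_norm_square[of w]
    by (simp add: szego_def mult.commute)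
  ultimately have "szego w \<zeta> * cnj (szego w \<zeta>) = szego w w * of_real (poisson_kernel w \<zeta>)"
    by (metis mult.assoc mult.left_neutral)
  then show ?thesis using szego_cnj_circle[OF z, of w] by simp
qed

lemma cauchy_formula_circle:
  assumes F: "F holomorphic_on ball 0 R" and R: "R > 1" and z: "z \<in> unit_disc"
  shows "F z = (LINT \<zeta>|\<mu>. F \<zeta> / (1 - cnj \<zeta> * z))"
proof -
  let ?a = "\<lambda>n. (deriv ^^ n) F 0 / fact n"
  \<comment> \<open>The dilation by the midpoint of 1 and R is holomorphic on the unit disc. With r
    the inverse of that factor, \<open>F\<close> on the circle is the r-dilation of
    \<open>g\<close>, so the results on power series inside the disc apply to it.\<close>
  define g where "g = (\<lambda>z. F (of_real ((1 + R) / 2) * z))"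
  define r where "r = 1 / ((1 + R) / 2)"
  have r: "0 \<le> r" "r < 1" "(1 + R) / 2 * r = 1" using R by (auto simp: r_def field_simps)
  have g: "(\<lambda>n. ?a n * of_real ((1 + R) / 2) ^ n * z ^ n) sums g z" if "z \<in> unit_disc" for z
  proof -
    have "(1 + R) / 2 * norm z \<le> (1 + R) / 2 * 1" using that R by (intro mult_left_mono) auto
    also have "\<dots> < R" using R by simp
    finally have "of_real ((1 + R) / 2) * z \<in> ball 0 R" using R unfolding mem_ball_0 norm_mult norm_of_real by simp
    from holomorphic_power_series[OF F this] show ?thesis
      unfolding g_def diff_zero power_mult_distrib mult.assoc .
  qed
  have gr: "g (of_real r * \<zeta>) = F \<zeta>" for \<zeta>
    unfolding g_def mult.assoc[symmetric] of_real_mult[symmetric] r(3) by simp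
  have coef: "fourier_coeff F n = ?a n" for n
  proof -
    have "fourier_coeff F n = ?a n * of_real ((1 + R) / 2) ^ n * of_real r ^ n"
      using power_series_means(2)[OF g r(1,2)] unfolding gr by simp
    also have "\<dots> = ?a n * of_real ((1 + R) / 2 * r) ^ n"
      by (simp only: power_mult_distrib of_real_mult mult.assoc)
    finally show ?thesis unfolding r(3) by simp
  qed
  have "continuous_on unit_circle F"
    using power_series_means(1)[OF g r(1,2)] unfolding gr by simp
  then have "integrable \<mu> F" by (intro L2_integrable_self L2_continuous)
  from riesz_projection_sums[OF this z] have "(\<lambda>n. ?a n * z ^ n) sums riesz_projection F z"
    unfolding coef .
  moreover have "(\<lambda>n. ?a n * z ^ n) sums F z"
    using holomorphic_power_series[OF F, of z] z R by simp
  ultimately show ?thesis by (auto simp: riesz_projection_def sums_iff)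
qed

text \<open>Cauchy's formula for the product of \<open>F\<close> and the Szego kernel at \<open>w\<close>, evaluated at \<open>w\<close>.\<close>

lemma poisson_formula:
  assumes F: "F holomorphic_on ball 0 R" and R: "R > 1" and w: "w \<in> unit_disc"
  shows "F w = (LINT \<zeta>|\<mu>. of_real (poisson_kernel w \<zeta>) * F \<zeta>)"
proof -
  have nw: "norm w < 1" using w by simp
  \<comment> \<open>The Szego kernel at w has its pole at modulus 1 / |w| > 1, which the new radius
    does not exceed.\<close>
  define R' where "R' = (if w = 0 then R else min R (1 / norm w))"
  have R': "R' > 1" "R' \<le> R" using R nw by (auto simp: R'_def)
  have nz: "1 - cnj w * z \<noteq> 0" if "z \<in> ball 0 R'" for z
  proof
    assume *: "1 - cnj w * z = 0"
    then have "norm (cnj w * z) = 1" by simp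
    then have "norm w * norm z = 1" by (simp add: norm_mult)
    moreover have "norm w * norm z < 1" if "w \<noteq> 0"
      using \<open>z \<in> ball 0 R'\<close> that by (auto simp: R'_def field_simps)
    ultimately show False by fastforce
  qed
  have "(\<lambda>z. F z * szego w z) holomorphic_on ball 0 R'"
    unfolding szego_def using nz R'
    by (intro holomorphic_intros holomorphic_on_subset[OF F]) auto
  from cauchy_formula_circle[OF this R'(1) w]
  have "F w * szego w w = (LINT \<zeta>|\<mu>. F \<zeta> * szego w \<zeta> / (1 - cnj \<zeta> * w))" .
  also have "\<dots> = (LINT \<zeta>|\<mu>. szego w w * (of_real (poisson_kernel w \<zeta>) * F \<zeta>))"
  proof (rule Bochner_Integration.integral_cong)
    fix \<zeta> assume "\<zeta> \<in> space \<mu>"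
    then have z: "\<zeta> \<in> unit_circle" by simp
    show "F \<zeta> * szego w \<zeta> / (1 - cnj \<zeta> * w) = szego w w * (of_real (poisson_kernel w \<zeta>) * F \<zeta>)"
      unfolding times_divide_eq_right[symmetric] szego_poisson_kernel[OF z w] by (simp only: mult_ac)
  qed simp
  also have "\<dots> = szego w w * (LINT \<zeta>|\<mu>. of_real (poisson_kernel w \<zeta>) * F \<zeta>)" by simp
  finally show ?thesis using szego_denominator_nonzero[OF nw, of w] nw by (simp add: szego_def)
qed

text \<open>On the circle the kernel at \<open>s * \<xi>\<close> is the real part of (1 + c z) / (1
  - c z) with c the conjugate of \<open>s * \<xi>\<close>. This function is holomorphic past the
  closed disc, so the Poisson formula evaluates the integral at \<open>r * \<zeta>\<close>.\<close>

lemma poisson_kernel_semigroup: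
  assumes "0 \<le> r" "r < 1" "0 \<le> s" "s < 1" "\<zeta> \<in> unit_circle" "\<xi> \<in> unit_circle"
  shows "(LINT \<eta>|\<mu>. poisson_kernel (of_real r * \<zeta>) \<eta> * poisson_kernel (of_real s * \<xi>) \<eta>)
    = poisson_kernel (of_real (r * s) * \<zeta>) \<xi>"
proof -
  define F where "F = (\<lambda>z. (1 + cnj (of_real s * \<xi>) * z) / (1 - cnj (of_real s * \<xi>) * z))"
  have re: "Re ((1 + c) / (1 - c)) = (1 - (norm c)\<^sup>2) / (norm (1 - c))\<^sup>2" if "c \<noteq> 1" for c :: complex
    unfolding cmod_power2 by (simp add: Re_divide power2_eq_square algebra_simps)
  \<comment> \<open>R > 1, while s R < 1 because 2 s < 1 + s; the pole of \<open>F\<close> thus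
    stays outside the ball of radius R.\<close>
  define R where "R = 2 / (1 + s)"
  have R: "R > 1" using assms by (simp add: R_def)
  have nz: "1 - cnj (of_real s * \<xi>) * z \<noteq> 0" if "z \<in> ball 0 R" for z
  proof
    assume "1 - cnj (of_real s * \<xi>) * z = 0"
    then have "norm (cnj (of_real s * \<xi>) * z) = 1" by simp
    then have "s * norm z = 1" using assms by (simp add: norm_mult)
    moreover have "s * norm z \<le> s * R" using that assms by (intro mult_left_mono) auto
    moreover have "s * R < 1" using assms by (simp add: R_def field_simps)
    ultimately show False by simp
  qed
  have hol: "F holomorphic_on ball 0 R" unfolding F_def using nz by (intro holomorphic_intros) auto
  have F: "Re (F z) = (1 - (s * norm z)\<^sup>2) / (norm (1 - cnj (of_real s * \<xi>) * z))\<^sup>2" if "z \<in> ball 0 R" for z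
    unfolding F_def using nz[OF that] assms by (subst re) (auto simp: norm_mult)
  have w: "of_real r * \<zeta> \<in> unit_disc" using assms by (simp add: norm_mult)
  have cont: "continuous_on unit_circle F"
    by (rule holomorphic_on_imp_continuous_on[OF holomorphic_on_subset[OF hol]]) (use R in auto)
  have "integrable \<mu> (\<lambda>\<eta>. of_real (poisson_kernel (of_real r * \<zeta>) \<eta>) * F \<eta>)"
    by (intro L2_integrable_self L2_continuous continuous_intros cont poisson_kernel_continuous w)
  then have "Re (F (of_real r * \<zeta>)) = (LINT \<eta>|\<mu>. Re (of_real (poisson_kernel (of_real r * \<zeta>) \<eta>) * F \<eta>))"
    by (subst integral_Re) (simp_all add: poisson_formula[OF hol R w, symmetric])
  also have "\<dots> = (LINT \<eta>|\<mu>. poisson_kernel (of_real r * \<zeta>) \<eta> * poisson_kernel (of_real s * \<xi>) \<eta>)"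
  proof (rule Bochner_Integration.integral_cong)
    fix \<eta> assume "\<eta> \<in> space \<mu>"
    then have e: "\<eta> \<in> unit_circle" by simp
    have "Re (F \<eta>) = poisson_kernel (of_real s * \<xi>) \<eta>"
      using F[of \<eta>] e R assms norm_circle_szego_denominator[OF e, of "of_real s * \<xi>"]
      by (simp add: poisson_kernel_def norm_mult)
    then show "Re (of_real (poisson_kernel (of_real r * \<zeta>) \<eta>) * F \<eta>) =
      poisson_kernel (of_real r * \<zeta>) \<eta> * poisson_kernel (of_real s * \<xi>) \<eta>" by simp
  qed simp
  finally have 1: "Re (F (of_real r * \<zeta>)) = (LINT \<eta>|\<mu>. poisson_kernel (of_real r * \<zeta>) \<eta> * poisson_kernel (of_real s * \<xi>) \<eta>)" .
  have "of_real r * \<zeta> \<in> ball 0 R" using w R by auto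
  from F[OF this] have 2: "Re (F (of_real r * \<zeta>)) = (1 - (s * r)\<^sup>2) / (norm (1 - cnj (of_real s * \<xi>) * (of_real r * \<zeta>)))\<^sup>2"
    using assms by (simp add: norm_mult)
  have "1 - cnj (of_real s * \<xi>) * (of_real r * \<zeta>) = cnj (1 - cnj (of_real (r * s) * \<zeta>) * \<xi>)"
    by (simp add: mult_ac)
  then have "norm (1 - cnj (of_real s * \<xi>) * (of_real r * \<zeta>)) = norm (cnj (1 - cnj (of_real (r * s) * \<zeta>) * \<xi>))"
    by (simp only:)
  also have "\<dots> = norm (\<xi> - of_real (r * s) * \<zeta>)"
    unfolding complex_mod_cnj by (rule norm_circle_szego_denominator) fact
  finally show ?thesis using 1 2 assms by (simp add: poisson_kernel_def norm_mult mult.commute)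
qed

text \<open>For r <= s the numerators compare with a factor 2, as 1 - (r s)^2 <= 1 - r^4 <= 2 (1 -
  r^2). The two base points are r (1 - s) <= 1 - r s apart, so the distances to \<open>\<xi>\<close>
  compare with a factor 2 as well, which enters squared: 8 = 2 * 4.\<close>

lemma poisson_kernel_product_radius_le:
  assumes "0 \<le> r" "r \<le> s" "s < 1" "\<zeta> \<in> unit_circle" "\<xi> \<in> unit_circle"
  shows "poisson_kernel (of_real (r * s) * \<zeta>) \<xi> \<le> 8 * poisson_kernel (of_real r * \<zeta>) \<xi>"
proof -
  have rs: "r * s < 1" "r * r \<le> r * s" "r * s \<le> r" "r < 1"
    using assms mult_left_mono[of r s r] mult_left_le[of s r] by (auto simp: mult.commute)
  have n1: "norm (\<xi> - of_real (r * s) * \<zeta>) \<ge> 1 - r * s"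
    using norm_triangle_ineq2[of \<xi> "of_real (r * s) * \<zeta>"] assms by (simp add: norm_mult)
  have "norm (\<xi> - of_real r * \<zeta>) = norm ((\<xi> - of_real (r * s) * \<zeta>) - of_real (r * (1 - s)) * \<zeta>)"
    by (simp add: algebra_simps)
  also have "\<dots> \<le> norm (\<xi> - of_real (r * s) * \<zeta>) + r * (1 - s)"
    using norm_triangle_ineq4[of "\<xi> - of_real (r * s) * \<zeta>" "of_real (r * (1 - s)) * \<zeta>"] assms
    unfolding norm_mult[of "of_real (r * (1 - s))"] norm_of_real by simp
  also have "r * (1 - s) \<le> norm (\<xi> - of_real (r * s) * \<zeta>)" using n1 rs by (simp add: algebra_simps)
  finally have n2: "norm (\<xi> - of_real r * \<zeta>) \<le> 2 * norm (\<xi> - of_real (r * s) * \<zeta>)" by simp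
  have p: "norm (\<xi> - of_real r * \<zeta>) > 0" "norm (\<xi> - of_real (r * s) * \<zeta>) > 0"
    using n1 rs norm_triangle_ineq2[of \<xi> "of_real r * \<zeta>"] assms by (auto simp: norm_mult)
  have rr: "0 \<le> 1 - r\<^sup>2" using assms rs by (simp add: abs_square_le_1)
  have "(r * r)\<^sup>2 \<le> (r * s)\<^sup>2" using rs by (intro power_mono) auto
  moreover have "1 - (r * r)\<^sup>2 = (1 - r\<^sup>2) * (1 + r\<^sup>2)" by (simp add: power2_eq_square algebra_simps)
  moreover have "(1 - r\<^sup>2) * (1 + r\<^sup>2) \<le> (1 - r\<^sup>2) * 2" using rr by (intro mult_left_mono) auto
  ultimately have num: "1 - (r * s)\<^sup>2 \<le> 2 * (1 - r\<^sup>2)" by linarith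
  have "poisson_kernel (of_real (r * s) * \<zeta>) \<xi> \<le> (2 * (1 - r\<^sup>2)) / (norm (\<xi> - of_real (r * s) * \<zeta>))\<^sup>2"
    using assms num by (simp add: poisson_kernel_def norm_mult divide_right_mono)
  also have "\<dots> \<le> (2 * (1 - r\<^sup>2)) / ((norm (\<xi> - of_real r * \<zeta>) / 2)\<^sup>2)"
    using n2 p rr by (intro divide_left_mono power_mono) (auto intro!: mult_nonneg_nonneg mult_pos_pos zero_less_power)
  also have "\<dots> = 8 * poisson_kernel (of_real r * \<zeta>) \<xi>"
    using assms by (simp add: poisson_kernel_def norm_mult power_divide)
  finally show ?thesis .
qed

lemma poisson_kernel_swap:
  assumes "\<zeta> \<in> unit_circle" "\<xi> \<in> unit_circle"
  shows "poisson_kernel (of_real r * \<zeta>) \<xi> = poisson_kernel (of_real r * \<xi>) \<zeta>"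
proof -
  have "norm (\<xi> - of_real r * \<zeta>) = norm (1 - cnj (of_real r * \<zeta>) * \<xi>)"
    using norm_circle_szego_denominator[of \<xi> "of_real r * \<zeta>"] assms by simp
  also have "1 - cnj (of_real r * \<zeta>) * \<xi> = cnj (1 - cnj (of_real r * \<xi>) * \<zeta>)" by simp
  also have "norm \<dots> = norm (\<zeta> - of_real r * \<xi>)"
    unfolding complex_mod_cnj using norm_circle_szego_denominator[of \<zeta> "of_real r * \<xi>"] assms by simp
  finally show ?thesis using assms by (simp add: poisson_kernel_def norm_mult)
qed

text \<open>The term with the smaller radius suffices. The symmetric sum avoids saying which radius
  that is, so the radii may vary freely with the point.\<close>

lemma poisson_kernel_convolution_le:
  assumes "0 \<le> r" "r < 1" "0 \<le> s" "s < 1" "\<zeta> \<in> unit_circle" "\<xi> \<in> unit_circle"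
  shows "(LINT \<eta>|\<mu>. poisson_kernel (of_real r * \<zeta>) \<eta> * poisson_kernel (of_real s * \<xi>) \<eta>)
    \<le> 8 * (poisson_kernel (of_real r * \<zeta>) \<xi> + poisson_kernel (of_real s * \<xi>) \<zeta>)"
proof -
  have p: "poisson_kernel (of_real r * \<zeta>) \<xi> \<ge> 0" "poisson_kernel (of_real s * \<xi>) \<zeta> \<ge> 0"
    using assms by (auto intro!: less_imp_le poisson_kernel_pos simp: norm_mult)
  show ?thesis
  proof (cases "r \<le> s")
    case True
    with poisson_kernel_product_radius_le[of r s \<zeta> \<xi>] p poisson_kernel_semigroup[OF assms] assms
    show ?thesis by simp
  next
    case False
    with poisson_kernel_product_radius_le[of s r \<xi> \<zeta>] p poisson_kernel_semigroup[OF assms] assms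
      poisson_kernel_swap[of \<zeta> \<xi> "r * s"]
    show ?thesis by (simp add: mult.commute)
  qed
qed

section \<open>The radial maximal function\<close>

lemma (in finite_measure) integrable_bounded:
  fixes f :: "'a \<Rightarrow> 'b::{banach, second_countable_topology}"
  assumes "f \<in> borel_measurable M" "\<And>x. x \<in> space M \<Longrightarrow> norm (f x) \<le> C"
  shows "integrable M f"
  using assms by (intro integrable_const_bound[where B=C]) auto

lemma (in prob_space) integral_bounded_le:
  fixes f :: "'a \<Rightarrow> real"
  assumes "f \<in> borel_measurable M" "\<And>x. x \<in> space M \<Longrightarrow> 0 \<le> f x \<and> f x \<le> C"
  shows "0 \<le> (LINT x|M. f x)" "(LINT x|M. f x) \<le> C"
proof -
  have i: "integrable M f" using assms by (intro integrable_bounded[where C=C]) auto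
  show "0 \<le> (LINT x|M. f x)" using assms by (intro Bochner_Integration.integral_nonneg) auto
  have "(LINT x|M. f x) \<le> (LINT x|M. C)" using assms i by (intro integral_mono) auto
  then show "(LINT x|M. f x) \<le> C" using prob_space by simp
qed

text \<open>Fubini's theorem; boundedness of all three factors gives integrability on the product
  space.\<close>

lemma (in prob_space) bounded_kernel_adjoint:
  fixes K :: "'a \<Rightarrow> 'a \<Rightarrow> real"
  assumes K[measurable]: "(\<lambda>(x, y). K x y) \<in> borel_measurable (M \<Otimes>\<^sub>M M)"
    and Kb: "\<And>x y. x \<in> space M \<Longrightarrow> y \<in> space M \<Longrightarrow> \<bar>K x y\<bar> \<le> b"
    and g[measurable]: "g \<in> borel_measurable M" and gb: "\<And>x. x \<in> space M \<Longrightarrow> \<bar>g x\<bar> \<le> B"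
    and h[measurable]: "h \<in> borel_measurable M" and hb: "\<And>x. x \<in> space M \<Longrightarrow> \<bar>h x\<bar> \<le> C"
  shows "(LINT x|M. h x * (LINT y|M. K x y * g y)) = (LINT y|M. g y * (LINT x|M. K x y * h x))"
proof -
  interpret P: pair_prob_space M M ..
  have "integrable (M \<Otimes>\<^sub>M M) (\<lambda>(x, y). h x * (K x y * g y))"
  proof (rule P.integrable_bounded[where C="C * (b * B)"])
    fix p assume "p \<in> space (M \<Otimes>\<^sub>M M)"
    then have p: "fst p \<in> space M" "snd p \<in> space M" by (auto simp: space_pair_measure)
    have "\<bar>h (fst p)\<bar> * (\<bar>K (fst p) (snd p)\<bar> * \<bar>g (snd p)\<bar>) \<le> C * (b * B)"
      using hb[OF p(1)] Kb[OF p] gb[OF p(2)] by (intro mult_mono) auto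
    then show "norm (case p of (x, y) \<Rightarrow> h x * (K x y * g y)) \<le> C * (b * B)"
      by (simp add: split_beta abs_mult)
  qed measurable
  from P.Fubini_integral[OF this]
  have "(LINT y|M. LINT x|M. h x * (K x y * g y)) = (LINT x|M. LINT y|M. h x * (K x y * g y))" .
  moreover have "(LINT x|M. h x * (K x y * g y)) = g y * (LINT x|M. K x y * h x)" for y
    by (subst integral_mult_right_zero[symmetric]) (simp add: mult_ac)
  ultimately show ?thesis by simp
qed

text \<open>
  The \<open>TT*\<close> method: the hypothesis says \<open>TT* \<le> c (T + T*)\<close> for the operator \<open>T\<close> with kernel \<open>K\<close>,
  hence \<open>\<parallel>T* h\<parallel>\<^sup>2 \<le> 2 c \<langle>h, T* h\<rangle>\<close> and \<open>\<parallel>T\<parallel> \<le> 2 c\<close>.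
\<close>

lemma (in prob_space) positive_kernel_norm_le:
  fixes K :: "'a \<Rightarrow> 'a \<Rightarrow> real"
  assumes K[measurable]: "(\<lambda>(x, y). K x y) \<in> borel_measurable (M \<Otimes>\<^sub>M M)"
    and Kb: "\<And>x y. x \<in> space M \<Longrightarrow> y \<in> space M \<Longrightarrow> 0 \<le> K x y \<and> K x y \<le> b"
    and KK: "\<And>x y. x \<in> space M \<Longrightarrow> y \<in> space M \<Longrightarrow> (LINT z|M. K x z * K y z) \<le> c * (K x y + K y x)"
    and c: "c > 0"
    and g[measurable]: "g \<in> borel_measurable M" and gb: "\<And>x. x \<in> space M \<Longrightarrow> 0 \<le> g x \<and> g x \<le> B"
  shows "(LINT x|M. (LINT y|M. K x y * g y)\<^sup>2) \<le> 4 * c\<^sup>2 * (LINT y|M. (g y)\<^sup>2)"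
proof -
  have [measurable]: "(\<lambda>(x, y). K y x) \<in> borel_measurable (M \<Otimes>\<^sub>M M)"
    using measurable_compose[OF measurable_pair_swap' K] by (simp add: split_beta')
  have Kx[measurable]: "K x \<in> borel_measurable M" "(\<lambda>y. K y x) \<in> borel_measurable M" if "x \<in> space M" for x
    using measurable_compose[OF measurable_Pair1'[OF that] K]
       measurable_compose[OF measurable_Pair2'[OF that] K] by auto
  \<comment> \<open>\<open>A\<close> is the operator \<open>T\<close> and \<open>S\<close> is
    \<open>T*\<close>. Boundedness and nonnegativity are propagated through both so that every
    integral below is finite and can be absorbed.\<close>
  define A where "A = (\<lambda>h x. LINT y|M. K x y * h y)"
  define S where "S = (\<lambda>h y. LINT x|M. K x y * h x)"
  have b: "0 \<le> b" using Kb not_empty by fastforce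
  have meas[measurable]: "A h \<in> borel_measurable M" "S h \<in> borel_measurable M"
    if [measurable]: "h \<in> borel_measurable M" for h :: "'a \<Rightarrow> real"
    unfolding A_def S_def by measurable
  have pr: "0 \<le> K x y * t" "K x y * t \<le> b * D" if "0 \<le> t \<and> t \<le> D" "x \<in> space M" "y \<in> space M" for x y and t D :: real
    using Kb[OF that(2,3)] that b by (auto intro: mult_mono)
  have bdd: "0 \<le> A h x \<and> A h x \<le> b * D" "0 \<le> S h x \<and> S h x \<le> b * D"
    if "h \<in> borel_measurable M" "\<And>x. x \<in> space M \<Longrightarrow> 0 \<le> h x \<and> h x \<le> D" "x \<in> space M" for h :: "'a \<Rightarrow> real" and D :: real and x
    unfolding A_def S_def using that Kx[OF that(3)]
    by (auto intro!: integral_bounded_le[where C="b * D"] pr)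
  have int: "integrable M (\<lambda>x. h x * k x)"
    if "h \<in> borel_measurable M" "\<And>x. x \<in> space M \<Longrightarrow> 0 \<le> h x \<and> h x \<le> D"
       "k \<in> borel_measurable M" "\<And>x. x \<in> space M \<Longrightarrow> 0 \<le> k x \<and> k x \<le> E" for h k :: "'a \<Rightarrow> real" and D E :: real
  proof (rule integrable_bounded[where C="D * E"])
    fix x assume "x \<in> space M"
    with that(2,4)[of x] show "norm (h x * k x) \<le> D * E" by (auto simp: abs_mult intro!: mult_mono)
  qed (use that in auto)
  have adj: "(LINT x|M. h x * A k x) = (LINT y|M. k y * S h y)"
    if "h \<in> borel_measurable M" "\<And>x. x \<in> space M \<Longrightarrow> 0 \<le> h x \<and> h x \<le> D"
       "k \<in> borel_measurable M" "\<And>x. x \<in> space M \<Longrightarrow> 0 \<le> k x \<and> k x \<le> E" for h k :: "'a \<Rightarrow> real" and D E :: real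
    unfolding A_def S_def
    by (rule bounded_kernel_adjoint[OF K, where b=b and B=E and C=D]) (use that Kb in auto)
  have star: "(LINT y|M. (S h y)\<^sup>2) \<le> 4 * c\<^sup>2 * (LINT y|M. (h y)\<^sup>2)"
    if h[measurable]: "h \<in> borel_measurable M" and hb: "\<And>x. x \<in> space M \<Longrightarrow> 0 \<le> h x \<and> h x \<le> D" for h :: "'a \<Rightarrow> real" and D :: real
  proof -
    note Sb = bdd(2)[OF h hb] and Ab = bdd(1)[OF h hb]
    have D: "0 \<le> D" using hb not_empty by fastforce
    have AS: "A (S h) x \<le> c * (A h x + S h x)" if x[measurable]: "x \<in> space M" for x
    proof -
      note Km = Kx[OF x]
      have KB: "\<And>y. y \<in> space M \<Longrightarrow> 0 \<le> K x y \<and> K x y \<le> b" "\<And>y. y \<in> space M \<Longrightarrow> 0 \<le> K y x \<and> K y x \<le> b"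
        using Kb x by auto
      note ints = int[OF Km(1) KB(1) h hb] int[OF Km(2) KB(2) h hb]
      have "A (S h) x = (LINT y|M. K x y * S h y)" by (simp add: A_def)
      also have "\<dots> = (LINT z|M. h z * A (K x) z)"
        by (rule adj[OF h hb Km(1) KB(1), symmetric])
      also have "\<dots> \<le> (LINT z|M. c * (K x z * h z + K z x * h z))"
      proof (rule integral_mono)
        show "integrable M (\<lambda>z. h z * A (K x) z)"
          by (rule int[OF h hb meas(1)[OF Km(1)] bdd(1)[OF Km(1) KB(1)]])
        show "integrable M (\<lambda>z. c * (K x z * h z + K z x * h z))" using ints by auto
        fix z assume z: "z \<in> space M"
        have "A (K x) z = (LINT y|M. K x y * K z y)" by (simp add: A_def mult.commute)
        also have "\<dots> \<le> c * (K x z + K z x)" using KK[OF x z] .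
        finally have "h z * A (K x) z \<le> h z * (c * (K x z + K z x))" using hb[OF z] by (intro mult_left_mono) auto
        then show "h z * A (K x) z \<le> c * (K x z * h z + K z x * h z)" by (simp add: algebra_simps)
      qed
      also have "\<dots> = c * (A h x + S h x)"
        using ints by (simp add: A_def S_def)
      finally show ?thesis .
    qed
    have i: "integrable M (\<lambda>x. h x * A h x)" "integrable M (\<lambda>x. h x * S h x)"
      "integrable M (\<lambda>x. h x * A (S h) x)" "integrable M (\<lambda>x. S h x * S h x)" "integrable M (\<lambda>x. h x * h x)"
    proof -
      show "integrable M (\<lambda>x. h x * A h x)" by (rule int[OF h hb _ Ab]) auto
      show "integrable M (\<lambda>x. h x * S h x)" by (rule int[OF h hb _ Sb]) auto
      show "integrable M (\<lambda>x. S h x * S h x)" by (rule int[OF _ Sb _ Sb]) auto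
      show "integrable M (\<lambda>x. h x * h x)" by (rule int[OF h hb h hb]) auto
      show "integrable M (\<lambda>x. h x * A (S h) x)" by (rule int[OF h hb _ bdd(1)[OF _ Sb]]) auto
    qed
    have "(LINT y|M. S h y * S h y) = (LINT x|M. h x * A (S h) x)"
      by (rule adj[OF h hb _ Sb, symmetric]) auto
    also have "\<dots> \<le> (LINT x|M. c * (h x * A h x + h x * S h x))"
    proof (rule integral_mono)
      fix x assume x: "x \<in> space M"
      have "h x * A (S h) x \<le> h x * (c * (A h x + S h x))" using AS[OF x] hb[OF x] by (intro mult_left_mono) auto
      then show "h x * A (S h) x \<le> c * (h x * A h x + h x * S h x)" by (simp add: algebra_simps)
    qed (use i in auto)
    \<comment> \<open>Adjointness with both arguments equal to \<open>h\<close> makes the integrals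
      of \<open>h * A h\<close> and \<open>h * S h\<close> coincide.\<close>
    also have "\<dots> = 2 * c * (LINT x|M. h x * S h x)"
      using i adj[OF h hb h hb] by (simp add: algebra_simps)
    also have "\<dots> = (LINT x|M. 2 * c * (h x * S h x))" by simp
    \<comment> \<open>The weights are chosen so that the last term is half of the quantity being
      estimated and can be subtracted from both sides.\<close>
    also have "\<dots> \<le> (LINT x|M. 2 * c\<^sup>2 * (h x * h x) + (1/2) * (S h x * S h x))"
    proof (rule integral_mono)
      fix x show "2 * c * (h x * S h x) \<le> 2 * c\<^sup>2 * (h x * h x) + (1/2) * (S h x * S h x)"
        using sum_squares_bound[of "2 * c * h x" "S h x"] by (simp add: power2_eq_square algebra_simps)
    qed (use i in auto)
    also have "\<dots> = 2 * c\<^sup>2 * (LINT x|M. h x * h x) + (1/2) * (LINT x|M. S h x * S h x)"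
      using i by simp
    finally show ?thesis by (simp add: power2_eq_square)
  qed
  \<comment> \<open>Back from the adjoint to the operator: the squared norm of \<open>A g\<close> is
    the pairing of \<open>g\<close> with \<open>S (A g)\<close>, and \<open>star\<close> at
    \<open>A g\<close> is absorbed in the same way.\<close>
  note Ag = bdd(1)[OF g gb]
  note SAg = bdd(2)[OF meas(1)[OF g] Ag]
  have i: "integrable M (\<lambda>x. g x * S (A g) x)" "integrable M (\<lambda>x. g x * g x)" "integrable M (\<lambda>x. S (A g) x * S (A g) x)"
    by (rule int[OF g gb _ SAg], simp_all, rule int[OF g gb g gb], simp_all, rule int[OF _ SAg _ SAg], simp_all)
  have st: "(LINT y|M. (S (A g) y)\<^sup>2) \<le> 4 * c\<^sup>2 * (LINT y|M. (A g y)\<^sup>2)"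
    by (rule star[OF _ Ag]) auto
  have "4 * c\<^sup>2 * (LINT x|M. A g x * A g x) = 4 * c\<^sup>2 * (LINT x|M. g x * S (A g) x)"
    by (subst adj[OF _ Ag g gb]) auto
  also have "\<dots> = (LINT x|M. 4 * c\<^sup>2 * (g x * S (A g) x))" by simp
  also have "\<dots> \<le> (LINT x|M. 8 * c^4 * (g x * g x) + (1/2) * (S (A g) x * S (A g) x))"
  proof (rule integral_mono)
    fix x show "4 * c\<^sup>2 * (g x * S (A g) x) \<le> 8 * c^4 * (g x * g x) + (1/2) * (S (A g) x * S (A g) x)"
      using sum_squares_bound[of "4 * c\<^sup>2 * g x" "S (A g) x"] by (simp add: power2_eq_square power4_eq_xxxx algebra_simps)
  qed (use i in auto)
  also have "\<dots> = 8 * c^4 * (LINT x|M. g x * g x) + (1/2) * (LINT x|M. S (A g) x * S (A g) x)"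
    using i by simp
  also have "\<dots> \<le> 8 * c^4 * (LINT x|M. g x * g x) + 2 * c\<^sup>2 * (LINT x|M. A g x * A g x)"
    using st by (simp add: power2_eq_square)
  finally have "2 * c\<^sup>2 * (LINT x|M. A g x * A g x) \<le> 2 * c\<^sup>2 * (4 * c\<^sup>2 * (LINT x|M. g x * g x))"
    by (simp add: power2_eq_square power4_eq_xxxx algebra_simps)
  then have "(LINT x|M. A g x * A g x) \<le> 4 * c\<^sup>2 * (LINT x|M. g x * g x)"
    by (rule mult_left_le_imp_le) (use c in auto)
  then show ?thesis by (simp add: A_def power2_eq_square)
qed

text \<open>Linearisation of the maximum: once a radius attaining it is chosen measurably at each
  point, the maximum is dominated by one positive integral operator. The kernel estimate with c = 8
  gives 4 * 8^2 = 256 for every finite \<open>I\<close>.\<close>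

lemma max_radius_inequality:
  assumes F: "F holomorphic_on ball 0 R" and R: "R > 1"
    and I: "finite I" "I \<noteq> {}" "I \<subseteq> {0..<1}"
  shows "(LINT \<zeta>|\<mu>. (Max ((\<lambda>r. norm (F (of_real r * \<zeta>))) ` I))\<^sup>2)
    \<le> 256 * (norm_sq F)"
proof -
  have cF: "continuous_on (cball 0 1) F"
    by (rule holomorphic_on_imp_continuous_on[OF holomorphic_on_subset[OF F]]) (use R in auto)
  have cFr[measurable]: "(\<lambda>\<zeta>. F (of_real r * \<zeta>)) \<in> borel_measurable \<mu>" if "r \<in> I" for r
  proof (rule borel_measurable_circle_continuous, rule continuous_on_compose2[OF cF])
    show "(\<lambda>\<zeta>. of_real r * \<zeta>) ` unit_circle \<subseteq> cball 0 1" using that I by (auto simp: norm_mult)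
  qed (intro continuous_intros)
  have cF1: "continuous_on unit_circle F" by (rule continuous_on_subset[OF cF]) auto
  have [measurable]: "F \<in> borel_measurable \<mu>" by (rule borel_measurable_circle_continuous[OF cF1])
  have "compact (F ` cball 0 1)" using cF by (intro compact_continuous_image) auto
  then have "bounded (F ` cball 0 1)" by (rule compact_imp_bounded)
  then obtain B where B: "\<And>z. z \<in> cball 0 1 \<Longrightarrow> norm (F z) \<le> B"
    unfolding bounded_iff by blast
  let ?m = "\<lambda>\<zeta>. Max ((\<lambda>r. norm (F (of_real r * \<zeta>))) ` I)"
  have mm[measurable]: "?m \<in> borel_measurable \<mu>"
    using I cFr by (intro borel_measurable_Max) auto
  \<comment> \<open>The least maximising radius. The default 1 exceeds every element of
    \<open>I\<close>, and some radius attains the maximum, so the default is never selected. As a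
    minimum of finitely many measurable functions \<open>rad\<close> is measurable.\<close>
  define rad where "rad = (\<lambda>\<zeta>. Min ((\<lambda>r. if norm (F (of_real r * \<zeta>)) = ?m \<zeta> then r else 1) ` I))"
  have radI: "rad \<zeta> \<in> I \<and> norm (F (of_real (rad \<zeta>) * \<zeta>)) = ?m \<zeta>" for \<zeta>
  proof -
    let ?v = "\<lambda>r. if norm (F (of_real r * \<zeta>)) = ?m \<zeta> then r else 1"
    have "?m \<zeta> \<in> (\<lambda>r. norm (F (of_real r * \<zeta>))) ` I" using I by (intro Max_in) auto
    then obtain r0 where r0: "r0 \<in> I" "norm (F (of_real r0 * \<zeta>)) = ?m \<zeta>" by force
    have "rad \<zeta> \<in> ?v ` I" unfolding rad_def using I by (intro Min_in) auto
    then obtain r1 where r1: "r1 \<in> I" "rad \<zeta> = ?v r1" by blast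
    have "rad \<zeta> \<le> ?v r0" unfolding rad_def using I r0(1) by (intro Min_le) auto
    moreover have "?v r0 = r0" "r0 < 1" using r0 I by auto
    ultimately have "?v r1 < 1" using r1(2) by linarith
    then have "norm (F (of_real r1 * \<zeta>)) = ?m \<zeta>" by (auto split: if_splits)
    then show ?thesis using r1 by simp
  qed
  have rad_meas[measurable]: "rad \<in> borel_measurable \<mu>"
    unfolding rad_def
  proof (rule borel_measurable_Min[OF I(1)])
    fix r assume [measurable]: "r \<in> I"
    show "(\<lambda>\<zeta>. if norm (F (of_real r * \<zeta>)) = ?m \<zeta> then r else 1) \<in> borel_measurable \<mu>"
      by measurable
  qed
  define K where "K = (\<lambda>\<zeta> \<eta>. poisson_kernel (of_real (rad \<zeta>) * \<zeta>) \<eta>)"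
  have w: "of_real (rad \<zeta>) * \<zeta> \<in> unit_disc" "0 \<le> rad \<zeta>" "rad \<zeta> < 1" if "\<zeta> \<in> unit_circle" for \<zeta>
    using radI[of \<zeta>] I that by (auto simp: norm_mult)
  \<comment> \<open>This bound depends on \<open>I\<close>; it secures integrability and does not
    enter the final constant.\<close>
  define b where "b = Max ((\<lambda>r. 1 / (1 - r)\<^sup>2) ` I)"
  have Kb: "0 \<le> K \<zeta> \<eta> \<and> K \<zeta> \<eta> \<le> b" if "\<zeta> \<in> unit_circle" "\<eta> \<in> unit_circle" for \<zeta> \<eta>
  proof
    show "0 \<le> K \<zeta> \<eta>" unfolding K_def using that w by (intro less_imp_le poisson_kernel_pos) auto
    have "norm (\<eta> - of_real (rad \<zeta>) * \<zeta>) \<ge> 1 - rad \<zeta>"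
      using norm_triangle_ineq2[of \<eta> "of_real (rad \<zeta>) * \<zeta>"] that w by (simp add: norm_mult)
    then have "K \<zeta> \<eta> \<le> 1 / (1 - rad \<zeta>)\<^sup>2"
      unfolding K_def poisson_kernel_def using that w[OF that(1)] by (intro frac_le power_mono) auto
    also have "\<dots> \<le> b" unfolding b_def using I radI by (intro Max_ge) auto
    finally show "K \<zeta> \<eta> \<le> b" .
  qed
  have "(LINT x|\<mu>. (LINT y|\<mu>. K x y * norm (F y))\<^sup>2)
     \<le> 4 * 8\<^sup>2 * (LINT y|\<mu>. (norm (F y))\<^sup>2)"
  proof (rule circle.positive_kernel_norm_le)
    show "(\<lambda>(x, y). K x y) \<in> borel_measurable (\<mu> \<Otimes>\<^sub>M \<mu>)"
      unfolding K_def poisson_kernel_def by measurable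
    show "0 \<le> K x y \<and> K x y \<le> b" if "x \<in> space \<mu>" "y \<in> space \<mu>" for x y
      using Kb that by simp
    \<comment> \<open>Here \<open>x\<close> and \<open>y\<close> carry their own radii
      \<open>rad x\<close> and \<open>rad y\<close>, hence the need for a convolution bound with
      unrelated radii.\<close>
    show "(LINT z|\<mu>. K x z * K y z) \<le> 8 * (K x y + K y x)"
      if "x \<in> space \<mu>" "y \<in> space \<mu>" for x y
      unfolding K_def using that w by (intro poisson_kernel_convolution_le) auto
    show "0 \<le> norm (F x) \<and> norm (F x) \<le> B" if "x \<in> space \<mu>" for x
      using B that by auto
  qed auto
  moreover have "(LINT x|\<mu>. (?m x)\<^sup>2) \<le> (LINT x|\<mu>. (LINT y|\<mu>. K x y * norm (F y))\<^sup>2)"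
  proof (rule integral_mono)
    show "integrable \<mu> (\<lambda>x. (?m x)\<^sup>2)"
    proof (rule circle.integrable_bounded[where C="B\<^sup>2"])
      fix x assume "x \<in> space \<mu>"
      then have "of_real (rad x) * x \<in> cball 0 1" using w[of x] by auto
      from B[OF this] radI[of x] have "?m x \<le> B" by simp
      moreover have "?m x \<ge> 0" using radI[of x] norm_ge_zero by metis
      ultimately show "norm ((?m x)\<^sup>2) \<le> B\<^sup>2" by (simp add: power_mono)
    qed measurable
    have cK: "continuous_on unit_circle (K x)" if "x \<in> unit_circle" for x
      unfolding K_def using w[OF that] by (intro poisson_kernel_continuous)
    have int: "integrable \<mu> (\<lambda>y. of_real (K x y) * F y)" if "x \<in> unit_circle" for x
      by (intro L2_integrable_self L2_continuous continuous_intros cK that cF1)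
    have "0 \<le> B" using B[of 0] norm_ge_zero[of "F 0"] by (simp, linarith)
    show "integrable \<mu> (\<lambda>x. (LINT y|\<mu>. K x y * norm (F y))\<^sup>2)"
    proof (rule circle.integrable_bounded[where C="(b * B)\<^sup>2"])
      show "(\<lambda>x. (LINT y|\<mu>. K x y * norm (F y))\<^sup>2) \<in> borel_measurable \<mu>"
        unfolding K_def poisson_kernel_def by measurable
      fix x assume x: "x \<in> space \<mu>"
      have [measurable]: "K x \<in> borel_measurable \<mu>"
        using cK x by (intro borel_measurable_circle_continuous) auto
      have "0 \<le> K x y * norm (F y) \<and> K x y * norm (F y) \<le> b * B" if "y \<in> space \<mu>" for y
        using Kb[of x y] B[of y] x that \<open>0 \<le> B\<close> by (auto intro: mult_mono)
      then have "0 \<le> (LINT y|\<mu>. K x y * norm (F y))" "(LINT y|\<mu>. K x y * norm (F y)) \<le> b * B"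
        by (auto intro!: circle.integral_bounded_le[where C="b * B"])
      then show "norm ((LINT y|\<mu>. K x y * norm (F y))\<^sup>2) \<le> (b * B)\<^sup>2"
        by (simp add: power_mono)
    qed
    fix x assume x: "x \<in> space \<mu>"
    then have x': "x \<in> unit_circle" by simp
    have "?m x = norm (LINT y|\<mu>. of_real (K x y) * F y)"
      using radI[of x] poisson_formula[OF F R w(1)[OF x']] unfolding K_def by simp
    also have "\<dots> \<le> (LINT y|\<mu>. norm (of_real (K x y) * F y))"
      by (rule integral_norm_bound)
    also have "\<dots> = (LINT y|\<mu>. K x y * norm (F y))"
      using Kb x' by (intro Bochner_Integration.integral_cong) (auto simp: norm_mult)
    finally have "?m x \<le> (LINT y|\<mu>. K x y * norm (F y))" .
    moreover have "?m x \<ge> 0" using radI[of x] norm_ge_zero by metis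
    ultimately show "(?m x)\<^sup>2 \<le> (LINT y|\<mu>. K x y * norm (F y))\<^sup>2" by (rule power_mono)
  qed
  ultimately show ?thesis by simp
qed

section \<open>Radial limits\<close>

text \<open>Finite sets exhaust the rational radii, monotone convergence keeps the constant 256, and
  continuity in r reaches the remaining radii. The values lie in \<open>ennreal\<close> because the
  supremum may be infinite at some points.\<close>

lemma radial_maximal_function:
  assumes f: "f holomorphic_on unit_disc" and B: "\<And>r. 0 \<le> r \<Longrightarrow> r < 1 \<Longrightarrow> mean2 f r \<le> B"
  obtains m :: "complex \<Rightarrow> ennreal" where "m \<in> borel_measurable \<mu>"
    "(\<integral>\<^sup>+ \<zeta>. m \<zeta> \<partial>\<mu>) \<le> ennreal (256 * B)"
    "\<And>\<zeta> r. \<zeta> \<in> unit_circle \<Longrightarrow> 0 \<le> r \<Longrightarrow> r < 1 \<Longrightarrow> ennreal ((norm (f (of_real r * \<zeta>)))\<^sup>2) \<le> m \<zeta>"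
proof
  define Q where "Q = \<rat> \<inter> {0::real..<1}"
  have Q: "countable Q" "Q \<noteq> {}" unfolding Q_def using countable_rat by (auto intro!: exI[of _ 0])
  define I where "I = (\<lambda>n. from_nat_into Q ` {..n::nat})"
  have I: "finite (I n)" "I n \<noteq> {}" "I n \<subseteq> {0..<1}" for n
    using from_nat_into[OF Q(2)] by (auto simp: I_def Q_def)
  define mx where "mx = (\<lambda>n \<zeta>. Max ((\<lambda>r. norm (f (of_real r * \<zeta>))) ` I n))"
  define m where "m = (\<lambda>\<zeta>. SUP n. ennreal ((mx n \<zeta>)\<^sup>2))"
  note cont = continuous_on_circle_dilation[OF f]
  have [measurable]: "mx n \<in> borel_measurable \<mu>" for n
  proof -
    have "(\<lambda>\<zeta>. norm (f (of_real r * \<zeta>))) \<in> borel_measurable \<mu>" if "r \<in> I n" for r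
      using I[of n] that by (intro borel_measurable_circle_continuous continuous_on_norm cont) auto
    then show ?thesis unfolding mx_def using I(1)[of n] by (intro borel_measurable_Max) auto
  qed
  show "m \<in> borel_measurable \<mu>" unfolding m_def by measurable
  have mx0: "0 \<le> norm (f (of_real r * \<zeta>)) \<and> norm (f (of_real r * \<zeta>)) \<le> mx n \<zeta>" if "r \<in> I n" for n r \<zeta>
    unfolding mx_def using I[of n] that by (auto intro!: Max_ge)
  have mxpos: "0 \<le> mx n \<zeta>" for n \<zeta>
  proof -
    obtain r where "r \<in> I n" using I(2)[of n] by blast
    from mx0[OF this, of \<zeta>] show ?thesis by linarith
  qed
  have inc: "incseq (\<lambda>n \<zeta>. ennreal ((mx n \<zeta>)\<^sup>2))"
  proof (intro incseq_SucI le_funI ennreal_leI power_mono mxpos)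
    fix n \<zeta> show "mx n \<zeta> \<le> mx (Suc n) \<zeta>"
      unfolding mx_def using I[of n] I[of "Suc n"] by (intro Max_mono image_mono) (auto simp: I_def)
  qed
  have int: "(\<integral>\<^sup>+ \<zeta>. ennreal ((mx n \<zeta>)\<^sup>2) \<partial>\<mu>) \<le> ennreal (256 * B)" for n
  proof -
    \<comment> \<open>A radius above all of \<open>I n\<close> and below 1. Dilation by it makes
      \<open>f\<close> holomorphic beyond the closed disc, and each radius r becomes r / rho <
      1.\<close>
    define \<rho> where "\<rho> = (1 + Max (I n)) / 2"
    have Mx: "Max (I n) \<in> {0..<1}" using I[of n] Max_in[of "I n"] by blast
    have \<rho>: "0 < \<rho>" "\<rho> < 1" and I\<rho>: "\<And>r. r \<in> I n \<Longrightarrow> r < \<rho>"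
    proof -
      show "0 < \<rho>" "\<rho> < 1" using Mx by (auto simp: \<rho>_def)
      fix r assume "r \<in> I n"
      then have "r \<le> Max (I n)" using I by auto
      then show "r < \<rho>" using Mx unfolding \<rho>_def by simp
    qed
    have hol: "(\<lambda>z. f (of_real \<rho> * z)) holomorphic_on ball 0 (1 / \<rho>)"
      by (rule holomorphic_on_compose_gen[OF _ f, unfolded o_def])
        (use \<rho> in \<open>auto intro!: holomorphic_intros simp: norm_mult field_simps\<close>)
    have "(LINT \<zeta>|\<mu>. (Max ((\<lambda>r. norm (f (of_real \<rho> * (of_real r * \<zeta>)))) ` (\<lambda>r. r / \<rho>) ` I n))\<^sup>2)
      \<le> 256 * (LINT \<zeta>|\<mu>. (norm (f (of_real \<rho> * \<zeta>)))\<^sup>2)"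
      by (rule max_radius_inequality[OF hol]) (use \<rho> I[of n] I\<rho> in \<open>auto simp: field_simps\<close>)
    also have "\<dots> \<le> 256 * B" using B[of \<rho>] \<rho> by simp
    also have "(\<lambda>\<zeta>. Max ((\<lambda>r. norm (f (of_real \<rho> * (of_real r * \<zeta>)))) ` (\<lambda>r. r / \<rho>) ` I n)) = mx n"
    proof
      fix \<zeta> :: complex
      have "of_real \<rho> * (of_real (r / \<rho>) * \<zeta>) = of_real r * \<zeta>" for r using \<rho> by simp
      then show "Max ((\<lambda>r. norm (f (of_real \<rho> * (of_real r * \<zeta>)))) ` (\<lambda>r. r / \<rho>) ` I n) = mx n \<zeta>"
        unfolding mx_def image_image by simp
    qed
    finally have le: "(LINT \<zeta>|\<mu>. (mx n \<zeta>)\<^sup>2) \<le> 256 * B" .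
    have cb: "continuous_on (cball 0 \<rho>) f"
      using \<rho> by (intro holomorphic_on_imp_continuous_on holomorphic_on_subset[OF f]) auto
    have "bounded (f ` cball 0 \<rho>)" by (intro compact_imp_bounded compact_continuous_image cb) auto
    then obtain C where C: "\<And>z. z \<in> cball 0 \<rho> \<Longrightarrow> norm (f z) \<le> C" unfolding bounded_iff by blast
    have "integrable \<mu> (\<lambda>\<zeta>. (mx n \<zeta>)\<^sup>2)"
    proof (rule circle.integrable_bounded[where C="C\<^sup>2"])
      fix \<zeta> assume z: "\<zeta> \<in> space \<mu>"
      have "mx n \<zeta> \<in> (\<lambda>r. norm (f (of_real r * \<zeta>))) ` I n"
        unfolding mx_def using I[of n] by (intro Max_in) auto
      then obtain r where r: "r \<in> I n" "mx n \<zeta> = norm (f (of_real r * \<zeta>))" by blast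
      have "of_real r * \<zeta> \<in> cball 0 \<rho>" using I\<rho>[OF r(1)] r(1) I(3)[of n] z by (auto simp: norm_mult)
      from C[OF this] have "mx n \<zeta> \<le> C" using r by simp
      then show "norm ((mx n \<zeta>)\<^sup>2) \<le> C\<^sup>2" using mxpos[of n \<zeta>] by (simp add: power_mono)
    qed measurable
    then have "(\<integral>\<^sup>+ \<zeta>. ennreal ((mx n \<zeta>)\<^sup>2) \<partial>\<mu>) = ennreal (LINT \<zeta>|\<mu>. (mx n \<zeta>)\<^sup>2)"
      by (intro nn_integral_eq_integral) auto
    then show ?thesis using le by (simp add: ennreal_leI)
  qed
  have "(\<integral>\<^sup>+ \<zeta>. m \<zeta> \<partial>\<mu>) = (SUP n. \<integral>\<^sup>+ \<zeta>. ennreal ((mx n \<zeta>)\<^sup>2) \<partial>\<mu>)"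
    unfolding m_def by (rule nn_integral_monotone_convergence_SUP[OF inc]) measurable
  also have "\<dots> \<le> ennreal (256 * B)" using int by (intro SUP_least)
  finally show "(\<integral>\<^sup>+ \<zeta>. m \<zeta> \<partial>\<mu>) \<le> ennreal (256 * B)" .
  have rational: "ennreal ((norm (f (of_real r * \<zeta>)))\<^sup>2) \<le> m \<zeta>" if r: "r \<in> Q" for r \<zeta>
  proof -
    obtain n where n: "from_nat_into Q n = r" using from_nat_into_surj[OF Q(1) r] by blast
    then have "r \<in> I n" by (auto simp: I_def)
    from mx0[OF this, of \<zeta>] have "ennreal ((norm (f (of_real r * \<zeta>)))\<^sup>2) \<le> ennreal ((mx n \<zeta>)\<^sup>2)"
      by (intro ennreal_leI power_mono) auto
    also have "\<dots> \<le> m \<zeta>" unfolding m_def by (rule SUP_upper) simp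
    finally show ?thesis .
  qed
  fix \<zeta> :: complex and r :: real assume z: "\<zeta> \<in> unit_circle" and r: "0 \<le> r" "r < 1"
  show "ennreal ((norm (f (of_real r * \<zeta>)))\<^sup>2) \<le> m \<zeta>"
  proof (rule ccontr)
    assume "\<not> ?thesis"
    then have lt: "m \<zeta> < ennreal ((norm (f (of_real r * \<zeta>)))\<^sup>2)" by simp
    \<comment> \<open>If the value at r exceeded \<open>m\<close>, continuity would make it exceed
      \<open>m\<close> at a rational radius slightly to the right.\<close>
    have "isCont f (of_real r * \<zeta>)"
      using holomorphic_on_imp_continuous_on[OF f] z r
      by (subst (asm) continuous_on_eq_continuous_at) (auto simp: norm_mult)
    then have "((\<lambda>s. f (of_real s * \<zeta>)) \<longlongrightarrow> f (of_real r * \<zeta>)) (at_right r)"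
      by (rule isCont_tendsto_compose) (intro tendsto_intros)
    then have "((\<lambda>s. ennreal ((norm (f (of_real s * \<zeta>)))\<^sup>2)) \<longlongrightarrow> ennreal ((norm (f (of_real r * \<zeta>)))\<^sup>2)) (at_right r)"
      by (intro tendsto_intros)
    from order_tendstoD(1)[OF this lt] obtain b where b: "b > r"
      "\<And>s. r < s \<Longrightarrow> s < b \<Longrightarrow> m \<zeta> < ennreal ((norm (f (of_real s * \<zeta>)))\<^sup>2)"
      unfolding eventually_at_right_field by blast
    obtain s where s: "s \<in> \<rat>" "r < s" "s < min b 1" using Rats_dense_in_real[of r "min b 1"] b r by auto
    with rational[of s \<zeta>] b(2)[of s] r show False by (auto simp: Q_def)
  qed
qed

text \<open>Natural number parameters make the set of convergence a countable combination of sets,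
  and the weak inequality makes those sets closed. Both serve the measurability of
  \<open>bdry\<close>.\<close>

lemma tendsto_at_left_1_iff_cauchy:
  fixes g :: "real \<Rightarrow> 'a::{complete_space}"
  shows "(\<exists>l. (g \<longlongrightarrow> l) (at_left 1)) \<longleftrightarrow>
    (\<forall>k::nat. \<exists>n::nat. \<forall>r s. 1 - 1 / Suc n < r \<and> r < 1 \<and> 1 - 1 / Suc n < s \<and> s < 1 \<longrightarrow>
       dist (g r) (g s) \<le> 1 / Suc k)" (is "?L \<longleftrightarrow> ?R")
proof
  assume ?L
  then obtain l where l: "(g \<longlongrightarrow> l) (at_left 1)" ..
  show ?R
  proof
    fix k :: nat
    have "\<forall>\<^sub>F r in at_left 1. dist (g r) l < 1 / (2 * Suc k)" by (rule tendstoD[OF l]) simp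
    then obtain b where b: "b < 1" "\<And>r. b < r \<Longrightarrow> r < 1 \<Longrightarrow> dist (g r) l < 1 / (2 * Suc k)"
      unfolding eventually_at_left_field by blast
    obtain n where n: "1 / Suc n < 1 - b" using reals_Archimedean[of "1 - b"] b(1) by (auto simp: inverse_eq_divide)
    have "dist (g r) (g s) \<le> 1 / Suc k" if "1 - 1 / Suc n < r \<and> r < 1 \<and> 1 - 1 / Suc n < s \<and> s < 1" for r s
    proof -
      have "dist (g r) (g s) \<le> dist (g r) l + dist (g s) l" by (rule dist_triangle2)
      also have "\<dots> \<le> 1 / (2 * Suc k) + 1 / (2 * Suc k)"
        using b(2)[of r] b(2)[of s] that n by (intro add_mono less_imp_le) auto
      finally show ?thesis by (simp add: field_simps)
    qed
    then show "\<exists>n. \<forall>r s. 1 - 1 / Suc n < r \<and> r < 1 \<and> 1 - 1 / Suc n < s \<and> s < 1 \<longrightarrow> dist (g r) (g s) \<le> 1 / Suc k"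
      by blast
  qed
next
  assume R: ?R
  have "cauchy_filter (filtermap g (at_left 1))"
    unfolding cauchy_filter_metric_filtermap
  proof (intro allI impI)
    fix e :: real assume "e > 0"
    then obtain k where k: "1 / Suc k < e" using reals_Archimedean[of e] by (auto simp: inverse_eq_divide)
    from R obtain n where n: "\<And>r s. 1 - 1 / Suc n < r \<and> r < 1 \<and> 1 - 1 / Suc n < s \<and> s < 1 \<Longrightarrow>
       dist (g r) (g s) \<le> 1 / Suc k" by blast
    show "\<exists>P. eventually P (at_left 1) \<and> (\<forall>x y. P x \<and> P y \<longrightarrow> dist (g x) (g y) < e)"
    proof (intro exI[of _ "\<lambda>r. 1 - 1 / Suc n < r \<and> r < 1"] conjI allI impI)
      show "\<forall>\<^sub>F r in at_left 1. 1 - 1 / Suc n < r \<and> r < (1::real)"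
        unfolding eventually_at_left_field by (intro exI[of _ "1 - 1 / Suc n"]) auto
      show "dist (g x) (g y) < e" if "(1 - 1 / Suc n < x \<and> x < 1) \<and> 1 - 1 / Suc n < y \<and> y < 1" for x y
        using n[of x y] that k by auto
    qed
  qed
  from cauchy_filter_complete_converges[OF this complete_UNIV] show ?L
    by (auto simp: filterlim_def filtermap_bot_iff)
qed

text \<open>The squared Taylor coefficients are summable, and the tail of their sum from N on bounds
  all the means at once.\<close>

lemma hardy2_taylor_tails:
  assumes f: "f \<in> hardy 2"
  shows "\<exists>\<epsilon>::nat \<Rightarrow> real. \<epsilon> \<longlonglongrightarrow> 0 \<and> (\<forall>N r. 0 \<le> r \<longrightarrow> r < 1 \<longrightarrow>
    mean2 (\<lambda>z. f z - (\<Sum>n<N. (deriv ^^ n) f 0 / fact n * z ^ n)) r \<le> \<epsilon> N)"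
proof -
  obtain B where hol: "f holomorphic_on unit_disc" and B: "\<And>r. 0 \<le> r \<Longrightarrow> r < 1 \<Longrightarrow> mean2 f r \<le> B"
    using f unfolding hardy2_iff by blast
  define a where "a = (\<lambda>n. (deriv ^^ n) f 0 / fact n)"
  have a: "(\<lambda>n. a n * z ^ n) sums f z" if "z \<in> unit_disc" for z
    using holomorphic_power_series[OF hol that] by (simp add: a_def)
  have aB: "(\<Sum>n<N. (norm (a n))\<^sup>2) \<le> B" for N
    by (rule sum_coeffs_le_mean2[OF a B])
  have sm: "summable (\<lambda>n. (norm (a n))\<^sup>2)"
    by (rule summableI_nonneg_bounded[OF _ aB]) simp
  define \<epsilon> where "\<epsilon> = (\<lambda>N. \<Sum>n. (norm (a (n + N)))\<^sup>2)"
  have \<epsilon>: "\<epsilon> \<longlonglongrightarrow> 0" using suminf_exist_split2[OF sm] by (simp add: \<epsilon>_def)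
  define h where "h = (\<lambda>N z. f z - (\<Sum>n<N. a n * z ^ n))"
  have hB: "mean2 (h N) r \<le> \<epsilon> N" if "0 \<le> r" "r < 1" for N r
  proof (rule mean2_le_sum_coeffs[OF _ that])
    fix z assume "z \<in> unit_disc"
    from sums_If_finite_set'[OF a[OF this], of "{..<N}" "h N z" "\<lambda>_. 0"]
    have "(\<lambda>n. if n \<in> {..<N} then 0 else a n * z ^ n) sums h N z"
      by (simp add: h_def sum_negf)
    then show "(\<lambda>n. (if n < N then 0 else a n) * z ^ n) sums h N z" by (simp add: if_distrib if_distribR cong: if_cong)
  next
    fix M
    have "(\<Sum>n<M. (norm (if n < N then 0 else a n))\<^sup>2) \<le> (\<Sum>n<N + M. (norm (if n < N then 0 else a n))\<^sup>2)"
      by (rule sum_mono2) auto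
    also have "\<dots> = (\<Sum>n<M. (norm (a (n + N)))\<^sup>2)"
      by (induction M) (auto simp: add.commute)
    also have "\<dots> \<le> \<epsilon> N"
      unfolding \<epsilon>_def using sm by (intro sum_le_suminf) (auto intro: summable_ignore_initial_segment)
    finally show "(\<Sum>n<M. (norm (if n < N then 0 else a n))\<^sup>2) \<le> \<epsilon> N" .
  qed
  show ?thesis using \<epsilon> hB unfolding h_def a_def by (intro exI[of _ \<epsilon>]) auto
qed

text \<open>Density argument of Fatou's theorem: the maximal function of the Taylor tails tends to 0.\<close>

theorem hardy2_radial_limit:
  assumes f: "f \<in> hardy 2"
  shows "AE \<zeta> in \<mu>. \<exists>l. ((\<lambda>r. f (of_real r * \<zeta>)) \<longlongrightarrow> l) (at_left (1::real))"
proof -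
  define a where "a = (\<lambda>n. (deriv ^^ n) f 0 / fact n)"
  define h where "h = (\<lambda>N z. f z - (\<Sum>n<N. a n * z ^ n))"
  have hh: "h N holomorphic_on unit_disc" for N
    using f unfolding h_def by (intro holomorphic_intros) (simp add: hardy2_iff)
  obtain \<epsilon> where \<epsilon>: "\<epsilon> \<longlonglongrightarrow> 0"
    and tails: "\<forall>N r. 0 \<le> r \<longrightarrow> r < 1 \<longrightarrow>
      mean2 (\<lambda>z. f z - (\<Sum>n<N. (deriv ^^ n) f 0 / fact n * z ^ n)) r \<le> \<epsilon> N"
    using hardy2_taylor_tails[OF f] by (elim exE conjE)
  have hB: "mean2 (h N) r \<le> \<epsilon> N" if "0 \<le> r" "r < 1" for N r
    using tails[rule_format, OF that] unfolding h_def a_def .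
  have "\<forall>N. \<exists>m :: complex \<Rightarrow> ennreal. m \<in> borel_measurable \<mu> \<and>
    (\<integral>\<^sup>+ \<zeta>. m \<zeta> \<partial>\<mu>) \<le> ennreal (256 * \<epsilon> N) \<and>
    (\<forall>\<zeta>\<in>unit_circle. \<forall>r. 0 \<le> r \<longrightarrow> r < 1 \<longrightarrow> ennreal ((norm (h N (of_real r * \<zeta>)))\<^sup>2) \<le> m \<zeta>)"
    (is "\<forall>N. \<exists>m. ?P N m")
  proof
    fix N
    show "\<exists>m. ?P N m"
    proof (rule radial_maximal_function[OF hh hB])
      fix m :: "complex \<Rightarrow> ennreal"
      assume "m \<in> borel_measurable \<mu>" "(\<integral>\<^sup>+ \<zeta>. m \<zeta> \<partial>\<mu>) \<le> ennreal (256 * \<epsilon> N)"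
        "\<And>\<zeta> r. \<zeta> \<in> unit_circle \<Longrightarrow> 0 \<le> r \<Longrightarrow> r < 1 \<Longrightarrow> ennreal ((norm (h N (of_real r * \<zeta>)))\<^sup>2) \<le> m \<zeta>"
      then show ?thesis by (intro exI[of _ m] conjI ballI allI impI)
    qed
  qed
  from choice[OF this] obtain m where P: "\<And>N. ?P N (m N)" by (elim exE) (rule that, erule spec)
  have m[measurable]: "m N \<in> borel_measurable \<mu>" for N using P[of N] by (elim conjE)
  have mint: "(\<integral>\<^sup>+ \<zeta>. m N \<zeta> \<partial>\<mu>) \<le> ennreal (256 * \<epsilon> N)" for N using P[of N] by (elim conjE)
  have mh: "ennreal ((norm (h N (of_real r * \<zeta>)))\<^sup>2) \<le> m N \<zeta>"
    if "\<zeta> \<in> unit_circle" "0 \<le> r" "r < 1" for N \<zeta> r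
    using P[of N] that by blast
  \<comment> \<open>Fatou's lemma. A vanishing liminf is enough: each accuracy needs just one N
    whose tail is small at the given point.\<close>
  have "(\<integral>\<^sup>+ \<zeta>. liminf (\<lambda>N. m N \<zeta>) \<partial>\<mu>) \<le> liminf (\<lambda>N. \<integral>\<^sup>+ \<zeta>. m N \<zeta> \<partial>\<mu>)"
    by (rule nn_integral_liminf) measurable
  also have "\<dots> \<le> liminf (\<lambda>N. ennreal (256 * \<epsilon> N))"
    by (rule Liminf_mono) (simp add: mint)
  also have "(\<lambda>N. ennreal (256 * \<epsilon> N)) \<longlonglongrightarrow> ennreal (256 * 0)" by (intro tendsto_intros \<epsilon>)
  then have "liminf (\<lambda>N. ennreal (256 * \<epsilon> N)) = 0"
    using lim_imp_Liminf[OF sequentially_bot] by fastforce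
  finally have "(\<integral>\<^sup>+ \<zeta>. liminf (\<lambda>N. m N \<zeta>) \<partial>\<mu>) = 0" by simp
  then have "AE \<zeta> in \<mu>. liminf (\<lambda>N. m N \<zeta>) = 0"
    by (subst (asm) nn_integral_0_iff_AE) auto
  with AE_space show ?thesis
  proof eventually_elim
    fix \<zeta> assume "\<zeta> \<in> space \<mu>" and l0: "liminf (\<lambda>N. m N \<zeta>) = 0"
    then have z: "\<zeta> \<in> unit_circle" by simp
    show "\<exists>l. ((\<lambda>r. f (of_real r * \<zeta>)) \<longlongrightarrow> l) (at_left (1::real))"
      unfolding tendsto_at_left_1_iff_cauchy
    proof
      fix k :: nat
      define e where "e = 1 / (3 * real (Suc k))"
      have e: "e > 0" by (simp add: e_def)
      \<comment> \<open>\<open>Suc (3 * k + 2)\<close> is three times \<open>Suc k\<close>, so the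
        Taylor polynomial takes the same third of the tolerance as each of the two tails.\<close>
      have e3: "1 / real (Suc (3 * k + 2)) = e" by (simp add: e_def)
      have "\<exists>N. m N \<zeta> < ennreal (e\<^sup>2)"
      proof (rule ccontr)
        assume "\<not> ?thesis"
        then have "ennreal (e\<^sup>2) \<le> liminf (\<lambda>N. m N \<zeta>)" by (intro Liminf_bounded) (auto simp: not_less)
        then show False using l0 e by (simp add: ennreal_eq_0_iff)
      qed
      then obtain N where N: "m N \<zeta> < ennreal (e\<^sup>2)" ..
      have hN: "norm (h N (of_real r * \<zeta>)) \<le> e" if "0 \<le> r" "r < 1" for r
      proof -
        have "ennreal ((norm (h N (of_real r * \<zeta>)))\<^sup>2) \<le> ennreal (e\<^sup>2)"
          using mh[OF z that, of N] N by (meson less_imp_le order.trans)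
        then have "(norm (h N (of_real r * \<zeta>)))\<^sup>2 \<le> e\<^sup>2" by (simp add: ennreal_le_iff)
        then show ?thesis by (rule power2_le_imp_le) (use e in auto)
      qed
      let ?S = "\<lambda>r. \<Sum>n<N. a n * (of_real r * \<zeta>) ^ n"
      have "\<exists>l. (?S \<longlongrightarrow> l) (at_left 1)"
        by (intro exI[of _ "\<Sum>n<N. a n * (of_real 1 * \<zeta>) ^ n"] tendsto_intros)
      then obtain n where n: "\<And>r s. 1 - 1 / Suc n < r \<and> r < 1 \<and> 1 - 1 / Suc n < s \<and> s < 1 \<Longrightarrow>
         dist (?S r) (?S s) \<le> 1 / Suc (3 * k + 2)" unfolding tendsto_at_left_1_iff_cauchy by blast
      have "dist (f (of_real r * \<zeta>)) (f (of_real s * \<zeta>)) \<le> 1 / Suc k"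
        if rs: "1 - 1 / Suc n < r \<and> r < 1 \<and> 1 - 1 / Suc n < s \<and> s < 1" for r s
      proof -
        have "0 \<le> 1 - 1 / real (Suc n)" by simp
        then have r0: "0 \<le> r" "0 \<le> s" using rs by linarith+
        have tri: "dist (a + c) (b + d) \<le> norm a + norm b + dist c d" for a b c d :: complex
          using dist_triangle_add[of a c b d] norm_triangle_ineq4[of a b] by (simp add: dist_norm)
        have "dist (f (of_real r * \<zeta>)) (f (of_real s * \<zeta>)) =
            dist (h N (of_real r * \<zeta>) + ?S r) (h N (of_real s * \<zeta>) + ?S s)"
          by (simp add: h_def)
        also have "\<dots> \<le> norm (h N (of_real r * \<zeta>)) + norm (h N (of_real s * \<zeta>)) + dist (?S r) (?S s)"
          by (rule tri)
        also have "\<dots> \<le> e + e + e"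
          using hN[of r] hN[of s] r0 rs n[OF rs] e3 by (intro add_mono) auto
        also have "\<dots> = 1 / Suc k" by (simp add: e_def field_simps)
        finally show ?thesis .
      qed
      then show "\<exists>n. \<forall>r s. 1 - 1 / Suc n < r \<and> r < 1 \<and> 1 - 1 / Suc n < s \<and> s < 1 \<longrightarrow>
         dist (f (of_real r * \<zeta>)) (f (of_real s * \<zeta>)) \<le> 1 / Suc k" by blast
    qed
  qed
qed

section \<open>The boundary function and its measurability\<close>

lemma tendsto_bdry:
  assumes "\<exists>l. ((\<lambda>r. f (of_real r * \<zeta>)) \<longlongrightarrow> l) (at_left (1::real))"
  shows "((\<lambda>r. f (of_real r * \<zeta>)) \<longlongrightarrow> bdry f \<zeta>) (at_left (1::real))"
  using assms by (auto simp: bdry_def tendsto_Lim)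

lemma bdry_eqI: "((\<lambda>r. f (of_real r * \<zeta>)) \<longlongrightarrow> l) (at_left (1::real)) \<Longrightarrow> bdry f \<zeta> = l"
  by (simp add: bdry_def tendsto_Lim)

lemma hardy2_tendsto_bdry:
  assumes "f \<in> hardy 2"
  shows "AE \<zeta> in \<mu>. ((\<lambda>r. f (of_real r * \<zeta>)) \<longlongrightarrow> bdry f \<zeta>) (at_left (1::real))"
  using hardy2_radial_limit[OF assms] by eventually_elim (rule tendsto_bdry)

lemma filterlim_radii_at_left_1: "filterlim (\<lambda>n::nat. 1 - 1 / Suc n :: real) (at_left 1) sequentially"
proof (rule tendsto_imp_filterlim_at_left)
  have "(\<lambda>n. 1 - inverse (real (Suc n))) \<longlonglongrightarrow> 1 - 0" by (intro tendsto_intros LIMSEQ_inverse_real_of_nat)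
  then show "(\<lambda>n::nat. 1 - 1 / Suc n :: real) \<longlonglongrightarrow> 1" by (simp add: inverse_eq_divide)
qed auto

text \<open>The set of convergence is a countable intersection of countable unions of closed sets;
  on it \<open>bdry f\<close> is the limit of a sequence of continuous functions, off it a
  constant.\<close>

lemma bdry_measurable:
  assumes f: "f holomorphic_on unit_disc"
  shows "bdry f \<in> borel_measurable \<mu>"
proof -
  note cont = continuous_on_circle_dilation[OF f]
  define X where "X = (\<lambda>n k. unit_circle \<inter> {\<zeta>. \<forall>r s. 1 - 1 / Suc n < r \<and> r < 1 \<and> 1 - 1 / Suc n < s \<and> s < 1 \<longrightarrow>
       dist (f (of_real r * \<zeta>)) (f (of_real s * \<zeta>)) \<le> 1 / Suc k})"
  have "closed (X n k)" for n k :: nat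
  proof -
    have "0 \<le> 1 - 1 / real (Suc n)" by simp
    then have pos: "1 - 1 / Suc n < r \<Longrightarrow> 0 \<le> r" for r by linarith
    have "closed {\<zeta> \<in> unit_circle. dist (f (of_real r * \<zeta>)) (f (of_real s * \<zeta>)) \<le> 1 / Suc k}"
      if "1 - 1 / Suc n < r \<and> r < 1 \<and> 1 - 1 / Suc n < s \<and> s < 1" for r s
    proof -
      have "0 \<le> r" "r < 1" "0 \<le> s" "s < 1" using that pos by blast+
      then show ?thesis by (intro continuous_on_closed_Collect_le continuous_on_dist cont continuous_on_const) auto
    qed
    then have "closed (\<Inter>p\<in>{p. 1 - 1 / Suc n < fst p \<and> fst p < 1 \<and> 1 - 1 / Suc n < snd p \<and> snd p < 1}.
       {\<zeta> \<in> unit_circle. dist (f (of_real (fst p) * \<zeta>)) (f (of_real (snd p) * \<zeta>)) \<le> 1 / Suc k})"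
      by (intro closed_INT) auto
    then have "closed (unit_circle \<inter> (\<Inter>p\<in>{p. 1 - 1 / Suc n < fst p \<and> fst p < 1 \<and> 1 - 1 / Suc n < snd p \<and> snd p < 1}.
       {\<zeta> \<in> unit_circle. dist (f (of_real (fst p) * \<zeta>)) (f (of_real (snd p) * \<zeta>)) \<le> 1 / Suc k}))"
      by (intro closed_Int) auto
    also have "\<dots> = X n k" by (auto simp: X_def)
    finally show ?thesis .
  qed
  then have X: "X n k \<in> sets \<mu>" for n k
    unfolding sets_circle_measure by (subst sets_restrict_space_iff) (auto simp: X_def)
  define C where "C = (\<Inter>k. \<Union>n. X n k)"
  have [measurable]: "C \<in> sets \<mu>" unfolding C_def using X by auto
  have C: "\<zeta> \<in> C \<longleftrightarrow> (\<exists>l. ((\<lambda>r. f (of_real r * \<zeta>)) \<longlongrightarrow> l) (at_left (1::real)))" if "\<zeta> \<in> unit_circle" for \<zeta>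
    unfolding tendsto_at_left_1_iff_cauchy using that by (auto simp: C_def X_def)
  let ?g = "\<lambda>n \<zeta>. f (of_real (1 - 1 / Suc n) * \<zeta>)"
  have [measurable]: "?g n \<in> borel_measurable \<mu>" for n
    by (intro borel_measurable_circle_continuous cont) auto
  \<comment> \<open>\<open>Lim\<close> is a definite description. Wherever no limit exists its
    predicate is constantly false, so all these points share this one value.\<close>
  define d where "d = (THE l::complex. False)"
  have eq: "bdry f \<zeta> = (if \<zeta> \<in> C then lim (\<lambda>n. ?g n \<zeta>) else d)" if "\<zeta> \<in> space \<mu>" for \<zeta>
  proof (cases "\<zeta> \<in> C")
    case True
    then have "((\<lambda>r. f (of_real r * \<zeta>)) \<longlongrightarrow> bdry f \<zeta>) (at_left (1::real))"
      using C that tendsto_bdry by auto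
    from filterlim_compose[OF this filterlim_radii_at_left_1] have "lim (\<lambda>n. ?g n \<zeta>) = bdry f \<zeta>" by (rule limI)
    then show ?thesis using True by simp
  next
    case False
    then show ?thesis using C[of \<zeta>] that by (auto simp: bdry_def t2_space_class.Lim_def d_def)
  qed
  have m: "(\<lambda>\<zeta>. if \<zeta> \<in> C then lim (\<lambda>n. ?g n \<zeta>) else d) \<in> borel_measurable \<mu>"
    by measurable
  show ?thesis by (rule measurable_cong[THEN iffD2, OF eq m])
qed

section \<open>Boundary values of functions in $H^2$\<close>

text \<open>Fatou's lemma along the radii 1 - 1 / (n + 1). The limit \<open>g\<close> is left
  general so that the lemma also applies to \<open>bdry f\<close> minus a Taylor polynomial.\<close>

lemma radial_limit_L2:
  assumes f: "f holomorphic_on unit_disc" and B: "\<And>r. 0 \<le> r \<Longrightarrow> r < 1 \<Longrightarrow> mean2 f r \<le> B"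
    and g: "g \<in> borel_measurable \<mu>"
    and lim: "AE \<zeta> in \<mu>. ((\<lambda>r. f (of_real r * \<zeta>)) \<longlongrightarrow> g \<zeta>) (at_left (1::real))"
  shows "g \<in> L2" "(norm_sq g) \<le> B"
proof -
  let ?r = "\<lambda>n::nat. 1 - 1 / Suc n :: real"
  have r: "0 \<le> ?r n" "?r n < 1" for n by auto
  have L: "(\<lambda>\<zeta>. f (of_real (?r n) * \<zeta>)) \<in> L2" for n by (rule L2_dilation[OF f r])
  have [measurable]: "(\<lambda>\<zeta>. f (of_real (?r n) * \<zeta>)) \<in> borel_measurable \<mu>" for n
    using L2_measurable[OF L] .
  note [measurable] = g
  have "(\<integral>\<^sup>+ \<zeta>. ennreal ((norm (g \<zeta>))\<^sup>2) \<partial>\<mu>) =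
     (\<integral>\<^sup>+ \<zeta>. liminf (\<lambda>n. ennreal ((norm (f (of_real (?r n) * \<zeta>)))\<^sup>2)) \<partial>\<mu>)"
  proof (rule nn_integral_cong_AE)
    show "AE \<zeta> in \<mu>. ennreal ((norm (g \<zeta>))\<^sup>2) =
        liminf (\<lambda>n. ennreal ((norm (f (of_real (?r n) * \<zeta>)))\<^sup>2))"
      using lim
    proof eventually_elim
      case (elim \<zeta>)
      from filterlim_compose[OF this filterlim_radii_at_left_1]
      have "(\<lambda>n. ennreal ((norm (f (of_real (?r n) * \<zeta>)))\<^sup>2)) \<longlonglongrightarrow> ennreal ((norm (g \<zeta>))\<^sup>2)"
        by (intro tendsto_intros)
      from lim_imp_Liminf[OF sequentially_bot this] show ?case by (rule sym)
    qed
  qed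
  also have "\<dots> \<le> liminf (\<lambda>n. \<integral>\<^sup>+ \<zeta>. ennreal ((norm (f (of_real (?r n) * \<zeta>)))\<^sup>2) \<partial>\<mu>)"
    by (rule nn_integral_liminf) measurable
  also have "\<dots> \<le> liminf (\<lambda>n::nat. ennreal B)"
  proof (intro Liminf_mono always_eventually allI)
    fix n
    show "(\<integral>\<^sup>+ \<zeta>. ennreal ((norm (f (of_real (?r n) * \<zeta>)))\<^sup>2) \<partial>\<mu>) \<le> ennreal B"
      using B[OF r, of n] nn_integral_eq_integral[OF L2_integrable[OF L[of n]]] by (simp add: ennreal_leI)
  qed
  finally have le: "(\<integral>\<^sup>+ \<zeta>. ennreal ((norm (g \<zeta>))\<^sup>2) \<partial>\<mu>) \<le> ennreal B"
    unfolding Liminf_const[OF sequentially_bot] .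
  have int: "integrable \<mu> (\<lambda>\<zeta>. (norm (g \<zeta>))\<^sup>2)"
    by (rule integrableI_bounded) (use le in \<open>auto intro: le_less_trans\<close>)
  then show "g \<in> L2" using g by (simp add: L2_def)
  have "0 \<le> mean2 f 0" by (intro Bochner_Integration.integral_nonneg) simp
  then have "0 \<le> B" using B[of 0] by linarith
  with le show "(norm_sq g) \<le> B"
    unfolding nn_integral_eq_integral[OF int zero_le_power2[THEN AE_I2]] by (simp add: ennreal_le_iff)
qed

lemma hardy2_holomorphic: "f \<in> hardy 2 \<Longrightarrow> f holomorphic_on unit_disc"
  by (simp add: hardy2_iff)

lemma hardy2_bdry_L2: "f \<in> hardy 2 \<Longrightarrow> bdry f \<in> L2"
  using radial_limit_L2(1)[OF _ _ bdry_measurable hardy2_tendsto_bdry, of f] unfolding hardy2_iff by blast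

lemma hardy2_bdry_norm_le:
  assumes "f \<in> hardy 2" "\<And>r. 0 \<le> r \<Longrightarrow> r < 1 \<Longrightarrow> mean2 f r \<le> B"
  shows "(norm_sq (bdry f)) \<le> B"
  using radial_limit_L2(2)[OF _ _ bdry_measurable hardy2_tendsto_bdry, of f] assms hardy2_holomorphic by blast

text \<open>Requiring \<open>N > n\<close> keeps the coefficient of index n in the polynomial, as
  the comparison of Fourier coefficients needs.\<close>

lemma hardy2_taylor_approx:
  assumes f: "f \<in> hardy 2" and e: "e > 0"
  obtains N where "N > n"
    "(LINT \<zeta>|\<mu>. (norm (bdry f \<zeta> - (\<Sum>k<N. (deriv ^^ k) f 0 / fact k * \<zeta> ^ k)))\<^sup>2) < e"
proof -
  let ?S = "\<lambda>N z. \<Sum>n<N. (deriv ^^ n) f 0 / fact n * z ^ n"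
  obtain \<epsilon> where \<epsilon>: "\<epsilon> \<longlonglongrightarrow> 0" and \<epsilon>B: "\<forall>N r. 0 \<le> r \<longrightarrow> r < 1 \<longrightarrow> mean2 (\<lambda>z. f z - ?S N z) r \<le> \<epsilon> N"
    using hardy2_taylor_tails[OF f] by (elim exE conjE)
  have "\<forall>\<^sub>F N in sequentially. \<epsilon> N < e \<and> n < N"
    using order_tendstoD(2)[OF \<epsilon> e] eventually_gt_at_top by (rule eventually_conj)
  then obtain N where N: "\<epsilon> N < e" "n < N" by (auto simp: eventually_sequentially)
  have hol: "(\<lambda>z. f z - ?S N z) holomorphic_on unit_disc"
    by (intro holomorphic_intros hardy2_holomorphic f)
  have m: "(\<lambda>\<zeta>. bdry f \<zeta> - ?S N \<zeta>) \<in> borel_measurable \<mu>"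
    by (intro L2_measurable L2_diff hardy2_bdry_L2 f L2_poly)
  have lim: "AE \<zeta> in \<mu>. ((\<lambda>r. f (of_real r * \<zeta>) - ?S N (of_real r * \<zeta>)) \<longlongrightarrow> bdry f \<zeta> - ?S N \<zeta>) (at_left (1::real))"
    using hardy2_tendsto_bdry[OF f]
  proof eventually_elim
    case (elim \<zeta>)
    have "((\<lambda>r. ?S N (of_real r * \<zeta>)) \<longlongrightarrow> ?S N (of_real 1 * \<zeta>)) (at_left (1::real))"
      by (intro tendsto_intros)
    with elim show ?case by (intro tendsto_diff) auto
  qed
  have "(LINT \<zeta>|\<mu>. (norm (bdry f \<zeta> - ?S N \<zeta>))\<^sup>2) \<le> \<epsilon> N"
    by (rule radial_limit_L2(2)[OF hol \<epsilon>B[rule_format] m lim])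
  with N show thesis by (intro that) auto
qed

section \<open>Fourier coefficients of boundary functions and the action of P on them\<close>

lemma fourier_coeff_norm_le:
  assumes "G \<in> L2" shows "(norm (fourier_coeff G n))\<^sup>2 \<le> norm_sq G"
proof -
  have "(norm (fourier_coeff G n))\<^sup>2 \<le> (\<Sum>k<Suc n. (norm (fourier_coeff G k))\<^sup>2)"
    by (rule member_le_sum) auto
  also have "\<dots> \<le> norm_sq G" by (rule bessel[OF assms])
  finally show ?thesis .
qed

lemma fourier_coeff_diff:
  assumes "F \<in> L2" "G \<in> L2"
  shows "fourier_coeff (\<lambda>\<zeta>. F \<zeta> - G \<zeta>) n = fourier_coeff F n - fourier_coeff G n"
proof -
  have m: "(\<lambda>\<zeta>. cnj \<zeta> ^ n) \<in> L2" by (intro L2_continuous continuous_intros)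
  show ?thesis unfolding fourier_coeff_def left_diff_distrib
    by (intro Bochner_Integration.integral_diff L2_integrable_mult assms m)
qed

text \<open>Fourier coefficients are continuous in the square mean. A discrepancy would be a fixed
  positive gap, contradicted by a sufficiently close Taylor polynomial.\<close>

lemma fourier_coeff_bdry:
  assumes f: "f \<in> hardy 2"
  shows "fourier_coeff (bdry f) n = (deriv ^^ n) f 0 / fact n"
proof (rule ccontr)
  let ?a = "\<lambda>k. (deriv ^^ k) f 0 / fact k"
  assume "\<not> ?thesis"
  then have pos: "(norm (fourier_coeff (bdry f) n - ?a n))\<^sup>2 > 0" by simp
  obtain N where N: "N > n" "(LINT \<zeta>|\<mu>. (norm (bdry f \<zeta> - (\<Sum>k<N. ?a k * \<zeta> ^ k)))\<^sup>2) < (norm (fourier_coeff (bdry f) n - ?a n))\<^sup>2"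
    using hardy2_taylor_approx[OF f pos] by blast
  have L: "(\<lambda>\<zeta>. bdry f \<zeta> - (\<Sum>k<N. ?a k * \<zeta> ^ k)) \<in> L2"
    by (intro L2_diff hardy2_bdry_L2 f L2_poly)
  have "fourier_coeff (\<lambda>\<zeta>. bdry f \<zeta> - (\<Sum>k<N. ?a k * \<zeta> ^ k)) n = fourier_coeff (bdry f) n - ?a n"
    using N(1) by (simp only: fourier_coeff_diff[OF hardy2_bdry_L2[OF f] L2_poly] fourier_coeff_poly) simp
  with fourier_coeff_norm_le[OF L, of n] N(2) show False by simp
qed

text \<open>Conjugated polynomials have no positive frequencies, so only the constant term meets the
  indices n >= 0; approximation extends this to \<open>f\<close>.\<close>

lemma fourier_coeff_cnj_bdry:
  assumes f: "f \<in> hardy 2"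
  shows "fourier_coeff (\<lambda>\<zeta>. cnj (bdry f \<zeta>)) n = (if n = 0 then cnj (f 0) else 0)" (is "_ = ?c")
proof (rule ccontr)
  let ?a = "\<lambda>k. (deriv ^^ k) f 0 / fact k"
  assume "\<not> ?thesis"
  then have pos: "(norm (fourier_coeff (\<lambda>\<zeta>. cnj (bdry f \<zeta>)) n - ?c))\<^sup>2 > 0" by simp
  obtain N where N: "N > n" "(LINT \<zeta>|\<mu>. (norm (bdry f \<zeta> - (\<Sum>k<N. ?a k * \<zeta> ^ k)))\<^sup>2) <
      (norm (fourier_coeff (\<lambda>\<zeta>. cnj (bdry f \<zeta>)) n - ?c))\<^sup>2"
    using hardy2_taylor_approx[OF f pos] by blast
  have S: "(\<lambda>\<zeta>. cnj (\<Sum>k<N. ?a k * \<zeta> ^ k)) \<in> L2" "(\<lambda>\<zeta>. cnj (bdry f \<zeta>)) \<in> L2"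
    by (intro L2_cnj L2_poly hardy2_bdry_L2 f)+
  have L: "(\<lambda>\<zeta>. cnj (bdry f \<zeta>) - cnj (\<Sum>k<N. ?a k * \<zeta> ^ k)) \<in> L2"
    by (intro L2_diff S)
  have "fourier_coeff (\<lambda>\<zeta>. cnj (\<Sum>k<N. ?a k * \<zeta> ^ k)) n = (LINT \<zeta>|\<mu>. cnj (\<Sum>k<N. ?a k * \<zeta> ^ k) * cnj \<zeta> ^ n)"
    by (simp only: fourier_coeff_def)
  also have "\<dots> = (\<Sum>k<N. cnj (?a k) * fourier_coeff (\<lambda>\<zeta>. cnj \<zeta> ^ n) k)"
    by (intro integral_cnj_poly_mult L2_continuous continuous_intros)
  also have "\<dots> = (\<Sum>k<N. cnj (?a k) * (if 0 = n + k then 1 else 0))"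
    unfolding integral_circle_monomials[symmetric] by (simp add: fourier_coeff_def power_add)
  also have "(\<Sum>k<N. cnj (?a k) * (if 0 = n + k then 1 else 0)) = (\<Sum>k<N. if k = 0 then ?c else 0)"
    by (intro sum.cong) auto
  also have "\<dots> = ?c" using N(1) by simp
  finally have "fourier_coeff (\<lambda>\<zeta>. cnj (bdry f \<zeta>) - cnj (\<Sum>k<N. ?a k * \<zeta> ^ k)) n =
      fourier_coeff (\<lambda>\<zeta>. cnj (bdry f \<zeta>)) n - ?c"
    by (simp only: fourier_coeff_diff[OF S(2,1)])
  with fourier_coeff_norm_le[OF L, of n] N(2) show False
    by (simp only: complex_cnj_diff[symmetric] complex_mod_cnj)
qed

theorem riesz_projection_bdry:
  assumes f: "f \<in> hardy 2" and z: "z \<in> unit_disc"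
  shows "riesz_projection (bdry f) z = f z"
proof -
  have "(\<lambda>n. fourier_coeff (bdry f) n * z ^ n) sums riesz_projection (bdry f) z"
    by (rule riesz_projection_sums[OF L2_integrable_self[OF hardy2_bdry_L2[OF f]] z])
  moreover have "(\<lambda>n. fourier_coeff (bdry f) n * z ^ n) sums f z"
    using holomorphic_power_series[OF hardy2_holomorphic[OF f] z] by (simp add: fourier_coeff_bdry[OF f])
  ultimately show ?thesis by (rule sums_unique2)
qed

text \<open>In particular P annihilates conjugates of functions that vanish at 0. This removes the
  correction term in the necessity proof and the part \<open>vm\<close> of a splitting.\<close>

theorem riesz_projection_cnj_bdry:
  assumes f: "f \<in> hardy 2" and z: "z \<in> unit_disc"
  shows "riesz_projection (\<lambda>\<zeta>. cnj (bdry f \<zeta>)) z = cnj (f 0)"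
proof -
  have "(\<lambda>n. fourier_coeff (\<lambda>\<zeta>. cnj (bdry f \<zeta>)) n * z ^ n) sums riesz_projection (\<lambda>\<zeta>. cnj (bdry f \<zeta>)) z"
    by (rule riesz_projection_sums[OF L2_integrable_self[OF L2_cnj[OF hardy2_bdry_L2[OF f]]] z])
  moreover have "(\<lambda>n. if n = 0 then cnj (f 0) * z ^ n else 0) sums (cnj (f 0) * z ^ 0)"
    by (rule sums_single)
  moreover have "(\<lambda>n. fourier_coeff (\<lambda>\<zeta>. cnj (bdry f \<zeta>)) n * z ^ n) = (\<lambda>n. if n = 0 then cnj (f 0) * z ^ n else 0)"
    by (auto simp: fourier_coeff_cnj_bdry[OF f])
  ultimately show ?thesis by (auto simp: sums_iff)
qed

section \<open>Products with bounded factors and the Poisson representation in H^2\<close>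

lemma hardy2_mult_bounded:
  assumes f: "f \<in> hardy 2" and g: "g holomorphic_on unit_disc" and C: "\<And>z. z \<in> unit_disc \<Longrightarrow> norm (g z) \<le> C"
  shows "(\<lambda>z. g z * f z) \<in> hardy 2"
proof -
  obtain B where B: "\<And>r. 0 \<le> r \<Longrightarrow> r < 1 \<Longrightarrow> mean2 f r \<le> B"
    using f unfolding hardy2_iff by blast
  have "mean2 (\<lambda>z. g z * f z) r \<le> C\<^sup>2 * B" if r: "0 \<le> r" "r < 1" for r
  proof -
    have L: "(\<lambda>\<zeta>. f (of_real r * \<zeta>)) \<in> L2" "(\<lambda>\<zeta>. g (of_real r * \<zeta>) * f (of_real r * \<zeta>)) \<in> L2"
      by (intro L2_continuous continuous_on_mult continuous_on_circle_dilation g hardy2_holomorphic f r)+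
    have "mean2 (\<lambda>z. g z * f z) r \<le> (LINT \<zeta>|\<mu>. C\<^sup>2 * (norm (f (of_real r * \<zeta>)))\<^sup>2)"
    proof (rule integral_mono)
      fix \<zeta> assume "\<zeta> \<in> space \<mu>"
      then have "norm (g (of_real r * \<zeta>)) \<le> C" using r by (intro C) (simp add: norm_mult)
      then show "(norm (g (of_real r * \<zeta>) * f (of_real r * \<zeta>)))\<^sup>2 \<le> C\<^sup>2 * (norm (f (of_real r * \<zeta>)))\<^sup>2"
        unfolding norm_mult power_mult_distrib by (intro mult_right_mono power_mono) auto
    qed (use L2_integrable L in auto)
    also have "\<dots> = C\<^sup>2 * mean2 f r" by simp
    also have "\<dots> \<le> C\<^sup>2 * B" using B r by (intro mult_left_mono) auto
    finally show ?thesis .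
  qed
  then show ?thesis unfolding hardy2_iff using g hardy2_holomorphic[OF f] by (auto intro!: holomorphic_intros)
qed

lemma bdry_continuous:
  fixes g :: "complex \<Rightarrow> complex"
  assumes "isCont g \<zeta>"
  shows "((\<lambda>r. g (of_real r * \<zeta>)) \<longlongrightarrow> g \<zeta>) (at_left (1::real))"
proof (rule isCont_tendsto_compose[OF assms])
  have "((\<lambda>r. of_real r * \<zeta>) \<longlongrightarrow> of_real 1 * \<zeta>) (at_left (1::real))" by (intro tendsto_intros)
  then show "((\<lambda>r. of_real r * \<zeta>) \<longlongrightarrow> \<zeta>) (at_left (1::real))" by simp
qed

lemma szego_isCont: "w \<in> unit_disc \<Longrightarrow> \<zeta> \<in> unit_circle \<Longrightarrow> isCont (szego w) \<zeta>"
  unfolding szego_def by (intro continuous_intros) (use szego_denominator_nonzero[of w \<zeta>] in auto)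

lemma norm_szego_le:
  assumes "w \<in> unit_disc" "norm z \<le> 1"
  shows "norm (szego w z) \<le> 1 / (1 - norm w)"
proof -
  have "norm w * norm z \<le> norm w * 1" using assms by (intro mult_left_mono) auto
  then have "1 - norm w \<le> norm (1 - cnj w * z)"
    using norm_triangle_ineq2[of 1 "cnj w * z"] by (simp add: norm_mult)
  then show ?thesis using assms by (auto simp: szego_def norm_divide intro!: divide_left_mono mult_pos_pos)
qed

lemma szego_mult_hardy: "f \<in> hardy 2 \<Longrightarrow> w \<in> unit_disc \<Longrightarrow> (\<lambda>z. szego w z * f z) \<in> hardy 2"
  by (rule hardy2_mult_bounded[where C="1 / (1 - norm w)"]) (auto intro: szego_holomorphic norm_szego_le)

lemma bdry_mult_AE:
  assumes f: "f \<in> hardy 2" and g: "\<And>\<zeta>. \<zeta> \<in> unit_circle \<Longrightarrow> isCont g \<zeta>"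
  shows "AE \<zeta> in \<mu>. bdry (\<lambda>z. g z * f z) \<zeta> = g \<zeta> * bdry f \<zeta>"
  using hardy2_tendsto_bdry[OF f] AE_space
proof eventually_elim
  case (elim \<zeta>)
  then show ?case by (intro bdry_eqI tendsto_mult bdry_continuous g) auto
qed

text \<open>The argument of \<open>poisson_formula\<close>, with
  \<open>riesz_projection_bdry\<close> in place of Cauchy's formula on a larger disc.\<close>

theorem hardy2_poisson_formula:
  assumes f: "f \<in> hardy 2" and w: "w \<in> unit_disc"
  shows "f w = (LINT \<zeta>|\<mu>. of_real (poisson_kernel w \<zeta>) * bdry f \<zeta>)"
proof -
  let ?F = "\<lambda>z. szego w z * f z"
  have F: "?F \<in> hardy 2" by (rule szego_mult_hardy[OF f w])
  have nw: "norm w < 1" using w by simp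
  note [measurable] = L2_measurable[OF hardy2_bdry_L2[OF f]] L2_measurable[OF hardy2_bdry_L2[OF F]]
    borel_measurable_circle_continuous[OF poisson_kernel_continuous[OF w]]
  have szb: "AE \<zeta> in \<mu>. bdry ?F \<zeta> = szego w \<zeta> * bdry f \<zeta>"
    by (intro bdry_mult_AE f szego_isCont w)
  have ne: "szego w w \<noteq> 0" using szego_denominator_nonzero[OF nw, of w] nw by (simp add: szego_def)
  have "szego w w * f w = riesz_projection (bdry ?F) w" using riesz_projection_bdry[OF F w] by simp
  also have "\<dots> = (LINT \<zeta>|\<mu>. szego w w * (of_real (poisson_kernel w \<zeta>) * bdry f \<zeta>))"
    unfolding riesz_projection_def
  proof (rule integral_cong_AE)
    show "AE \<zeta> in \<mu>. bdry ?F \<zeta> / (1 - cnj \<zeta> * w) = szego w w * (of_real (poisson_kernel w \<zeta>) * bdry f \<zeta>)"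
      using szb AE_space
    proof eventually_elim
      case (elim \<zeta>)
      then have z: "\<zeta> \<in> unit_circle" by simp
      show ?case
        unfolding elim(1) times_divide_eq_left[symmetric] szego_poisson_kernel[OF z w] by (simp only: mult_ac)
    qed
  qed measurable
  also have "\<dots> = szego w w * (LINT \<zeta>|\<mu>. of_real (poisson_kernel w \<zeta>) * bdry f \<zeta>)" by simp
  finally show ?thesis using ne by simp
qed

lemma poisson_eq: "poisson \<rho> w = (LINT \<zeta>|\<mu>. poisson_kernel w \<zeta> * \<rho> \<zeta>)"
  by (simp add: poisson_def poisson_kernel_def)

lemma poisson_kernel_integral:
  assumes "w \<in> unit_disc" shows "(LINT \<zeta>|\<mu>. poisson_kernel w \<zeta>) = 1"
proof -
  have "1 = (LINT \<zeta>|\<mu>. complex_of_real (poisson_kernel w \<zeta>) * 1)"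
    by (rule poisson_formula[where R=2]) (use assms in auto)
  then have "complex_of_real 1 = of_real (LINT \<zeta>|\<mu>. poisson_kernel w \<zeta>)" by simp
  then show ?thesis by (simp only: of_real_eq_iff)
qed

lemma poisson_kernel_mult_integrable:
  fixes g :: "complex \<Rightarrow> 'a::{real_normed_field, second_countable_topology, banach}"
  assumes w: "w \<in> unit_disc" and g: "integrable \<mu> g"
  shows "integrable \<mu> (\<lambda>\<zeta>. of_real (poisson_kernel w \<zeta>) * g \<zeta>)"
proof -
  have "bounded (poisson_kernel w ` unit_circle)"
    by (intro compact_imp_bounded compact_continuous_image poisson_kernel_continuous w) auto
  then obtain C where C: "\<And>\<zeta>. \<zeta> \<in> unit_circle \<Longrightarrow> norm (poisson_kernel w \<zeta>) \<le> C" unfolding bounded_iff by blast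
  show ?thesis
    by (rule integrable_mult_AE_bounded[OF g, where C=C])
      (use C in \<open>auto intro!: AE_I2 borel_measurable_circle_continuous continuous_intros poisson_kernel_continuous w\<close>)
qed

text \<open>The Poisson kernel is positive with total mass 1.\<close>

lemma hardy2_bounded_by_bdry:
  assumes f: "f \<in> hardy 2" and C: "AE \<zeta> in \<mu>. norm (bdry f \<zeta>) \<le> C" and w: "w \<in> unit_disc"
  shows "norm (f w) \<le> C"
proof -
  have pk: "integrable \<mu> (poisson_kernel w)"
    using poisson_kernel_mult_integrable[OF w, of "\<lambda>_. 1::real"] by simp
  have i: "integrable \<mu> (\<lambda>\<zeta>. of_real (poisson_kernel w \<zeta>) * bdry f \<zeta>)"
    by (intro poisson_kernel_mult_integrable w L2_integrable_self hardy2_bdry_L2 f)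
  have "norm (f w) \<le> (LINT \<zeta>|\<mu>. norm (of_real (poisson_kernel w \<zeta>) * bdry f \<zeta>))"
    unfolding hardy2_poisson_formula[OF f w] by (rule integral_norm_bound)
  also have "\<dots> \<le> (LINT \<zeta>|\<mu>. poisson_kernel w \<zeta> * C)"
  proof (rule integral_mono_AE)
    show "AE \<zeta> in \<mu>. norm (of_real (poisson_kernel w \<zeta>) * bdry f \<zeta>) \<le> poisson_kernel w \<zeta> * C"
      using C AE_space
    proof eventually_elim
      case (elim \<zeta>)
      then show ?case using poisson_kernel_pos[of \<zeta> w] w by (simp add: norm_mult)
    qed
  qed (use i pk in auto)
  also have "\<dots> = C" using pk poisson_kernel_integral[OF w] by simp
  finally show ?thesis .
qed

text \<open>Jensen's inequality, obtained from 2 a x <= a^2 + x^2 by integration against the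
  probability density \<open>poisson_kernel w\<close>.\<close>

lemma hardy2_norm_sq_le_poisson:
  assumes f: "f \<in> hardy 2" and w: "w \<in> unit_disc"
  shows "(norm (f w))\<^sup>2 \<le> poisson (\<lambda>\<zeta>. (norm (bdry f \<zeta>))\<^sup>2) w"
proof -
  let ?P = "poisson_kernel w" and ?g = "\<lambda>\<zeta>. norm (bdry f \<zeta>)"
  define a where "a = norm (f w)"
  have i1: "integrable \<mu> ?P"
    using poisson_kernel_mult_integrable[OF w, of "\<lambda>_. 1::real"] by simp
  have i2: "integrable \<mu> (\<lambda>\<zeta>. ?P \<zeta> * ?g \<zeta>)"
    using poisson_kernel_mult_integrable[OF w integrable_norm[OF L2_integrable_self[OF hardy2_bdry_L2[OF f]]]] by simp
  have i3: "integrable \<mu> (\<lambda>\<zeta>. ?P \<zeta> * (?g \<zeta>)\<^sup>2)"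
    using poisson_kernel_mult_integrable[OF w L2_integrable[OF hardy2_bdry_L2[OF f]]] by simp
  have "a \<le> (LINT \<zeta>|\<mu>. norm (of_real (?P \<zeta>) * bdry f \<zeta>))"
    unfolding a_def hardy2_poisson_formula[OF f w] by (rule integral_norm_bound)
  also have "\<dots> = (LINT \<zeta>|\<mu>. ?P \<zeta> * ?g \<zeta>)"
    using poisson_kernel_pos[OF _ w] by (intro Bochner_Integration.integral_cong) (auto simp: norm_mult less_imp_le)
  finally have "2 * a * a \<le> 2 * a * (LINT \<zeta>|\<mu>. ?P \<zeta> * ?g \<zeta>)"
    by (intro mult_left_mono) (auto simp: a_def)
  also have "\<dots> = (LINT \<zeta>|\<mu>. 2 * a * (?P \<zeta> * ?g \<zeta>))" by simp
  also have "\<dots> \<le> (LINT \<zeta>|\<mu>. a\<^sup>2 * ?P \<zeta> + ?P \<zeta> * (?g \<zeta>)\<^sup>2)"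
  proof (rule integral_mono)
    fix \<zeta> assume "\<zeta> \<in> space \<mu>"
    then have "?P \<zeta> > 0" using poisson_kernel_pos[OF _ w] by simp
    then have "?P \<zeta> * (2 * a * ?g \<zeta>) \<le> ?P \<zeta> * (a\<^sup>2 + (?g \<zeta>)\<^sup>2)"
      using sum_squares_bound[of a "?g \<zeta>"] by (intro mult_left_mono) auto
    then show "2 * a * (?P \<zeta> * ?g \<zeta>) \<le> a\<^sup>2 * ?P \<zeta> + ?P \<zeta> * (?g \<zeta>)\<^sup>2" by (simp add: algebra_simps)
  qed (use i1 i2 i3 in auto)
  also have "\<dots> = a\<^sup>2 + poisson (\<lambda>\<zeta>. (?g \<zeta>)\<^sup>2) w"
    using i1 i3 poisson_kernel_integral[OF w] by (simp add: poisson_eq)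
  finally show ?thesis by (simp add: a_def power2_eq_square)
qed

section \<open>Necessity\<close>

lemma riesz_projection_cong_AE:
  assumes "F \<in> borel_measurable \<mu>" "G \<in> borel_measurable \<mu>"
    "AE \<zeta> in \<mu>. F \<zeta> = G \<zeta>"
  shows "riesz_projection F z = riesz_projection G z"
  unfolding riesz_projection_def
proof (rule integral_cong_AE)
  show "AE \<zeta> in \<mu>. F \<zeta> / (1 - cnj \<zeta> * z) = G \<zeta> / (1 - cnj \<zeta> * z)"
    using assms(3) by eventually_elim simp
qed (use assms in measurable)

lemma riesz_projection_cmult: "riesz_projection (\<lambda>\<zeta>. c * F \<zeta>) z = c * riesz_projection F z"
  unfolding riesz_projection_def times_divide_eq_right[symmetric] by (rule integral_mult_right_zero)

lemma eventually_at_left_1_disc: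
  assumes "\<zeta> \<in> unit_circle"
  shows "\<forall>\<^sub>F r in at_left (1::real). of_real r * \<zeta> \<in> unit_disc"
  unfolding eventually_at_left_field using assms
  by (intro exI[of _ 0]) (auto simp: norm_mult)

lemma bdry_cong:
  fixes f g :: "complex \<Rightarrow> complex"
  assumes "\<zeta> \<in> unit_circle" "\<And>z. z \<in> unit_disc \<Longrightarrow> f z = g z"
  shows "bdry f \<zeta> = bdry g \<zeta>"
  unfolding bdry_def
  by (rule Lim_cong[OF _ refl]) (rule eventually_mono[OF eventually_at_left_1_disc[OF assms(1)]], rule assms(2))

lemma bdry_eq_of_disc_eq:
  fixes f g :: "complex \<Rightarrow> complex"
  assumes "\<zeta> \<in> unit_circle" "\<And>z. z \<in> unit_disc \<Longrightarrow> f z = g z"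
    "((\<lambda>r. f (of_real r * \<zeta>)) \<longlongrightarrow> a) (at_left (1::real))" "((\<lambda>r. g (of_real r * \<zeta>)) \<longlongrightarrow> b) (at_left (1::real))"
  shows "a = b"
proof -
  have "bdry f \<zeta> = bdry g \<zeta>" by (rule bdry_cong) (fact assms)+
  then show ?thesis using bdry_eqI[of f, OF assms(3)] bdry_eqI[of g, OF assms(4)] by simp
qed

text \<open>Rewrites a Poisson extension as the norm of a test function, the form in which an
  operator bound can be compared with it.\<close>

lemma poisson_norm_sq:
  assumes "w \<in> unit_disc"
  shows "poisson (\<lambda>\<zeta>. (norm (g \<zeta>))\<^sup>2) w = (1 - (norm w)\<^sup>2) * (LINT \<zeta>|\<mu>. (norm (szego w \<zeta> * g \<zeta>))\<^sup>2)"
proof -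
  have "poisson (\<lambda>\<zeta>. (norm (g \<zeta>))\<^sup>2) w = (LINT \<zeta>|\<mu>. (1 - (norm w)\<^sup>2) * (norm (szego w \<zeta> * g \<zeta>))\<^sup>2)"
    unfolding poisson_eq using norm_szego_sq[OF _ assms]
    by (intro Bochner_Integration.integral_cong) (auto simp: norm_mult power_mult_distrib mult.assoc[symmetric])
  then show ?thesis by simp
qed

text \<open>Here \<open>(z - w) * szego w z\<close> is the Blaschke factor at \<open>w\<close>. The
  right side separates the variables, which is why the operator P minus its conjugation by the
  Blaschke factor has rank one.\<close>

lemma blaschke_kernel_identity:
  assumes "\<zeta> \<in> unit_circle" "z \<in> unit_disc" "w \<in> unit_disc"
  shows "(1 - ((z - w) * szego w z) * cnj ((\<zeta> - w) * szego w \<zeta>)) / (1 - cnj \<zeta> * z) =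
    of_real (1 - (norm w)\<^sup>2) * szego w z * cnj (szego w \<zeta>)"
proof -
  have nz: "1 - cnj w * z \<noteq> 0" "1 - w * cnj \<zeta> \<noteq> 0" "1 - cnj \<zeta> * z \<noteq> 0"
    using szego_denominator_nonzero[of w z] szego_denominator_nonzero[of w \<zeta>] szego_denominator_nonzero[of z \<zeta>] assms
    by (auto simp: complex_eq_iff mult.commute)
  have "1 - ((z - w) * szego w z) * cnj ((\<zeta> - w) * szego w \<zeta>) =
     ((1 - cnj w * z) * (1 - w * cnj \<zeta>) - (z - w) * (cnj \<zeta> - cnj w)) * (szego w z * cnj (szego w \<zeta>))"
  proof -
    have "szego w z * (1 - cnj w * z) = 1" "cnj (szego w \<zeta>) * (1 - w * cnj \<zeta>) = 1"
      using nz by (auto simp: szego_def)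
    moreover have "(A * B - P * Q) * (s * t) = (s * A) * (t * B) - (P * s) * (Q * t)" for A B P Q s t :: complex
      by (simp add: algebra_simps)
    ultimately show ?thesis by (simp only: complex_cnj_mult complex_cnj_diff) simp
  qed
  also have "(1 - cnj w * z) * (1 - w * cnj \<zeta>) - (z - w) * (cnj \<zeta> - cnj w) = (1 - w * cnj w) * (1 - cnj \<zeta> * z)"
    by (simp add: algebra_simps)
  also have "1 - w * cnj w = of_real (1 - (norm w)\<^sup>2)" by (simp add: complex_norm_square[symmetric])
  finally show ?thesis using nz by simp
qed

lemma riesz_projection_integrable:
  assumes F: "integrable \<mu> F" and z: "z \<in> unit_disc"
  shows "integrable \<mu> (\<lambda>\<zeta>. F \<zeta> / (1 - cnj \<zeta> * z))"
proof -
  have "integrable \<mu> (\<lambda>\<zeta>. cnj (szego z \<zeta>) * F \<zeta>)"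
  proof (rule integrable_mult_AE_bounded[OF F])
    show "(\<lambda>\<zeta>. cnj (szego z \<zeta>)) \<in> borel_measurable \<mu>"
      by (intro borel_measurable_circle_continuous continuous_on_cnj szego_continuous_circle z)
    show "AE \<zeta> in \<mu>. norm (cnj (szego z \<zeta>)) \<le> 1 / (1 - norm z)"
      using norm_szego_le[OF z] by (auto intro!: AE_I2)
  qed
  also have "(\<lambda>\<zeta>. cnj (szego z \<zeta>) * F \<zeta>) = (\<lambda>\<zeta>. F \<zeta> / (1 - cnj \<zeta> * z))"
    by (simp add: szego_def fun_eq_iff mult.commute)
  finally show ?thesis .
qed

lemma riesz_projection_add:
  assumes F: "integrable \<mu> F" and G: "integrable \<mu> G" and z: "z \<in> unit_disc"
  shows "riesz_projection (\<lambda>\<zeta>. F \<zeta> + G \<zeta>) z = riesz_projection F z + riesz_projection G z"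
  using riesz_projection_integrable[OF F z] riesz_projection_integrable[OF G z]
  by (simp add: riesz_projection_def add_divide_distrib)

text \<open>Both claims follow from \<open>\<zeta> * cnj \<zeta> = 1\<close>. The second exhibits
  the product as the conjugate of a function vanishing at 0, the kind that P annihilates.\<close>

lemma blaschke_circle:
  assumes "\<zeta> \<in> unit_circle" "w \<in> unit_disc"
  shows "norm ((\<zeta> - w) * szego w \<zeta>) = 1" "cnj ((\<zeta> - w) * szego w \<zeta>) * szego w \<zeta> = cnj (\<zeta> * szego w \<zeta>)"
proof -
  have nz: "1 - cnj w * \<zeta> \<noteq> 0" using assms szego_denominator_nonzero[of w \<zeta>] by auto
  then have "norm (\<zeta> - w) \<noteq> 0" using norm_circle_szego_denominator[OF assms(1), of w] by auto
  then show "norm ((\<zeta> - w) * szego w \<zeta>) = 1"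
    using norm_circle_szego_denominator[OF assms(1), of w] by (simp add: szego_def norm_mult norm_divide)
  have "\<zeta> * cnj \<zeta> = 1" using assms by (simp add: complex_norm_square[symmetric])
  then have "cnj \<zeta> - cnj w = cnj \<zeta> * (1 - cnj w * \<zeta>)" by (simp add: algebra_simps)
  then have "cnj (\<zeta> - w) * szego w \<zeta> = cnj \<zeta>" using nz by (simp add: szego_def)
  then show "cnj ((\<zeta> - w) * szego w \<zeta>) * szego w \<zeta> = cnj (\<zeta> * szego w \<zeta>)"
    by (simp add: mult_ac)
qed

text \<open>The kernel identity integrated against \<open>G\<close>. Integrability of
  \<open>G\<close> is the right generality, since \<open>G\<close> will be
  \<open>cnj v * f\<close>.\<close>

lemma riesz_projection_blaschke:
  assumes G: "integrable \<mu> G" and z: "z \<in> unit_disc" and w: "w \<in> unit_disc"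
  shows "riesz_projection G z - ((z - w) * szego w z) * riesz_projection (\<lambda>\<zeta>. cnj ((\<zeta> - w) * szego w \<zeta>) * G \<zeta>) z
    = of_real (1 - (norm w)\<^sup>2) * szego w z * (LINT \<zeta>|\<mu>. G \<zeta> * cnj (szego w \<zeta>))"
proof -
  let ?\<phi> = "\<lambda>\<zeta>. (\<zeta> - w) * szego w \<zeta>"
  have m: "(\<lambda>\<zeta>. cnj (?\<phi> \<zeta>)) \<in> borel_measurable \<mu>"
    by (intro borel_measurable_circle_continuous continuous_intros szego_continuous_circle w)
  have i: "integrable \<mu> (\<lambda>\<zeta>. cnj (?\<phi> \<zeta>) * G \<zeta>)"
  proof (rule integrable_mult_AE_bounded[OF G m])
    show "AE \<zeta> in \<mu>. norm (cnj (?\<phi> \<zeta>)) \<le> 1"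
      unfolding complex_mod_cnj using blaschke_circle(1)[OF _ w] by (auto intro!: AE_I2)
  qed
  note j = riesz_projection_integrable[OF G z] riesz_projection_integrable[OF i z]
  have "riesz_projection G z - ?\<phi> z * riesz_projection (\<lambda>\<zeta>. cnj (?\<phi> \<zeta>) * G \<zeta>) z =
     (LINT \<zeta>|\<mu>. G \<zeta> / (1 - cnj \<zeta> * z) - ?\<phi> z * (cnj (?\<phi> \<zeta>) * G \<zeta> / (1 - cnj \<zeta> * z)))"
    unfolding riesz_projection_def
    by (subst Bochner_Integration.integral_diff[OF j(1) integrable_mult_right[OF j(2)]])
      (simp only: integral_mult_right_zero)
  also have "\<dots> = (LINT \<zeta>|\<mu>. of_real (1 - (norm w)\<^sup>2) * szego w z * (G \<zeta> * cnj (szego w \<zeta>)))"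
  proof (rule Bochner_Integration.integral_cong)
    fix \<zeta> assume "\<zeta> \<in> space \<mu>"
    then have "\<zeta> \<in> unit_circle" by simp
    from blaschke_kernel_identity[OF this z w]
    have "G \<zeta> * ((1 - ?\<phi> z * cnj (?\<phi> \<zeta>)) / (1 - cnj \<zeta> * z)) = G \<zeta> * (of_real (1 - (norm w)\<^sup>2) * szego w z * cnj (szego w \<zeta>))"
      by (simp only:)
    moreover have "G \<zeta> * ((1 - ?\<phi> z * cnj (?\<phi> \<zeta>)) / (1 - cnj \<zeta> * z)) =
       G \<zeta> / (1 - cnj \<zeta> * z) - ?\<phi> z * (cnj (?\<phi> \<zeta>) * G \<zeta> / (1 - cnj \<zeta> * z))"
      by (simp add: right_diff_distrib diff_divide_distrib mult_ac)
    ultimately show "G \<zeta> / (1 - cnj \<zeta> * z) - ?\<phi> z * (cnj (?\<phi> \<zeta>) * G \<zeta> / (1 - cnj \<zeta> * z)) =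
      of_real (1 - (norm w)\<^sup>2) * szego w z * (G \<zeta> * cnj (szego w \<zeta>))" by (simp only: mult_ac)
  qed simp
  finally show ?thesis by simp
qed

lemma toeplitz_symbol_integrable:
  assumes "f \<in> hardy 2" "v \<in> hardy 2"
  shows "integrable \<mu> (\<lambda>\<zeta>. cnj (bdry v \<zeta>) * bdry f \<zeta>)"
  by (intro L2_integrable_mult L2_cnj hardy2_bdry_L2 assms)

theorem toeplitz_product_bounded_imp:
  assumes u: "u \<in> hardy 2" and v: "v \<in> hardy 2"
    and bd: "bounded_on_H2 (toeplitz_product u (bdry v))"
  shows "bdd_above ((\<lambda>w. poisson (\<lambda>\<zeta>. (norm (bdry u \<zeta>))\<^sup>2) w *
                          poisson (\<lambda>\<zeta>. (norm (bdry v \<zeta>))\<^sup>2) w) ` unit_disc)"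
proof -
  let ?T = "toeplitz_product u (bdry v)"
  obtain C where TH: "\<And>f. f \<in> hardy 2 \<Longrightarrow> ?T f \<in> hardy 2"
    and C: "\<And>f. f \<in> hardy 2 \<Longrightarrow> Lp_norm 2 (bdry (?T f)) \<le> C * Lp_norm 2 (bdry f)"
    using bd unfolding bounded_on_H2_def by blast
  have TN: "norm_sq (bdry (?T f)) \<le> C\<^sup>2 * norm_sq (bdry f)" if "f \<in> hardy 2" for f
  proof -
    have "(Lp_norm 2 (bdry (?T f)))\<^sup>2 \<le> (C * Lp_norm 2 (bdry f))\<^sup>2"
      by (rule power_mono[OF C[OF that]]) (simp add: Lp_norm_2)
    then show ?thesis by (simp add: Lp_norm_2 power_mult_distrib)
  qed
  have "poisson (\<lambda>\<zeta>. (norm (bdry u \<zeta>))\<^sup>2) w * poisson (\<lambda>\<zeta>. (norm (bdry v \<zeta>))\<^sup>2) w \<le> 4 * C\<^sup>2"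
    if w: "w \<in> unit_disc" for w
  proof -
    define \<phi> where "\<phi> = (\<lambda>z. (z - w) * szego w z)"
    define d where "d = 1 - (norm w)\<^sup>2"
    have d: "d > 0" using w by (simp add: d_def power_less_one_iff abs_square_less_1)
    \<comment> \<open>The factor v makes \<open>cnj v * f * cnj (szego w)\<close> equal to the
      squared modulus of \<open>szego w * v\<close>, whose integral is a Poisson extension up to the
      factor \<open>d\<close>.\<close>
    define f where "f = (\<lambda>z. szego w z * v z)"
    have f: "f \<in> hardy 2" unfolding f_def by (rule szego_mult_hardy[OF v w])
    have bf: "AE \<zeta> in \<mu>. bdry f \<zeta> = szego w \<zeta> * bdry v \<zeta>"
      unfolding f_def by (intro bdry_mult_AE v szego_isCont w)
    define pu where "pu = poisson (\<lambda>\<zeta>. (norm (bdry u \<zeta>))\<^sup>2) w"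
    define pv where "pv = poisson (\<lambda>\<zeta>. (norm (bdry v \<zeta>))\<^sup>2) w"
    note bL = hardy2_bdry_L2
    have \<phi>cont: "continuous_on unit_circle \<phi>"
      unfolding \<phi>_def by (intro continuous_intros szego_continuous_circle w)
    have \<phi>C: "isCont \<phi> \<zeta>" if "\<zeta> \<in> unit_circle" for \<zeta>
      unfolding \<phi>_def by (intro continuous_intros szego_isCont[OF w that])
    have \<phi>1: "norm (\<phi> \<zeta>) = 1" if "\<zeta> \<in> unit_circle" for \<zeta>
      unfolding \<phi>_def by (rule blaschke_circle(1)[OF that w])
    have cm[measurable]: "(\<lambda>\<zeta>. cnj (\<phi> \<zeta>)) \<in> borel_measurable \<mu>" "\<phi> \<in> borel_measurable \<mu>"
      by (intro borel_measurable_circle_continuous continuous_intros \<phi>cont)+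
    have sz[measurable]: "szego w \<in> borel_measurable \<mu>"
      by (intro borel_measurable_circle_continuous szego_continuous_circle w)
    note [measurable] = L2_measurable[OF bL[OF u]] L2_measurable[OF bL[OF v]] L2_measurable[OF bL[OF f]]
    define G where "G = (\<lambda>\<zeta>. cnj (\<phi> \<zeta>) * bdry f \<zeta>)"
    have GL: "G \<in> L2" unfolding G_def
      by (rule L2_mult_bounded[OF bL[OF f] cm(1), where C=1]) (use \<phi>1 in \<open>auto intro!: AE_I2\<close>)
    have NG: "norm_sq G = norm_sq (bdry f)"
      by (rule Bochner_Integration.integral_cong) (use \<phi>1 in \<open>auto simp: G_def norm_mult\<close>)
    \<comment> \<open>\<open>cnj \<phi> * f\<close> need not be analytic, while the operator acts on
      H^2. Its projection takes its place; \<open>Rh\<close> shows that this does not change the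
      result.\<close>
    define h where "h = riesz_projection G"
    have h: "h \<in> hardy 2" unfolding h_def by (rule riesz_projection_hardy[OF GL])
    have Nh: "norm_sq (bdry h) \<le> norm_sq (bdry f)"
      unfolding NG[symmetric]
      by (rule hardy2_bdry_norm_le[OF h]) (use riesz_projection_mean2_le[OF GL] in \<open>simp add: h_def\<close>)
    have fw: "(LINT \<zeta>|\<mu>. bdry f \<zeta> * cnj (szego w \<zeta>)) = f w"
      using riesz_projection_bdry[OF f w]
      by (simp add: riesz_projection_def szego_def divide_inverse mult.commute)
    \<comment> \<open>The rank one identity for \<open>bdry f\<close> itself. Division by
      \<open>\<phi>\<close> on the circle then computes the boundary values of
      \<open>h\<close>.\<close>
    have \<phi>h: "f z - of_real d * f w * szego w z = \<phi> z * h z" if z: "z \<in> unit_disc" for z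
    proof -
      have "riesz_projection (bdry f) z - \<phi> z * riesz_projection (\<lambda>\<zeta>. cnj (\<phi> \<zeta>) * bdry f \<zeta>) z
          = of_real d * szego w z * (LINT \<zeta>|\<mu>. bdry f \<zeta> * cnj (szego w \<zeta>))"
        unfolding \<phi>_def d_def by (rule riesz_projection_blaschke[OF L2_integrable_self[OF bL[OF f]] z w])
      then show ?thesis unfolding riesz_projection_bdry[OF f z] fw h_def G_def by (simp only: algebra_simps)
    qed
    have bh: "AE \<zeta> in \<mu>. bdry h \<zeta> = cnj (\<phi> \<zeta>) * bdry f \<zeta> - of_real d * f w * cnj (\<zeta> * szego w \<zeta>)"
      using hardy2_tendsto_bdry[OF f] hardy2_tendsto_bdry[OF h] AE_space
    proof eventually_elim
      case (elim \<zeta>)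
      then have z: "\<zeta> \<in> unit_circle" by simp
      have lim: "((\<lambda>r. f (of_real r * \<zeta>) - of_real d * f w * szego w (of_real r * \<zeta>))
          \<longlongrightarrow> bdry f \<zeta> - of_real d * f w * szego w \<zeta>) (at_left (1::real))"
        "((\<lambda>r. \<phi> (of_real r * \<zeta>) * h (of_real r * \<zeta>)) \<longlongrightarrow> \<phi> \<zeta> * bdry h \<zeta>) (at_left (1::real))"
        by (intro tendsto_diff tendsto_mult tendsto_const elim bdry_continuous \<phi>C szego_isCont w z)+
      have "bdry f \<zeta> - of_real d * f w * szego w \<zeta> = \<phi> \<zeta> * bdry h \<zeta>"
        by (rule bdry_eq_of_disc_eq[of \<zeta> "\<lambda>z. f z - of_real d * f w * szego w z" "\<lambda>z. \<phi> z * h z", OF z \<phi>h lim])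
      then have "cnj (\<phi> \<zeta>) * (bdry f \<zeta> - of_real d * f w * szego w \<zeta>) = (\<phi> \<zeta> * cnj (\<phi> \<zeta>)) * bdry h \<zeta>"
        by (simp add: mult_ac)
      also have "\<phi> \<zeta> * cnj (\<phi> \<zeta>) = 1" using \<phi>1[OF z] by (simp add: complex_norm_square[symmetric])
      finally have "bdry h \<zeta> = cnj (\<phi> \<zeta>) * bdry f \<zeta> - of_real d * f w * (cnj (\<phi> \<zeta>) * szego w \<zeta>)"
        by (simp add: algebra_simps)
      then show ?case using blaschke_circle(2)[OF z w] by (simp only: \<phi>_def)
    qed
    \<comment> \<open>By \<open>bh\<close>, \<open>h\<close> differs from
      \<open>cnj \<phi> * f\<close> on the circle by a term whose product with \<open>cnj v\<close>
      is a multiple of \<open>cnj F\<close>. The factor z gives F(0) = 0, so P removes it.\<close>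
    define F where "F = (\<lambda>z. z * szego w z * v z)"
    have F: "F \<in> hardy 2" unfolding F_def
      by (rule hardy2_mult_bounded[OF v, where C="1 / (1 - norm w)"])
        (use norm_szego_le[OF w] w in \<open>auto intro!: holomorphic_intros szego_holomorphic
          simp: norm_mult intro: order.trans[OF mult_left_le_one_le]\<close>)
    have bF: "AE \<zeta> in \<mu>. bdry F \<zeta> = \<zeta> * szego w \<zeta> * bdry v \<zeta>"
      unfolding F_def by (intro bdry_mult_AE v continuous_intros szego_isCont w)
    let ?G = "\<lambda>\<zeta>. cnj (bdry v \<zeta>) * bdry f \<zeta>"
    have iG: "integrable \<mu> ?G" by (rule toeplitz_symbol_integrable[OF f v])
    have i2: "integrable \<mu> (\<lambda>\<zeta>. cnj (\<phi> \<zeta>) * ?G \<zeta>)"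
      by (rule integrable_mult_AE_bounded[OF iG cm(1), where C=1]) (use \<phi>1 in \<open>auto intro!: AE_I2\<close>)
    have i3: "integrable \<mu> (\<lambda>\<zeta>. cnj (bdry F \<zeta>))"
      by (intro L2_integrable_self L2_cnj bL F)
    have Rh: "riesz_projection (\<lambda>\<zeta>. cnj (bdry v \<zeta>) * bdry h \<zeta>) z = riesz_projection (\<lambda>\<zeta>. cnj (\<phi> \<zeta>) * ?G \<zeta>) z"
      if z: "z \<in> unit_disc" for z
    proof -
      note [measurable] = L2_measurable[OF bL[OF F]] L2_measurable[OF bL[OF h]]
      have "riesz_projection (\<lambda>\<zeta>. cnj (bdry v \<zeta>) * bdry h \<zeta>) z =
         riesz_projection (\<lambda>\<zeta>. cnj (\<phi> \<zeta>) * ?G \<zeta> + (- of_real d * f w) * cnj (bdry F \<zeta>)) z"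
      proof (rule riesz_projection_cong_AE)
        show "AE \<zeta> in \<mu>. cnj (bdry v \<zeta>) * bdry h \<zeta> = cnj (\<phi> \<zeta>) * ?G \<zeta> + (- of_real d * f w) * cnj (bdry F \<zeta>)"
          using bh bF
        proof eventually_elim
          case (elim \<zeta>)
          show ?case unfolding elim by (simp add: algebra_simps)
        qed
      qed measurable
      also have "\<dots> = riesz_projection (\<lambda>\<zeta>. cnj (\<phi> \<zeta>) * ?G \<zeta>) z + (- of_real d * f w) * riesz_projection (\<lambda>\<zeta>. cnj (bdry F \<zeta>)) z"
        unfolding riesz_projection_cmult[symmetric] using i2 i3 z by (intro riesz_projection_add) auto
      also have "riesz_projection (\<lambda>\<zeta>. cnj (bdry F \<zeta>)) z = 0"
        using riesz_projection_cnj_bdry[OF F z] by (simp add: F_def)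
      finally show ?thesis by simp
    qed
    have pvd: "of_real d * (LINT \<zeta>|\<mu>. ?G \<zeta> * cnj (szego w \<zeta>)) = of_real pv"
    proof -
      have "(LINT \<zeta>|\<mu>. ?G \<zeta> * cnj (szego w \<zeta>)) = (LINT \<zeta>|\<mu>. of_real ((norm (szego w \<zeta> * bdry v \<zeta>))\<^sup>2))"
      proof (rule integral_cong_AE)
        show "AE \<zeta> in \<mu>. ?G \<zeta> * cnj (szego w \<zeta>) = of_real ((norm (szego w \<zeta> * bdry v \<zeta>))\<^sup>2)"
          using bf by eventually_elim (simp only: complex_norm_square complex_cnj_mult mult_ac)
      qed measurable
      also have "\<dots> = of_real (norm_sq (\<lambda>\<zeta>. szego w \<zeta> * bdry v \<zeta>))" by (rule integral_complex_of_real)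
      finally show ?thesis unfolding pv_def poisson_norm_sq[OF w] d_def[symmetric] by simp
    qed
    have key: "?T f z - \<phi> z * ?T h z = of_real pv * szego w z * u z" if z: "z \<in> unit_disc" for z
    proof -
      have "?T f z - \<phi> z * ?T h z = u z * (riesz_projection ?G z - \<phi> z * riesz_projection (\<lambda>\<zeta>. cnj (\<phi> \<zeta>) * ?G \<zeta>) z)"
        unfolding toeplitz_product_def Rh[OF z] by (simp add: algebra_simps)
      also have "\<dots> = u z * (of_real d * szego w z * (LINT \<zeta>|\<mu>. ?G \<zeta> * cnj (szego w \<zeta>)))"
        unfolding \<phi>_def d_def riesz_projection_blaschke[OF iG z w] ..
      also have "\<dots> = u z * szego w z * (of_real d * (LINT \<zeta>|\<mu>. ?G \<zeta> * cnj (szego w \<zeta>)))"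
        by (simp only: mult_ac)
      finally show ?thesis unfolding pvd by (simp only: mult_ac)
    qed
    have bkey: "AE \<zeta> in \<mu>. bdry (?T f) \<zeta> - \<phi> \<zeta> * bdry (?T h) \<zeta> = of_real pv * szego w \<zeta> * bdry u \<zeta>"
      using hardy2_tendsto_bdry[OF TH[OF f]] hardy2_tendsto_bdry[OF TH[OF h]] hardy2_tendsto_bdry[OF u] AE_space
    proof eventually_elim
      case (elim \<zeta>)
      then have z: "\<zeta> \<in> unit_circle" by simp
      have lim: "((\<lambda>r. ?T f (of_real r * \<zeta>) - \<phi> (of_real r * \<zeta>) * ?T h (of_real r * \<zeta>))
          \<longlongrightarrow> bdry (?T f) \<zeta> - \<phi> \<zeta> * bdry (?T h) \<zeta>) (at_left (1::real))"
        "((\<lambda>r. of_real pv * szego w (of_real r * \<zeta>) * u (of_real r * \<zeta>))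
          \<longlongrightarrow> of_real pv * szego w \<zeta> * bdry u \<zeta>) (at_left (1::real))"
        by (intro tendsto_diff tendsto_mult tendsto_const elim bdry_continuous \<phi>C szego_isCont w z)+
      show ?case
        by (rule bdry_eq_of_disc_eq[of \<zeta> "\<lambda>z. ?T f z - \<phi> z * ?T h z" "\<lambda>z. of_real pv * szego w z * u z", OF z key lim])
    qed
    have TL: "bdry (?T f) \<in> L2" "bdry (?T h) \<in> L2" using bL TH f h by auto
    have uL: "(\<lambda>\<zeta>. szego w \<zeta> * bdry u \<zeta>) \<in> L2"
      by (rule L2_mult_bounded[OF bL[OF u] sz, where C="1 / (1 - norm w)"])
        (use norm_szego_le[OF w] in \<open>auto intro!: AE_I2\<close>)
    \<comment> \<open>Norms are compared in \<open>bkey\<close>, using |phi| = 1 on the circle. The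
      two images contribute 2 C^2 times the squared norm of \<open>f\<close> each, hence the
      constant 4 C^2.\<close>
    have "pv\<^sup>2 * norm_sq (\<lambda>\<zeta>. szego w \<zeta> * bdry u \<zeta>) = (LINT \<zeta>|\<mu>. pv\<^sup>2 * (norm (szego w \<zeta> * bdry u \<zeta>))\<^sup>2)"
      by simp
    also have "\<dots> \<le> (LINT \<zeta>|\<mu>. 2 * (norm (bdry (?T f) \<zeta>))\<^sup>2 + 2 * (norm (bdry (?T h) \<zeta>))\<^sup>2)"
    proof (rule integral_mono_AE)
      show "AE \<zeta> in \<mu>. pv\<^sup>2 * (norm (szego w \<zeta> * bdry u \<zeta>))\<^sup>2 \<le> 2 * (norm (bdry (?T f) \<zeta>))\<^sup>2 + 2 * (norm (bdry (?T h) \<zeta>))\<^sup>2"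
        using bkey AE_space
      proof eventually_elim
        case (elim \<zeta>)
        let ?a = "bdry (?T f) \<zeta>" and ?b = "bdry (?T h) \<zeta>"
        have "norm (\<phi> \<zeta> * ?b) = norm ?b" using elim \<phi>1[of \<zeta>] by (simp add: norm_mult)
        then have "norm (of_real pv * szego w \<zeta> * bdry u \<zeta>) \<le> norm ?a + norm ?b"
          unfolding elim(1)[symmetric] using norm_triangle_ineq4[of ?a "\<phi> \<zeta> * ?b"] by simp
        then have "(norm (of_real pv * szego w \<zeta> * bdry u \<zeta>))\<^sup>2 \<le> (norm ?a + norm ?b)\<^sup>2"
          by (intro power_mono) auto
        also have "\<dots> \<le> 2 * (norm ?a)\<^sup>2 + 2 * (norm ?b)\<^sup>2"
          using sum_squares_bound[of "norm ?a" "norm ?b"] by (simp add: power2_sum)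
        finally show ?case by (simp add: norm_mult power_mult_distrib mult.assoc)
      qed
    qed (use L2_integrable[OF TL(1)] L2_integrable[OF TL(2)] L2_integrable[OF uL] in auto)
    also have "\<dots> = 2 * norm_sq (bdry (?T f)) + 2 * norm_sq (bdry (?T h))"
      using L2_integrable[OF TL(1)] L2_integrable[OF TL(2)] by simp
    also have "\<dots> \<le> 2 * (C\<^sup>2 * norm_sq (bdry f)) + 2 * (C\<^sup>2 * norm_sq (bdry f))"
      using TN[OF f] TN[OF h] mult_left_mono[OF Nh, of "C\<^sup>2"] by simp
    also have "norm_sq (bdry f) = norm_sq (\<lambda>\<zeta>. szego w \<zeta> * bdry v \<zeta>)"
      by (rule integral_cong_AE) (use bf in \<open>auto elim: eventually_mono\<close>)
    finally have "d * (pv\<^sup>2 * norm_sq (\<lambda>\<zeta>. szego w \<zeta> * bdry u \<zeta>)) \<le> d * (4 * C\<^sup>2 * norm_sq (\<lambda>\<zeta>. szego w \<zeta> * bdry v \<zeta>))"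
      using d by (intro mult_left_mono) auto
    \<comment> \<open>The factor \<open>d\<close> turns both norms into Poisson extensions; one
      power of \<open>pv\<close> then cancels.\<close>
    then have "pv\<^sup>2 * pu \<le> 4 * C\<^sup>2 * pv"
      unfolding pu_def pv_def poisson_norm_sq[OF w] d_def[symmetric] by (simp add: mult_ac)
    moreover have "pv \<ge> 0" unfolding pv_def poisson_norm_sq[OF w] d_def[symmetric] using d
      by (intro mult_nonneg_nonneg Bochner_Integration.integral_nonneg) auto
    ultimately have "pu * pv \<le> 4 * C\<^sup>2"
      by (cases "pv = 0") (auto simp: power2_eq_square mult.assoc mult_ac)
    then show ?thesis by (simp add: pu_def pv_def)
  qed
  then show ?thesis by (intro bdd_aboveI2)
qed

section \<open>Sufficiency\<close>

text \<open>For \<open>\<zeta>\<close> on the circle |1 - cnj(zeta) z| = |z - zeta|. The Lipschitz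
  bound on \<open>p z - p \<zeta>\<close> cancels this denominator and leaves at most L |G| under
  the integral, uniformly in z.\<close>

lemma riesz_projection_commutator_le:
  assumes p: "p holomorphic_on UNIV"
  shows "\<exists>L. \<forall>G z. integrable \<mu> G \<longrightarrow> z \<in> unit_disc \<longrightarrow>
    norm (p z * riesz_projection G z - riesz_projection (\<lambda>\<zeta>. p \<zeta> * G \<zeta>) z) \<le> L * (LINT \<zeta>|\<mu>. norm (G \<zeta>))"
proof -
  have cp: "continuous_on (cball 0 1) p" "continuous_on (cball 0 1) (deriv p)"
    by (intro holomorphic_on_imp_continuous_on holomorphic_on_subset[OF p] holomorphic_on_subset[OF holomorphic_deriv[OF p]]; simp)+
  have "bounded (deriv p ` cball 0 1)" by (intro compact_imp_bounded compact_continuous_image cp) auto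
  then obtain L where L: "\<And>z. z \<in> cball 0 1 \<Longrightarrow> norm (deriv p z) \<le> L" unfolding bounded_iff by blast
  have "norm (p z * riesz_projection G z - riesz_projection (\<lambda>\<zeta>. p \<zeta> * G \<zeta>) z) \<le> L * (LINT \<zeta>|\<mu>. norm (G \<zeta>))"
    if G: "integrable \<mu> G" and z: "z \<in> unit_disc" for G z
  proof -
    have lip: "norm (p z - p \<zeta>) \<le> L * norm (z - \<zeta>)" if "\<zeta> \<in> unit_circle" for \<zeta>
    proof (rule field_differentiable_bound[of "cball 0 1"])
      show "(p has_field_derivative deriv p x) (at x within cball 0 1)" for x
        using holomorphic_derivI[OF p open_UNIV] by (simp add: has_field_derivative_at_within)
    qed (use L z that in auto)
    have cu: "continuous_on unit_circle p" using cp(1) by (rule continuous_on_subset) auto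
    then have "bounded (p ` unit_circle)" by (intro compact_imp_bounded compact_continuous_image) auto
    then obtain C where C: "\<And>z. z \<in> unit_circle \<Longrightarrow> norm (p z) \<le> C" unfolding bounded_iff by blast
    have iG: "integrable \<mu> (\<lambda>\<zeta>. p \<zeta> * G \<zeta>)"
      by (rule integrable_mult_AE_bounded[OF G borel_measurable_circle_continuous[OF cu], where C=C]) (use C in \<open>auto intro!: AE_I2\<close>)
    note i = riesz_projection_integrable[OF G z] riesz_projection_integrable[OF iG z]
    have eq: "p z * riesz_projection G z - riesz_projection (\<lambda>\<zeta>. p \<zeta> * G \<zeta>) z =
       (LINT \<zeta>|\<mu>. p z * (G \<zeta> / (1 - cnj \<zeta> * z)) - p \<zeta> * G \<zeta> / (1 - cnj \<zeta> * z))"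
      unfolding riesz_projection_def
      by (subst Bochner_Integration.integral_diff[OF integrable_mult_right[OF i(1)] i(2)])
        (simp only: integral_mult_right_zero)
    have "norm (p z * riesz_projection G z - riesz_projection (\<lambda>\<zeta>. p \<zeta> * G \<zeta>) z)
      \<le> (LINT \<zeta>|\<mu>. norm (p z * (G \<zeta> / (1 - cnj \<zeta> * z)) - p \<zeta> * G \<zeta> / (1 - cnj \<zeta> * z)))"
      unfolding eq by (rule integral_norm_bound)
    also have "\<dots> \<le> (LINT \<zeta>|\<mu>. L * norm (G \<zeta>))"
    proof (rule integral_mono)
      show "integrable \<mu> (\<lambda>\<zeta>. norm (p z * (G \<zeta> / (1 - cnj \<zeta> * z)) - p \<zeta> * G \<zeta> / (1 - cnj \<zeta> * z)))"
        by (rule integrable_norm[OF Bochner_Integration.integrable_diff[OF integrable_mult_right[OF i(1)] i(2)]])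
      show "integrable \<mu> (\<lambda>\<zeta>. L * norm (G \<zeta>))" using G by auto
      fix \<zeta> assume "\<zeta> \<in> space \<mu>"
      then have t: "\<zeta> \<in> unit_circle" by simp
      have n: "norm (1 - cnj \<zeta> * z) = norm (z - \<zeta>)"
      proof -
        have "norm (1 - cnj \<zeta> * z) = norm (cnj (1 - cnj z * \<zeta>))" by (simp add: mult.commute)
        also have "\<dots> = norm (\<zeta> - z)" unfolding complex_mod_cnj by (rule norm_circle_szego_denominator[OF t])
        finally show ?thesis by (simp add: norm_minus_commute)
      qed
      have pos: "norm (z - \<zeta>) > 0" using t z by auto
      have "norm (p z * (G \<zeta> / (1 - cnj \<zeta> * z)) - p \<zeta> * G \<zeta> / (1 - cnj \<zeta> * z)) = norm ((p z - p \<zeta>) * G \<zeta> / (1 - cnj \<zeta> * z))"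
        by (simp add: algebra_simps diff_divide_distrib)
      also have "\<dots> = norm (p z - p \<zeta>) * norm (G \<zeta>) / norm (z - \<zeta>)" by (simp only: norm_divide norm_mult n)
      also have "\<dots> \<le> (L * norm (z - \<zeta>)) * norm (G \<zeta>) / norm (z - \<zeta>)"
        by (intro divide_right_mono mult_right_mono lip t) auto
      also have "\<dots> = L * norm (G \<zeta>)" using pos by simp
      finally show "norm (p z * (G \<zeta> / (1 - cnj \<zeta> * z)) - p \<zeta> * G \<zeta> / (1 - cnj \<zeta> * z)) \<le> L * norm (G \<zeta>)" .
    qed
    finally show ?thesis by simp
  qed
  then show ?thesis by (intro exI[of _ L] allI impI)
qed

lemma L2_integral_norm_sq_le:
  assumes "g \<in> L2"
  shows "(LINT \<zeta>|\<mu>. norm (g \<zeta>))\<^sup>2 \<le> norm_sq g"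
proof -
  have "(\<lambda>_. 1) \<in> L2" by (rule L2_continuous) auto
  from L2_cauchy_schwarz[OF assms this] show ?thesis
    using circle.prob_space[unfolded space_circle_measure] by simp
qed

text \<open>
  Multiplying \<open>P (cnj v f)\<close> by \<open>q\<close> and factoring \<open>q cnj v f = p g\<close> costs only commutators of \<open>P\<close> with
  Lipschitz functions, which map \<open>L\<^sup>1\<close> to bounded functions; hence
  \<open>u P (cnj v f) = (u p / q) P g + (u / q) E\<close> with \<open>E\<close> bounded.
\<close>

lemma toeplitz_product_bounded_by_factors:
  assumes u: "u \<in> hardy 2" and v: "v \<in> hardy 2"
    and p: "p holomorphic_on UNIV" and q: "q holomorphic_on UNIV"
    and p0: "AE \<zeta> in \<mu>. p \<zeta> \<noteq> 0" and q0: "\<And>z. z \<in> unit_disc \<Longrightarrow> q z \<noteq> 0"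
    and up: "\<And>z. z \<in> unit_disc \<Longrightarrow> norm (u z) * norm (p z) \<le> A * norm (q z)"
    and vq: "AE \<zeta> in \<mu>. norm (bdry v \<zeta>) * norm (q \<zeta>) \<le> B * norm (p \<zeta>)"
    and uq: "(\<lambda>z. u z / q z) \<in> hardy 2"
  shows "bounded_on_H2 (toeplitz_product u (bdry v))"
proof -
  let ?T = "toeplitz_product u (bdry v)"
  note bL = hardy2_bdry_L2
  obtain D where D: "\<And>r. 0 \<le> r \<Longrightarrow> r < 1 \<Longrightarrow> mean2 (\<lambda>z. u z / q z) r \<le> D"
    using uq unfolding hardy2_iff by blast
  obtain L1 where "\<forall>G z. integrable \<mu> G \<longrightarrow> z \<in> unit_disc \<longrightarrow>
    norm (q z * riesz_projection G z - riesz_projection (\<lambda>\<zeta>. q \<zeta> * G \<zeta>) z) \<le> L1 * (LINT \<zeta>|\<mu>. norm (G \<zeta>))"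
    using riesz_projection_commutator_le[OF q] by (elim exE)
  note L1 = this[rule_format]
  obtain L2' where "\<forall>G z. integrable \<mu> G \<longrightarrow> z \<in> unit_disc \<longrightarrow>
    norm (p z * riesz_projection G z - riesz_projection (\<lambda>\<zeta>. p \<zeta> * G \<zeta>) z) \<le> L2' * (LINT \<zeta>|\<mu>. norm (G \<zeta>))"
    using riesz_projection_commutator_le[OF p] by (elim exE)
  note L2 = this[rule_format]
  have [measurable]: "p \<in> borel_measurable \<mu>" "q \<in> borel_measurable \<mu>"
    by (intro borel_measurable_circle_continuous holomorphic_on_imp_continuous_on holomorphic_on_subset[OF p] holomorphic_on_subset[OF q]; simp)+
  \<comment> \<open>Bound for the squared error: its two summands come from the commutators with q
    and p.\<close>
  define K where "K = 2 * L1\<^sup>2 * norm_sq (bdry v) + 2 * L2'\<^sup>2 * B\<^sup>2"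
  define K' where "K' = 2 * A\<^sup>2 * B\<^sup>2 + 2 * K * D"
  have main: "?T f holomorphic_on unit_disc \<and> (\<forall>r. 0 \<le> r \<longrightarrow> r < 1 \<longrightarrow> mean2 (?T f) r \<le> K' * norm_sq (bdry f))"
    if f: "f \<in> hardy 2" for f
  proof -
    let ?G = "\<lambda>\<zeta>. cnj (bdry v \<zeta>) * bdry f \<zeta>"
    have iG: "integrable \<mu> ?G" by (rule toeplitz_symbol_integrable[OF f v])
    note [measurable] = L2_measurable[OF bL[OF v]] L2_measurable[OF bL[OF f]]
    \<comment> \<open>The multiplier that turns f into g with p g = q cnj(v) f. Only moduli enter
      its bound, so \<open>vq\<close> applies although v is conjugated and q is not.\<close>
    define s where "s = (\<lambda>\<zeta>. q \<zeta> * cnj (bdry v \<zeta>) / p \<zeta>)"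
    have sB: "AE \<zeta> in \<mu>. norm (s \<zeta>) \<le> B"
      using vq p0
    proof eventually_elim
      case (elim \<zeta>)
      then show ?case by (simp add: s_def norm_mult norm_divide divide_le_eq mult.commute)
    qed
    have sm[measurable]: "s \<in> borel_measurable \<mu>" unfolding s_def by measurable
    define g where "g = (\<lambda>\<zeta>. s \<zeta> * bdry f \<zeta>)"
    have g: "g \<in> L2" unfolding g_def by (rule L2_mult_bounded[OF bL[OF f] sm sB])
    have Ng: "norm_sq g \<le> B\<^sup>2 * norm_sq (bdry f)"
    proof -
      have "norm_sq g \<le> (LINT \<zeta>|\<mu>. B\<^sup>2 * (norm (bdry f \<zeta>))\<^sup>2)"
      proof (rule integral_mono_AE)
        show "AE \<zeta> in \<mu>. (norm (g \<zeta>))\<^sup>2 \<le> B\<^sup>2 * (norm (bdry f \<zeta>))\<^sup>2"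
          using sB by eventually_elim (auto simp: g_def norm_mult power_mult_distrib intro!: mult_right_mono power_mono)
      qed (use L2_integrable g bL[OF f] in auto)
      then show ?thesis by simp
    qed
    define E where "E = (\<lambda>z. q z * riesz_projection ?G z - p z * riesz_projection g z)"
    have E: "(norm (E z))\<^sup>2 \<le> K * norm_sq (bdry f)" if z: "z \<in> unit_disc" for z
    proof -
      have eq: "riesz_projection (\<lambda>\<zeta>. q \<zeta> * ?G \<zeta>) z = riesz_projection (\<lambda>\<zeta>. p \<zeta> * g \<zeta>) z"
      proof (rule riesz_projection_cong_AE)
        show "AE \<zeta> in \<mu>. q \<zeta> * ?G \<zeta> = p \<zeta> * g \<zeta>"
          using p0 by eventually_elim (simp add: g_def s_def)
        show "(\<lambda>\<zeta>. p \<zeta> * g \<zeta>) \<in> borel_measurable \<mu>" using L2_measurable[OF g] by measurable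
      qed measurable
      define a where "a = L1 * (LINT \<zeta>|\<mu>. norm (?G \<zeta>))"
      define b where "b = L2' * (LINT \<zeta>|\<mu>. norm (g \<zeta>))"
      \<comment> \<open>The two inserted projections agree by \<open>eq\<close>, so the error is a
        difference of two commutators.\<close>
      have Ez: "E z = (q z * riesz_projection ?G z - riesz_projection (\<lambda>\<zeta>. q \<zeta> * ?G \<zeta>) z) -
          (p z * riesz_projection g z - riesz_projection (\<lambda>\<zeta>. p \<zeta> * g \<zeta>) z)"
        unfolding E_def eq by simp
      have "norm (E z) \<le> a + b"
        unfolding Ez a_def b_def
        by (rule order.trans[OF norm_triangle_ineq4 add_mono[OF L1[OF iG z] L2[OF L2_integrable_self[OF g] z]]])
      then have "(norm (E z))\<^sup>2 \<le> (a + b)\<^sup>2" by (intro power_mono) auto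
      also have "\<dots> \<le> 2 * a\<^sup>2 + 2 * b\<^sup>2" using sum_squares_bound[of a b] by (simp add: power2_sum)
      finally have ab: "(norm (E z))\<^sup>2 \<le> 2 * a\<^sup>2 + 2 * b\<^sup>2" .
      have "a\<^sup>2 \<le> L1\<^sup>2 * (norm_sq (bdry v) * norm_sq (bdry f))"
        using L2_cauchy_schwarz[OF L2_cnj[OF bL[OF v]] bL[OF f]] unfolding a_def power_mult_distrib complex_mod_cnj
        by (rule mult_left_mono) simp
      moreover have "b\<^sup>2 \<le> L2'\<^sup>2 * (B\<^sup>2 * norm_sq (bdry f))"
        using order.trans[OF L2_integral_norm_sq_le[OF g] Ng] unfolding b_def power_mult_distrib
        by (rule mult_left_mono) simp
      ultimately have "(norm (E z))\<^sup>2 \<le> 2 * (L1\<^sup>2 * (norm_sq (bdry v) * norm_sq (bdry f))) + 2 * (L2'\<^sup>2 * (B\<^sup>2 * norm_sq (bdry f)))"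
        using ab by linarith
      also have "\<dots> = K * norm_sq (bdry f)" unfolding K_def by (simp only: distrib_right mult.assoc)
      finally show ?thesis .
    qed
    have hol: "?T f holomorphic_on unit_disc"
      unfolding toeplitz_product_def
      by (intro holomorphic_on_mult hardy2_holomorphic u riesz_projection_holomorphic iG)
    have mean: "mean2 (?T f) r \<le> K' * norm_sq (bdry f)" if r: "0 \<le> r" "r < 1" for r
    proof -
      note L = L2_dilation[OF _ r]
      note i = L2_integrable[OF L[OF hol]] L2_integrable[OF L[OF riesz_projection_holomorphic[OF L2_integrable_self[OF g]]]]
        L2_integrable[OF L[OF hardy2_holomorphic[OF uq]]]
      have "mean2 (?T f) r \<le> (LINT \<zeta>|\<mu>. 2 * A\<^sup>2 * (norm (riesz_projection g (of_real r * \<zeta>)))\<^sup>2 +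
          2 * (K * norm_sq (bdry f)) * (norm (u (of_real r * \<zeta>) / q (of_real r * \<zeta>)))\<^sup>2)"
      proof (rule integral_mono)
        fix \<zeta> assume "\<zeta> \<in> space \<mu>"
        then have z: "of_real r * \<zeta> \<in> unit_disc" using r by (simp add: norm_mult)
        define z where "z = of_real r * \<zeta>"
        note z = z[folded z_def]
        \<comment> \<open>The definition of \<open>E\<close> solved for the projection of
          \<open>cnj v * f\<close> and multiplied by u; \<open>q0\<close> permits the
          division.\<close>
        have Tz: "?T f z = u z * p z / q z * riesz_projection g z + u z / q z * E z"
        proof -
          have "a * R = a * b / c * S + a / c * (c * R - b * S)" if "c \<noteq> 0" for a b c R S :: complex
            using that by (simp add: field_simps)
          then show ?thesis unfolding toeplitz_product_def E_def using q0[OF z] .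
        qed
        have "norm (?T f z) \<le> norm (u z * p z / q z * riesz_projection g z) + norm (u z / q z * E z)"
          unfolding Tz by (rule norm_triangle_ineq)
        also have "\<dots> \<le> A * norm (riesz_projection g z) + norm (u z / q z) * norm (E z)"
        proof (intro add_mono)
          have "norm (u z * p z / q z) \<le> A"
            using up[OF z] q0[OF z] by (simp add: norm_mult norm_divide divide_le_eq)
          then show "norm (u z * p z / q z * riesz_projection g z) \<le> A * norm (riesz_projection g z)"
            unfolding norm_mult[of _ "riesz_projection g z"] by (rule mult_right_mono) simp
        qed (rule eq_refl, rule norm_mult)
        finally have "(norm (?T f z))\<^sup>2 \<le> (A * norm (riesz_projection g z) + norm (u z / q z) * norm (E z))\<^sup>2"
          by (intro power_mono) auto
        also have "\<dots> \<le> 2 * (A * norm (riesz_projection g z))\<^sup>2 + 2 * (norm (u z / q z) * norm (E z))\<^sup>2"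
          using sum_squares_bound[of "A * norm (riesz_projection g z)" "norm (u z / q z) * norm (E z)"] by (simp add: power2_sum)
        also have "\<dots> = 2 * A\<^sup>2 * (norm (riesz_projection g z))\<^sup>2 + 2 * ((norm (u z / q z))\<^sup>2 * (norm (E z))\<^sup>2)"
          by (simp only: power_mult_distrib mult.assoc)
        also have "\<dots> \<le> 2 * A\<^sup>2 * (norm (riesz_projection g z))\<^sup>2 + 2 * ((norm (u z / q z))\<^sup>2 * (K * norm_sq (bdry f)))"
          using E[OF z] by (intro add_left_mono mult_left_mono) auto
        finally show "(norm (?T f (of_real r * \<zeta>)))\<^sup>2 \<le> 2 * A\<^sup>2 * (norm (riesz_projection g (of_real r * \<zeta>)))\<^sup>2 +
          2 * (K * norm_sq (bdry f)) * (norm (u (of_real r * \<zeta>) / q (of_real r * \<zeta>)))\<^sup>2"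
          unfolding z_def by (simp only: mult_ac)
      qed (use i in auto)
      also have "\<dots> = 2 * A\<^sup>2 * mean2 (riesz_projection g) r + 2 * (K * norm_sq (bdry f)) * mean2 (\<lambda>z. u z / q z) r"
        using i by simp
      also have "\<dots> \<le> 2 * A\<^sup>2 * (B\<^sup>2 * norm_sq (bdry f)) + 2 * (K * norm_sq (bdry f)) * D"
      proof (intro add_mono mult_left_mono D r)
        show "mean2 (riesz_projection g) r \<le> B\<^sup>2 * norm_sq (bdry f)"
          using riesz_projection_mean2_le[OF g r] Ng by linarith
        show "0 \<le> 2 * (K * norm_sq (bdry f))"
          unfolding K_def by (intro mult_nonneg_nonneg add_nonneg_nonneg Bochner_Integration.integral_nonneg) auto
      qed auto
      also have "\<dots> = K' * norm_sq (bdry f)" unfolding K'_def by (simp only: algebra_simps)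
      finally show ?thesis .
    qed
    show ?thesis using hol mean by blast
  qed
  have TH: "?T f \<in> hardy 2" if "f \<in> hardy 2" for f
    unfolding hardy2_iff using main[OF that] by (elim conjE, intro conjI exI)
  have add: "?T (\<lambda>x. f x + g x) z = ?T f z + ?T g z" if f: "f \<in> hardy 2" and g: "g \<in> hardy 2" and z: "z \<in> unit_disc" for f g z
  proof -
    note [measurable] = L2_measurable[OF bL[OF v]] L2_measurable[OF bL[OF f]] L2_measurable[OF bL[OF g]]
      bdry_measurable[OF holomorphic_on_add[OF hardy2_holomorphic[OF f] hardy2_holomorphic[OF g]]]
    have "riesz_projection (\<lambda>\<zeta>. cnj (bdry v \<zeta>) * bdry (\<lambda>x. f x + g x) \<zeta>) z =
      riesz_projection (\<lambda>\<zeta>. cnj (bdry v \<zeta>) * bdry f \<zeta> + cnj (bdry v \<zeta>) * bdry g \<zeta>) z"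
    proof (rule riesz_projection_cong_AE)
      show "AE \<zeta> in \<mu>. cnj (bdry v \<zeta>) * bdry (\<lambda>x. f x + g x) \<zeta> = cnj (bdry v \<zeta>) * bdry f \<zeta> + cnj (bdry v \<zeta>) * bdry g \<zeta>"
        using hardy2_tendsto_bdry[OF f] hardy2_tendsto_bdry[OF g]
      proof eventually_elim
        case (elim \<zeta>)
        have "bdry (\<lambda>x. f x + g x) \<zeta> = bdry f \<zeta> + bdry g \<zeta>" by (intro bdry_eqI tendsto_add elim)
        then show ?case by (simp add: algebra_simps)
      qed
    qed measurable
    also have "\<dots> = riesz_projection (\<lambda>\<zeta>. cnj (bdry v \<zeta>) * bdry f \<zeta>) z + riesz_projection (\<lambda>\<zeta>. cnj (bdry v \<zeta>) * bdry g \<zeta>) z"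
      by (intro riesz_projection_add toeplitz_symbol_integrable f g v z)
    finally show ?thesis by (simp add: toeplitz_product_def algebra_simps)
  qed
  have scale: "?T (\<lambda>x. a * f x) z = a * ?T f z" if f: "f \<in> hardy 2" for f a z
  proof -
    note [measurable] = L2_measurable[OF bL[OF v]] L2_measurable[OF bL[OF f]]
      bdry_measurable[OF holomorphic_on_mult[OF holomorphic_on_const hardy2_holomorphic[OF f], of a]]
    have "riesz_projection (\<lambda>\<zeta>. cnj (bdry v \<zeta>) * bdry (\<lambda>x. a * f x) \<zeta>) z =
      riesz_projection (\<lambda>\<zeta>. a * (cnj (bdry v \<zeta>) * bdry f \<zeta>)) z"
    proof (rule riesz_projection_cong_AE)
      show "AE \<zeta> in \<mu>. cnj (bdry v \<zeta>) * bdry (\<lambda>x. a * f x) \<zeta> = a * (cnj (bdry v \<zeta>) * bdry f \<zeta>)"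
        using hardy2_tendsto_bdry[OF f]
      proof eventually_elim
        case (elim \<zeta>)
        have "bdry (\<lambda>x. a * f x) \<zeta> = a * bdry f \<zeta>" by (intro bdry_eqI tendsto_mult_left elim)
        then show ?case by simp
      qed
    qed measurable
    then show ?thesis by (simp add: toeplitz_product_def riesz_projection_cmult)
  qed
  have norm: "Lp_norm 2 (bdry (?T f)) \<le> sqrt K' * Lp_norm 2 (bdry f)" if f: "f \<in> hardy 2" for f
  proof -
    have "norm_sq (bdry (?T f)) \<le> K' * norm_sq (bdry f)"
      by (rule hardy2_bdry_norm_le[OF TH[OF f]]) (use main[OF f] in simp)
    then have "sqrt (norm_sq (bdry (?T f))) \<le> sqrt (K' * norm_sq (bdry f))" by (rule real_sqrt_le_mono)
    then show ?thesis by (simp add: Lp_norm_2 real_sqrt_mult)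
  qed
  show ?thesis unfolding bounded_on_H2_def
    by (intro conjI ballI allI exI[of _ "sqrt K'"] TH add scale norm)
qed

lemma outer_nonzero: "outer f \<Longrightarrow> z \<in> unit_disc \<Longrightarrow> f z \<noteq> 0"
  by (auto simp: outer_def)

section \<open>From local to global bounds by compactness\<close>

lemma compact_finite_cover_constant:
  fixes S :: "'a::metric_space set" and e K :: "'a \<Rightarrow> real"
  assumes "compact S" and e: "\<forall>x\<in>S. e x > 0"
  shows "\<exists>C L. C \<subseteq> S \<and> finite C \<and> L \<ge> 0 \<and> (\<forall>z\<in>S. \<exists>x\<in>C. z \<in> ball x (e x) \<and> K x \<le> L)"
proof -
  obtain C where C: "C \<subseteq> S" "finite C" "S \<subseteq> (\<Union>x\<in>C. ball x (e x))"
    using compactE_image[OF assms(1), of S "\<lambda>x. ball x (e x)"] e by (force simp: Bex_def)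
  \<comment> \<open>A sum of absolute values dominates each constant and, unlike a maximum, is also
    meaningful for an empty cover.\<close>
  have "K x \<le> (\<Sum>x\<in>C. \<bar>K x\<bar>)" if "x \<in> C" for x
    using member_le_sum[OF that, of "\<lambda>x. \<bar>K x\<bar>"] C(2) abs_ge_self[of "K x"] by force
  then have "\<exists>x\<in>C. z \<in> ball x (e x) \<and> K x \<le> (\<Sum>x\<in>C. \<bar>K x\<bar>)" if "z \<in> S" for z
    using C(3) that by blast
  with C(1,2) show ?thesis by (intro exI[of _ C] exI[of _ "\<Sum>x\<in>C. \<bar>K x\<bar>"] conjI ballI sum_nonneg) auto
qed

lemma compact_local_bound_imp_bound:
  fixes a b :: "'a::metric_space \<Rightarrow> real"
  assumes S: "compact S" and b: "\<And>z. z \<in> X \<Longrightarrow> 0 \<le> b z"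
    and loc: "\<And>x. x \<in> S \<Longrightarrow> \<exists>e>0. \<exists>K. \<forall>z\<in>ball x e \<inter> X. a z \<le> K * b z"
  shows "\<exists>K\<ge>0. \<forall>z\<in>S \<inter> X. a z \<le> K * b z"
proof -
  obtain e K where eK: "\<forall>x\<in>S. e x > 0"
    "\<And>x z. x \<in> S \<Longrightarrow> z \<in> ball x (e x) \<Longrightarrow> z \<in> X \<Longrightarrow> a z \<le> K x * b z"
    using loc by (metis IntI)
  obtain C L where C: "C \<subseteq> S" "L \<ge> 0" "\<forall>z\<in>S. \<exists>x\<in>C. z \<in> ball x (e x) \<and> K x \<le> L"
    using compact_finite_cover_constant[where e=e and K=K, OF S eK(1)] by (elim exE conjE)
  have "a z \<le> L * b z" if z: "z \<in> S \<inter> X" for z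
  proof -
    obtain x where x: "x \<in> C" "z \<in> ball x (e x)" "K x \<le> L" using C(3) z by blast
    have "a z \<le> K x * b z" using eK(2)[of x z] x z C(1) by blast
    also have "\<dots> \<le> L * b z" using x(3) b z by (intro mult_right_mono) auto
    finally show ?thesis .
  qed
  with C(2) show ?thesis by (intro exI[of _ L] conjI ballI)
qed

lemma compact_local_AE_bound_imp_AE_bound:
  fixes a b :: "'a::metric_space \<Rightarrow> real"
  assumes S: "compact S" and b: "\<And>z. 0 \<le> b z" and sp: "space M \<subseteq> S"
    and loc: "\<And>x. x \<in> S \<Longrightarrow> \<exists>e>0. \<exists>K. AE z in M. z \<in> ball x e \<longrightarrow> a z \<le> K * b z"
  shows "\<exists>K. AE z in M. a z \<le> K * b z"
proof -
  obtain e K where eK: "\<forall>x\<in>S. e x > 0"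
    "\<And>x. x \<in> S \<Longrightarrow> AE z in M. z \<in> ball x (e x) \<longrightarrow> a z \<le> K x * b z"
    using loc by metis
  obtain C L where C: "C \<subseteq> S" "finite C" "\<forall>z\<in>S. \<exists>x\<in>C. z \<in> ball x (e x) \<and> K x \<le> L"
    using compact_finite_cover_constant[where e=e and K=K, OF S eK(1)] by (elim exE conjE)
  have "AE z in M. \<forall>x\<in>C. z \<in> ball x (e x) \<longrightarrow> a z \<le> K x * b z"
    using C eK(2) by (intro AE_finite_allI) auto
  with AE_space have "AE z in M. a z \<le> L * b z"
  proof eventually_elim
    case (elim z)
    then obtain x where x: "x \<in> C" "z \<in> ball x (e x)" "K x \<le> L" using C(3) sp by blast
    have "a z \<le> K x * b z" using elim(2) x by blast
    also have "\<dots> \<le> L * b z" using x(3) by (intro mult_right_mono b)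
    finally show ?case .
  qed
  then show ?thesis by blast
qed

section \<open>Zeros of finite order at points of the circle and the polynomials that carry
  them\<close>

lemma nonzero_continuous_local_bounds:
  fixes g :: "complex \<Rightarrow> complex"
  assumes "isCont g x" "g x \<noteq> 0"
  obtains e c C where "e > 0" "c > 0" "\<And>z. z \<in> ball x e \<Longrightarrow> c \<le> norm (g z) \<and> norm (g z) \<le> C"
proof -
  have "norm (g x) / 2 > 0" using assms by simp
  with assms(1) obtain e where e: "e > 0" "\<And>z. dist z x < e \<Longrightarrow> dist (g z) (g x) < norm (g x) / 2"
    unfolding continuous_at_eps_delta by blast
  show thesis
  proof (rule that[of e "norm (g x) / 2" "2 * norm (g x)"])
    fix z assume "z \<in> ball x e"
    then have "norm (g z - g x) < norm (g x) / 2" using e(2)[of z] by (simp add: dist_norm norm_minus_commute)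
    then show "norm (g x) / 2 \<le> norm (g z) \<and> norm (g z) \<le> 2 * norm (g x)"
      using norm_triangle_ineq2[of "g x" "g z"] norm_triangle_ineq2[of "g z" "g x"]
      by (simp add: norm_minus_commute)
  qed (use e assms in auto)
qed

text \<open>The continuation of \<open>f\<close> cannot vanish identically near \<open>t\<close>,
  because \<open>f\<close> has no zeros in the disc and the disc meets every ball around
  \<open>t\<close>. Its order k at \<open>t\<close> is thus finite, possibly 0, and the remaining
  factor is bounded away from 0 and infinity near \<open>t\<close>.\<close>

lemma analytic_zero_order_bounds:
  assumes t: "t \<in> unit_circle" and an: "analytic_at_bdry f t" and nz: "\<And>z. z \<in> unit_disc \<Longrightarrow> f z \<noteq> 0"
  obtains k :: nat and e c C where "e > 0" "c > 0"
    "\<And>z. z \<in> ball t e \<inter> unit_disc \<Longrightarrow> c * norm (z - t) ^ k \<le> norm (f z) \<and> norm (f z) \<le> C * norm (z - t) ^ k"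
proof -
  obtain e0 g where e0: "e0 > 0" and g: "g holomorphic_on ball t e0" and gf: "\<And>z. z \<in> ball t e0 \<inter> unit_disc \<Longrightarrow> g z = f z"
    using an unfolding analytic_at_bdry_def by blast
  obtain z0 where z0: "z0 \<in> ball t e0 \<inter> unit_disc"
  proof -
    have "t \<in> closure unit_disc" using t by simp
    then obtain z0 where "z0 \<in> unit_disc" "dist z0 t < e0" using e0 closure_approachable[of t unit_disc] by blast
    then show thesis by (intro that[of z0]) (auto simp: dist_commute)
  qed
  obtain k :: nat and r h where r: "r > 0" "r \<le> e0" and h: "h holomorphic_on ball t r" "h t \<noteq> 0"
    and gh: "\<And>z. z \<in> ball t r \<Longrightarrow> g z = (z - t) ^ k * h z"
  proof (cases "g t = 0")
    case False
    then show thesis by (intro that[of e0 g 0]) (use e0 g in auto)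
  next
    case True
    have nc: "\<not> g constant_on ball t e0"
    proof
      assume "g constant_on ball t e0"
      then have "g z0 = g t" using z0 e0 unfolding constant_on_def by (metis IntD1 centre_in_ball)
      then show False using True gf[OF z0] nz[of z0] z0 by auto
    qed
    obtain h r n where "0 < n" "0 < r" "ball t r \<subseteq> ball t e0" "h holomorphic_on ball t r"
      "\<And>w. w \<in> ball t r \<Longrightarrow> g w = (w - t) ^ n * h w" "\<And>w. w \<in> ball t r \<Longrightarrow> h w \<noteq> 0"
      using holomorphic_factor_zero_nonconstant[OF g open_ball connected_ball _ True nc] e0 by (metis centre_in_ball)
    then show thesis by (intro that[of r h n]) (auto simp: ball_subset_ball_iff)
  qed
  have "isCont h t" using holomorphic_on_imp_continuous_on[OF h(1)] r(1)
    by (simp add: continuous_on_eq_continuous_at)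
  from nonzero_continuous_local_bounds[OF this h(2)]
  obtain e c C where e: "e > 0" "c > 0" "\<And>z. z \<in> ball t e \<Longrightarrow> c \<le> norm (h z) \<and> norm (h z) \<le> C" by blast
  show thesis
  proof (rule that[of "min e r" c k C])
    fix z assume z: "z \<in> ball t (min e r) \<inter> unit_disc"
    then have "f z = (z - t) ^ k * h z" using gf[of z] gh[of z] r by auto
    moreover have "c \<le> norm (h z) \<and> norm (h z) \<le> C" using e(3)[of z] z by auto
    ultimately show "c * norm (z - t) ^ k \<le> norm (f z) \<and> norm (f z) \<le> C * norm (z - t) ^ k"
      by (auto simp: norm_mult norm_power mult.commute intro!: mult_right_mono)
  qed (use e r in auto)
qed

text \<open>The polynomials \<open>p\<close> and \<open>q\<close> are two instances over one common
  set \<open>D\<close>; an exponent 0 drops a point.\<close>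

definition zero_prod :: "complex set \<Rightarrow> (complex \<Rightarrow> nat) \<Rightarrow> complex \<Rightarrow> complex" where
  "zero_prod D k z = (\<Prod>t\<in>D. (z - t) ^ k t)"

lemma zero_prod_holomorphic: "zero_prod D k holomorphic_on S"
  unfolding zero_prod_def by (intro holomorphic_intros)

lemma zero_prod_nonzero: "finite D \<Longrightarrow> z \<notin> D \<Longrightarrow> zero_prod D k z \<noteq> 0"
  by (auto simp: zero_prod_def)

lemma zero_prod_isCont: "isCont (zero_prod D k) x"
  unfolding zero_prod_def by (intro continuous_intros)

text \<open>Here \<open>0\<^sup>0 = 1\<close>, so both cases \<open>x \<in> D\<close> and \<open>x \<notin> D\<close> are covered when \<open>k\<close> vanishes outside \<open>D\<close>.\<close>

lemma zero_prod_local_bounds: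
  assumes D: "finite D" and k: "x \<notin> D \<Longrightarrow> k x = 0"
  obtains e c C where "e > 0" "c > 0"
    "\<And>z. z \<in> ball x e \<Longrightarrow> c * norm (z - x) ^ k x \<le> norm (zero_prod D k z) \<and> norm (zero_prod D k z) \<le> C * norm (z - x) ^ k x"
proof -
  have "zero_prod (D - {x}) k x \<noteq> 0" using D by (intro zero_prod_nonzero) auto
  from nonzero_continuous_local_bounds[OF zero_prod_isCont this]
  obtain e c C where e: "e > 0" "c > 0"
    "\<And>z. z \<in> ball x e \<Longrightarrow> c \<le> norm (zero_prod (D - {x}) k z) \<and> norm (zero_prod (D - {x}) k z) \<le> C" by blast
  have eq: "zero_prod D k z = (z - x) ^ k x * zero_prod (D - {x}) k z" for z
  proof (cases "x \<in> D")
    case True then show ?thesis using D by (simp add: zero_prod_def prod.remove)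
  next
    case False then show ?thesis using k by simp
  qed
  show thesis
  proof (rule that[OF e(1,2)])
    fix z assume "z \<in> ball x e"
    then show "c * norm (z - x) ^ k x \<le> norm (zero_prod D k z) \<and> norm (zero_prod D k z) \<le> C * norm (z - x) ^ k x"
      unfolding eq norm_mult norm_power mult.commute[of "norm (z - x) ^ k x"]
      by (intro conjI mult_right_mono conjunct1[OF e(3)] conjunct2[OF e(3)]) auto
  qed
qed

text \<open>At points of \<open>D\<close> the inequality in the disc passes to radial limits. At
  other points of the circle there is no pole, so \<open>bdry f\<close> is locally bounded, and both
  exponents are 0. Compactness of the circle joins these bounds.\<close>

lemma hardy2_bdry_factor_bound:
  assumes f: "f \<in> hardy 2" and D: "finite D" and poles: "poles (bdry f) \<subseteq> D"
    and kl: "\<And>x. x \<notin> D \<Longrightarrow> k x = 0 \<and> l x = 0"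
    and loc: "\<And>t. t \<in> D \<Longrightarrow> \<exists>e>0. \<exists>K. \<forall>z\<in>ball t e \<inter> unit_disc. norm (f z) * norm (z - t) ^ k t \<le> K * norm (z - t) ^ l t"
  shows "\<exists>K. AE \<zeta> in \<mu>. norm (bdry f \<zeta>) * norm (zero_prod D k \<zeta>) \<le> K * norm (zero_prod D l \<zeta>)"
proof (rule compact_local_AE_bound_imp_AE_bound[where S=unit_circle])
  fix x assume x: "x \<in> unit_circle"
  obtain e1 c1 C1 where 1: "e1 > 0" "c1 > 0" "\<And>z. z \<in> ball x e1 \<Longrightarrow> c1 * norm (z - x) ^ k x \<le> norm (zero_prod D k z) \<and> norm (zero_prod D k z) \<le> C1 * norm (z - x) ^ k x"
    using zero_prod_local_bounds[OF D, of x k] kl by metis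
  obtain e2 c2 C2 where 2: "e2 > 0" "c2 > 0" "\<And>z. z \<in> ball x e2 \<Longrightarrow> c2 * norm (z - x) ^ l x \<le> norm (zero_prod D l z) \<and> norm (zero_prod D l z) \<le> C2 * norm (z - x) ^ l x"
    using zero_prod_local_bounds[OF D, of x l] kl by metis
  have "\<exists>e>0. \<exists>K. AE \<zeta> in \<mu>. \<zeta> \<in> ball x e \<longrightarrow> norm (bdry f \<zeta>) * norm (\<zeta> - x) ^ k x \<le> K * norm (\<zeta> - x) ^ l x"
  proof (cases "x \<in> D")
    case True
    then obtain e K where e: "e > 0" "\<And>z. z \<in> ball x e \<inter> unit_disc \<Longrightarrow> norm (f z) * norm (z - x) ^ k x \<le> K * norm (z - x) ^ l x"
      using loc by blast
    have "AE \<zeta> in \<mu>. \<zeta> \<in> ball x e \<longrightarrow> norm (bdry f \<zeta>) * norm (\<zeta> - x) ^ k x \<le> K * norm (\<zeta> - x) ^ l x"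
      using hardy2_tendsto_bdry[OF f] AE_space
    proof eventually_elim
      case (elim \<zeta>)
      show ?case
      proof
        assume z: "\<zeta> \<in> ball x e"
        have lim: "((\<lambda>r. of_real r * \<zeta>) \<longlongrightarrow> of_real 1 * \<zeta>) (at_left (1::real))" by (intro tendsto_intros)
        show "norm (bdry f \<zeta>) * norm (\<zeta> - x) ^ k x \<le> K * norm (\<zeta> - x) ^ l x"
        proof (rule tendsto_le[of "at_left (1::real)"])
          show "((\<lambda>r. norm (f (of_real r * \<zeta>)) * norm (of_real r * \<zeta> - x) ^ k x) \<longlongrightarrow> norm (bdry f \<zeta>) * norm (\<zeta> - x) ^ k x) (at_left 1)"
            using lim elim by (intro tendsto_intros) auto
          show "((\<lambda>r. K * norm (of_real r * \<zeta> - x) ^ l x) \<longlongrightarrow> K * norm (\<zeta> - x) ^ l x) (at_left 1)"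
            using lim by (intro tendsto_intros) auto
          have "\<forall>\<^sub>F r in at_left (1::real). of_real r * \<zeta> \<in> ball x e"
            using topological_tendstoD[OF lim open_ball, of x e] z by simp
          moreover have "\<forall>\<^sub>F r in at_left (1::real). of_real r * \<zeta> \<in> unit_disc"
            using elim by (intro eventually_at_left_1_disc) simp
          ultimately show "\<forall>\<^sub>F r in at_left (1::real). norm (f (of_real r * \<zeta>)) * norm (of_real r * \<zeta> - x) ^ k x \<le> K * norm (of_real r * \<zeta> - x) ^ l x"
            by eventually_elim (rule e(2), simp)
        qed simp
      qed
    qed
    then show ?thesis using e(1) by blast
  next
    case False
    then obtain e where e: "e > 0" "bdry f \<in> Linfty (ball x e)" using poles x unfolding poles_def by blast
    then obtain C where "AE \<zeta> in \<mu>. \<zeta> \<in> ball x e \<longrightarrow> norm (bdry f \<zeta>) \<le> C" unfolding Linfty_def by blast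
    then show ?thesis using kl[OF False] e(1) by (intro exI[of _ e] conjI exI[of _ C]) auto
  qed
  then obtain e3 K where 3: "e3 > 0" "AE \<zeta> in \<mu>. \<zeta> \<in> ball x e3 \<longrightarrow> norm (bdry f \<zeta>) * norm (\<zeta> - x) ^ k x \<le> K * norm (\<zeta> - x) ^ l x"
    by blast
  define e where "e = min e1 (min e2 e3)"
  \<comment> \<open>Absolute values are taken because the signs of \<open>C1\<close> and
    \<open>K\<close> are unknown.\<close>
  have "AE \<zeta> in \<mu>. \<zeta> \<in> ball x e \<longrightarrow> norm (bdry f \<zeta>) * norm (zero_prod D k \<zeta>) \<le> (\<bar>C1\<bar> * \<bar>K\<bar> / c2) * norm (zero_prod D l \<zeta>)"
    using 3(2)
  proof eventually_elim
    case (elim \<zeta>)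
    show ?case
    proof
      assume "\<zeta> \<in> ball x e"
      then have z: "\<zeta> \<in> ball x e1" "\<zeta> \<in> ball x e2" "\<zeta> \<in> ball x e3" by (auto simp: e_def)
      let ?d = "norm (\<zeta> - x)"
      have "norm (zero_prod D k \<zeta>) \<le> \<bar>C1\<bar> * ?d ^ k x"
        using 1(3)[OF z(1)] mult_right_mono[OF abs_ge_self[of C1], of "?d ^ k x"] by auto
      then have "norm (bdry f \<zeta>) * norm (zero_prod D k \<zeta>) \<le> norm (bdry f \<zeta>) * (\<bar>C1\<bar> * ?d ^ k x)"
        by (rule mult_left_mono) simp
      also have "\<dots> = \<bar>C1\<bar> * (norm (bdry f \<zeta>) * ?d ^ k x)" by simp
      also have "\<dots> \<le> \<bar>C1\<bar> * (K * ?d ^ l x)" using elim z by (intro mult_left_mono) auto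
      also have "\<dots> \<le> \<bar>C1\<bar> * (\<bar>K\<bar> * ?d ^ l x)" by (intro mult_left_mono mult_right_mono) auto
      also have "\<dots> \<le> \<bar>C1\<bar> * (\<bar>K\<bar> * (norm (zero_prod D l \<zeta>) / c2))"
        using 2(3)[OF z(2)] 2(2) by (intro mult_left_mono) (auto simp: le_divide_eq mult.commute)
      finally show "norm (bdry f \<zeta>) * norm (zero_prod D k \<zeta>) \<le> (\<bar>C1\<bar> * \<bar>K\<bar> / c2) * norm (zero_prod D l \<zeta>)"
        by simp
    qed
  qed
  moreover have "e > 0" using 1 2 3 by (simp add: e_def)
  ultimately show "\<exists>e>0. \<exists>K. AE \<zeta> in \<mu>. \<zeta> \<in> ball x e \<longrightarrow> norm (bdry f \<zeta>) * norm (zero_prod D k \<zeta>) \<le> K * norm (zero_prod D l \<zeta>)"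
    by blast
qed auto

text \<open>The weight \<open>1 + norm (f z)\<close> treats all points alike: where the exponent is
  0 the bound is trivial even if \<open>f\<close> is unbounded, and elsewhere \<open>f\<close> has
  to decay like the polynomial. Globally the quotient is at most K (1 + |f|), so its square means
  stay bounded.\<close>

lemma hardy2_divide_zero_prod:
  assumes f: "f \<in> hardy 2" and D: "finite D" "D \<subseteq> unit_circle"
    and l: "\<And>x. x \<notin> D \<Longrightarrow> l x = 0"
    and loc: "\<And>t. t \<in> D \<Longrightarrow> \<exists>e>0. \<exists>K. \<forall>z\<in>ball t e \<inter> unit_disc. norm (f z) \<le> K * (norm (z - t) ^ l t * (1 + norm (f z)))"
  shows "(\<lambda>z. f z / zero_prod D l z) \<in> hardy 2"
proof -
  have q0: "zero_prod D l z \<noteq> 0" if "z \<in> unit_disc" for z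
    using that D by (intro zero_prod_nonzero) auto
  have "\<exists>K\<ge>0. \<forall>z\<in>cball 0 1 \<inter> unit_disc. norm (f z) \<le> K * (norm (zero_prod D l z) * (1 + norm (f z)))"
  proof (rule compact_local_bound_imp_bound)
    fix x :: complex assume x: "x \<in> cball 0 1"
    obtain e1 c1 C1 where 1: "e1 > 0" "c1 > 0" "\<And>z. z \<in> ball x e1 \<Longrightarrow> c1 * norm (z - x) ^ l x \<le> norm (zero_prod D l z) \<and> norm (zero_prod D l z) \<le> C1 * norm (z - x) ^ l x"
      using zero_prod_local_bounds[OF D(1), of x l] l by metis
    have "\<exists>e>0. \<exists>K. \<forall>z\<in>ball x e \<inter> unit_disc. norm (f z) \<le> K * (norm (z - x) ^ l x * (1 + norm (f z)))"
    proof (cases "x \<in> D")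
      case False
      then show ?thesis using l[OF False] by (intro exI[of _ 1] conjI) auto
    qed (rule loc)
    then obtain e2 K where 2: "e2 > 0" "\<And>z. z \<in> ball x e2 \<inter> unit_disc \<Longrightarrow> norm (f z) \<le> K * (norm (z - x) ^ l x * (1 + norm (f z)))" by blast
    show "\<exists>e>0. \<exists>K. \<forall>z\<in>ball x e \<inter> unit_disc. norm (f z) \<le> K * (norm (zero_prod D l z) * (1 + norm (f z)))"
    proof (rule exI[of _ "min e1 e2"], rule conjI)
      have "norm (f z) \<le> \<bar>K\<bar> / c1 * (norm (zero_prod D l z) * (1 + norm (f z)))"
        if z: "z \<in> ball x (min e1 e2) \<inter> unit_disc" for z
      proof -
        have "norm (f z) \<le> K * (norm (z - x) ^ l x * (1 + norm (f z)))" using 2(2)[of z] z by auto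
        also have "\<dots> \<le> \<bar>K\<bar> * (norm (z - x) ^ l x * (1 + norm (f z)))" by (intro mult_right_mono) auto
        also have "\<dots> \<le> \<bar>K\<bar> * ((norm (zero_prod D l z) / c1) * (1 + norm (f z)))"
          using 1(3)[of z] 1(2) z by (intro mult_left_mono mult_right_mono) (auto simp: le_divide_eq mult.commute)
        finally show ?thesis by simp
      qed
      then show "\<exists>K. \<forall>z\<in>ball x (min e1 e2) \<inter> unit_disc. norm (f z) \<le> K * (norm (zero_prod D l z) * (1 + norm (f z)))"
        by (intro exI[of _ "\<bar>K\<bar> / c1"] ballI)
    qed (use 1 2 in auto)
  qed auto
  then obtain K where K: "K \<ge> 0" "\<And>z. z \<in> unit_disc \<Longrightarrow> norm (f z) \<le> K * (norm (zero_prod D l z) * (1 + norm (f z)))"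
    by (auto simp: Int_absorb1 ball_subset_cball)
  have bound: "norm (f z / zero_prod D l z) \<le> K * (1 + norm (f z))" if "z \<in> unit_disc" for z
    using K(2)[OF that] q0[OF that] by (simp add: norm_divide divide_le_eq mult_ac)
  have hol: "(\<lambda>z. f z / zero_prod D l z) holomorphic_on unit_disc"
    using q0 by (intro holomorphic_on_divide hardy2_holomorphic f zero_prod_holomorphic)
  obtain B where B: "\<And>r. 0 \<le> r \<Longrightarrow> r < 1 \<Longrightarrow> mean2 f r \<le> B" using f unfolding hardy2_iff by blast
  have "mean2 (\<lambda>z. f z / zero_prod D l z) r \<le> K\<^sup>2 * (2 + 2 * B)" if r: "0 \<le> r" "r < 1" for r
  proof -
    note L = L2_dilation[OF _ r]
    note i = L2_integrable[OF L[OF hol]] L2_integrable[OF L[OF hardy2_holomorphic[OF f]]]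
    have "mean2 (\<lambda>z. f z / zero_prod D l z) r \<le> (LINT \<zeta>|\<mu>. K\<^sup>2 * (2 + 2 * (norm (f (of_real r * \<zeta>)))\<^sup>2))"
    proof (rule integral_mono)
      fix \<zeta> assume "\<zeta> \<in> space \<mu>"
      then have z: "of_real r * \<zeta> \<in> unit_disc" using r by (simp add: norm_mult)
      let ?n = "norm (f (of_real r * \<zeta>))"
      have "(norm (f (of_real r * \<zeta>) / zero_prod D l (of_real r * \<zeta>)))\<^sup>2 \<le> (K * (1 + ?n))\<^sup>2"
        by (rule power_mono[OF bound[OF z]]) simp
      also have "\<dots> \<le> K\<^sup>2 * (2 + 2 * ?n\<^sup>2)"
        unfolding power_mult_distrib using sum_squares_bound[of 1 ?n] by (intro mult_left_mono) (auto simp: power2_sum)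
      finally show "(norm (f (of_real r * \<zeta>) / zero_prod D l (of_real r * \<zeta>)))\<^sup>2 \<le> K\<^sup>2 * (2 + 2 * ?n\<^sup>2)" .
    qed (use i in auto)
    also have "\<dots> = K\<^sup>2 * (2 + 2 * mean2 f r)"
      using i circle.prob_space[unfolded space_circle_measure] by simp
    also have "\<dots> \<le> K\<^sup>2 * (2 + 2 * B)" using B[OF r] by (intro mult_left_mono) auto
    finally show ?thesis .
  qed
  then show ?thesis unfolding hardy2_iff using hol by blast
qed

text \<open>The product of the bounded polynomial with the quotient in \<open>fq\<close> lies in
  H^2, so its bound on the circle enters the disc through the Poisson formula.\<close>

lemma hardy2_factor_bound_disc:
  assumes f: "f \<in> hardy 2" and D: "finite D" "D \<subseteq> unit_circle"
    and fq: "(\<lambda>z. f z / zero_prod D l z) \<in> hardy 2"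
    and bd: "AE \<zeta> in \<mu>. norm (bdry f \<zeta>) * norm (zero_prod D k \<zeta>) \<le> K * norm (zero_prod D l \<zeta>)"
    and z: "z \<in> unit_disc"
  shows "norm (f z) * norm (zero_prod D k z) \<le> K * norm (zero_prod D l z)"
proof -
  let ?F = "\<lambda>z. zero_prod D k z * (f z / zero_prod D l z)"
  have "bounded (zero_prod D k ` cball 0 1)"
    by (intro compact_imp_bounded compact_continuous_image holomorphic_on_imp_continuous_on zero_prod_holomorphic) auto
  then obtain C where C: "\<And>z. z \<in> cball 0 1 \<Longrightarrow> norm (zero_prod D k z) \<le> C" unfolding bounded_iff by blast
  have F: "?F \<in> hardy 2"
    by (rule hardy2_mult_bounded[OF fq zero_prod_holomorphic, where C=C]) (use C in auto)
  have "AE \<zeta> in \<mu>. \<forall>t\<in>D. \<zeta> \<noteq> t" using D(1) by (intro AE_finite_allI AE_circle_neq)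
  with hardy2_tendsto_bdry[OF f] bd have "AE \<zeta> in \<mu>. norm (bdry ?F \<zeta>) \<le> K"
  proof eventually_elim
    case (elim \<zeta>)
    have ne: "zero_prod D l \<zeta> \<noteq> 0" using elim D by (intro zero_prod_nonzero) auto
    have "bdry ?F \<zeta> = zero_prod D k \<zeta> * (bdry f \<zeta> / zero_prod D l \<zeta>)"
      by (intro bdry_eqI tendsto_mult tendsto_divide bdry_continuous zero_prod_isCont ne elim)
    then show ?case using elim(2) ne by (simp add: norm_mult norm_divide divide_le_eq mult.commute)
  qed
  from hardy2_bounded_by_bdry[OF F this z] have "norm (?F z) \<le> K" .
  moreover have "zero_prod D l z \<noteq> 0" using z D by (intro zero_prod_nonzero) auto
  ultimately show ?thesis by (simp add: norm_mult norm_divide divide_le_eq mult.commute)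
qed

text \<open>Applying P to the splitting removes the conjugated part, since \<open>vm\<close>
  vanishes at 0. Conditions on \<open>vp\<close> thereby become conditions on
  \<open>v\<close>.\<close>

lemma L2_split_bdry:
  assumes v: "v \<in> hardy 2" and split: "L2_split (bdry v) vm vp" and z: "z \<in> unit_disc"
  shows "vp z = v z"
proof -
  obtain h where vp: "vp \<in> hardy 2" and h: "h \<in> hardy 2" and vm: "\<And>z. z \<in> unit_disc \<Longrightarrow> vm z = z * h z"
    and AE: "AE \<zeta> in \<mu>. bdry v \<zeta> = cnj (bdry vm \<zeta>) + bdry vp \<zeta>"
    using split unfolding L2_split_def by blast
  let ?m = "\<lambda>z. z * h z"
  have m: "?m \<in> hardy 2" by (rule hardy2_mult_bounded[OF h, where C=1]) (auto intro: holomorphic_intros)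
  have bm: "bdry vm \<zeta> = bdry ?m \<zeta>" if "\<zeta> \<in> unit_circle" for \<zeta> by (rule bdry_cong[OF that vm])
  note [measurable] = L2_measurable[OF hardy2_bdry_L2[OF v]] L2_measurable[OF hardy2_bdry_L2[OF vp]] L2_measurable[OF hardy2_bdry_L2[OF m]]
  have "v z = riesz_projection (bdry v) z" using riesz_projection_bdry[OF v z] by simp
  also have "\<dots> = riesz_projection (\<lambda>\<zeta>. cnj (bdry ?m \<zeta>) + bdry vp \<zeta>) z"
  proof (rule riesz_projection_cong_AE)
    show "AE \<zeta> in \<mu>. bdry v \<zeta> = cnj (bdry ?m \<zeta>) + bdry vp \<zeta>"
      using AE AE_space by eventually_elim (simp add: bm)
  qed measurable
  also have "\<dots> = riesz_projection (\<lambda>\<zeta>. cnj (bdry ?m \<zeta>)) z + riesz_projection (bdry vp) z"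
    by (intro riesz_projection_add L2_integrable_self L2_cnj hardy2_bdry_L2 m vp z)
  also have "\<dots> = vp z" using riesz_projection_cnj_bdry[OF m z] riesz_projection_bdry[OF vp z] by simp
  finally show ?thesis by simp
qed

text \<open>Each squared modulus is at most its own Poisson extension, by Jensen's
  inequality.\<close>

lemma poisson_product_bound_imp:
  assumes u: "u \<in> hardy 2" and v: "v \<in> hardy 2"
    and bd: "bdd_above ((\<lambda>w. poisson (\<lambda>\<zeta>. (norm (bdry u \<zeta>))\<^sup>2) w * poisson (\<lambda>\<zeta>. (norm (bdry v \<zeta>))\<^sup>2) w) ` unit_disc)"
  obtains M where "\<And>z. z \<in> unit_disc \<Longrightarrow> norm (u z) * norm (v z) \<le> M"
proof -
  obtain M where M: "\<And>w. w \<in> unit_disc \<Longrightarrow> poisson (\<lambda>\<zeta>. (norm (bdry u \<zeta>))\<^sup>2) w * poisson (\<lambda>\<zeta>. (norm (bdry v \<zeta>))\<^sup>2) w \<le> M"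
    using bd unfolding bdd_above_def by blast
  show thesis
  proof (rule that[of "sqrt M"])
    fix z :: complex assume z: "z \<in> unit_disc"
    have "(norm (u z) * norm (v z))\<^sup>2 \<le> poisson (\<lambda>\<zeta>. (norm (bdry u \<zeta>))\<^sup>2) z * poisson (\<lambda>\<zeta>. (norm (bdry v \<zeta>))\<^sup>2) z"
      unfolding power_mult_distrib
      using hardy2_norm_sq_le_poisson[OF u z] hardy2_norm_sq_le_poisson[OF v z]
      by (intro mult_mono) (auto intro: order.trans[OF zero_le_power2])
    then have "(norm (u z) * norm (v z))\<^sup>2 \<le> M" using M[OF z] by linarith
    then show "norm (u z) * norm (v z) \<le> sqrt M" by (rule real_le_rsqrt)
  qed
qed

text \<open>Near \<open>t\<close> the function \<open>v\<close> is comparable to |z - t|^k, so the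
  bound on the product lets \<open>u\<close> grow no faster than the inverse of this power. It is
  applied with both assignments of roles.\<close>

lemma pole_cancellation:
  assumes t: "t \<in> unit_circle" and uv: "\<And>z. z \<in> unit_disc \<Longrightarrow> norm (u z) * norm (v z) \<le> M"
    and an: "analytic_at_bdry v t" and v0: "\<And>z. z \<in> unit_disc \<Longrightarrow> v z \<noteq> 0"
  obtains k :: nat and e K where "e > 0" "\<And>z. z \<in> ball t e \<inter> unit_disc \<Longrightarrow>
    norm (u z) * norm (z - t) ^ k \<le> K \<and> norm (v z) \<le> K * norm (z - t) ^ k"
proof -
  obtain k :: nat and e c C where e: "e > 0" "c > 0"
    and b: "\<And>z. z \<in> ball t e \<inter> unit_disc \<Longrightarrow> c * norm (z - t) ^ k \<le> norm (v z) \<and> norm (v z) \<le> C * norm (z - t) ^ k"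
    using analytic_zero_order_bounds[OF t an v0] by metis
  show thesis
  proof (rule that[of e k "max C (M / c)"])
    fix z assume z: "z \<in> ball t e \<inter> unit_disc"
    have "norm (u z) * (c * norm (z - t) ^ k) \<le> norm (u z) * norm (v z)" using b[OF z] by (intro mult_left_mono) auto
    also have "\<dots> \<le> M" using uv[of z] z by auto
    finally have 1: "norm (u z) * norm (z - t) ^ k \<le> M / c" using e(2) by (simp add: field_simps)
    have "norm (v z) \<le> C * norm (z - t) ^ k" using b[OF z] by blast
    also have "\<dots> \<le> max C (M / c) * norm (z - t) ^ k" by (intro mult_right_mono) auto
    finally show "norm (u z) * norm (z - t) ^ k \<le> max C (M / c) \<and> norm (v z) \<le> max C (M / c) * norm (z - t) ^ k"
      using 1 by auto
  qed (rule e)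
qed

theorem corollary5p2:
  fixes u v :: "complex \<Rightarrow> complex"
  assumes "u \<in> hardy 2" and "v \<in> hardy 2"
    and "outer u" and "outer v"
    and "admissible_pair u (bdry v)"
  shows "bounded_on_H2 (toeplitz_product u (bdry v)) \<longleftrightarrow>
         bdd_above ((\<lambda>w. poisson (\<lambda>\<zeta>. (norm (bdry u \<zeta>))\<^sup>2) w *
                          poisson (\<lambda>\<zeta>. (norm (bdry v \<zeta>))\<^sup>2) w) ` unit_disc)"
proof
  assume "bounded_on_H2 (toeplitz_product u (bdry v))"
  then show "bdd_above ((\<lambda>w. poisson (\<lambda>\<zeta>. (norm (bdry u \<zeta>))\<^sup>2) w *
                          poisson (\<lambda>\<zeta>. (norm (bdry v \<zeta>))\<^sup>2) w) ` unit_disc)"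
    by (rule toeplitz_product_bounded_imp[OF assms(1,2)])
next
  assume bd: "bdd_above ((\<lambda>w. poisson (\<lambda>\<zeta>. (norm (bdry u \<zeta>))\<^sup>2) w *
                          poisson (\<lambda>\<zeta>. (norm (bdry v \<zeta>))\<^sup>2) w) ` unit_disc)"
  note u = assms(1) and v = assms(2)
  note u0 = outer_nonzero[OF assms(3)] and v0 = outer_nonzero[OF assms(4)]
  obtain vm vp where split: "L2_split (bdry v) vm vp"
    and fin: "finite (poles (bdry u))" "finite (poles (bdry vp))"
    and an_u: "\<And>t. t \<in> poles (bdry vp) \<Longrightarrow> analytic_at_bdry u t"
    and an_vp: "\<And>t. t \<in> poles (bdry u) \<Longrightarrow> analytic_at_bdry vp t"
    using assms(5) unfolding admissible_pair_def Let_def by blast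
  have vp: "vp \<in> hardy 2" using split unfolding L2_split_def by blast
  note vpv = L2_split_bdry[OF v split]
  have vp0: "\<And>z. z \<in> unit_disc \<Longrightarrow> vp z \<noteq> 0" using vpv v0 by simp
  obtain M where "\<And>z. z \<in> unit_disc \<Longrightarrow> norm (u z) * norm (v z) \<le> M"
    using poisson_product_bound_imp[OF u v bd] by blast
  then have uv: "\<And>z. z \<in> unit_disc \<Longrightarrow> norm (u z) * norm (vp z) \<le> M"
    and vu: "\<And>z. z \<in> unit_disc \<Longrightarrow> norm (vp z) * norm (u z) \<le> M"
    using vpv by (simp_all add: mult.commute)
  define D where "D = poles (bdry u) \<union> poles (bdry vp)"
  have D: "finite D" "D \<subseteq> unit_circle" using fin by (auto simp: D_def poles_def)
  \<comment> \<open>In each case one exponent is 0: at a pole of \<open>u\<close>, k is supplied by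
    the zero of \<open>vp\<close>; at a pole of \<open>vp\<close> only, l is supplied by the zero of
    \<open>u\<close>. One joint statement ensures that a single choice of exponents serves all three
    bounds.\<close>
  have "\<exists>k l e K. e > 0 \<and> (\<forall>z\<in>ball t e \<inter> unit_disc. norm (u z) * norm (z - t) ^ k \<le> K * norm (z - t) ^ l \<and>
     norm (vp z) * norm (z - t) ^ l \<le> K * norm (z - t) ^ k \<and> norm (u z) \<le> K * (norm (z - t) ^ l * (1 + norm (u z))))"
    if t: "t \<in> D" for t
  proof -
    have tc: "t \<in> unit_circle" using t D by auto
    show ?thesis
    proof (cases "t \<in> poles (bdry u)")
      case True
      obtain k e K where e: "e > 0" "\<And>z. z \<in> ball t e \<inter> unit_disc \<Longrightarrow>
          norm (u z) * norm (z - t) ^ k \<le> K \<and> norm (vp z) \<le> K * norm (z - t) ^ k"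
        using pole_cancellation[OF tc uv an_vp[OF True] vp0] by metis
      show ?thesis
      \<comment> \<open>The maximum with 1 serves the last bound, which for exponent 0 compares |u|
        with K (1 + |u|).\<close>
      proof (rule exI[of _ k], rule exI[of _ 0], rule exI[of _ e], rule exI[of _ "max 1 K"], intro conjI ballI)
        fix z assume z: "z \<in> ball t e \<inter> unit_disc"
        show "norm (u z) * norm (z - t) ^ k \<le> max 1 K * norm (z - t) ^ 0"
          using e(2)[OF z] by (auto simp: le_max_iff_disj)
        have "norm (vp z) \<le> K * norm (z - t) ^ k" using e(2)[OF z] by simp
        also have "\<dots> \<le> max 1 K * norm (z - t) ^ k" by (intro mult_right_mono) auto
        finally show "norm (vp z) * norm (z - t) ^ 0 \<le> max 1 K * norm (z - t) ^ k" by simp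
        have "1 * (1 + norm (u z)) \<le> max 1 K * (1 + norm (u z))" by (intro mult_right_mono) auto
        then show "norm (u z) \<le> max 1 K * (norm (z - t) ^ 0 * (1 + norm (u z)))" by simp
      qed (rule e)
    next
      case False
      then have tv: "t \<in> poles (bdry vp)" using t by (simp add: D_def)
      obtain l e K where e: "e > 0" "\<And>z. z \<in> ball t e \<inter> unit_disc \<Longrightarrow>
          norm (vp z) * norm (z - t) ^ l \<le> K \<and> norm (u z) \<le> K * norm (z - t) ^ l"
        using pole_cancellation[OF tc vu an_u[OF tv] u0] by metis
      show ?thesis
      proof (rule exI[of _ 0], rule exI[of _ l], rule exI[of _ e], rule exI[of _ "max 1 K"], intro conjI ballI)
        fix z assume z: "z \<in> ball t e \<inter> unit_disc"
        show "norm (vp z) * norm (z - t) ^ l \<le> max 1 K * norm (z - t) ^ 0"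
          using e(2)[OF z] by (auto simp: le_max_iff_disj)
        have "norm (u z) \<le> K * norm (z - t) ^ l" using e(2)[OF z] by simp
        also have "\<dots> \<le> max 1 K * norm (z - t) ^ l" by (intro mult_right_mono) auto
        finally have *: "norm (u z) \<le> max 1 K * norm (z - t) ^ l" .
        then show "norm (u z) * norm (z - t) ^ 0 \<le> max 1 K * norm (z - t) ^ l" by simp
        have "max 1 K * norm (z - t) ^ l * 1 \<le> max 1 K * norm (z - t) ^ l * (1 + norm (u z))"
          by (intro mult_left_mono) auto
        with * show "norm (u z) \<le> max 1 K * (norm (z - t) ^ l * (1 + norm (u z)))" by (simp only: mult.assoc mult_1_right)
      qed (rule e)
    qed
  qed
  then obtain k0 l0 where loc: "\<And>t. t \<in> D \<Longrightarrow> \<exists>e K. e > 0 \<and> (\<forall>z\<in>ball t e \<inter> unit_disc. norm (u z) * norm (z - t) ^ k0 t \<le> K * norm (z - t) ^ l0 t \<and>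
     norm (vp z) * norm (z - t) ^ l0 t \<le> K * norm (z - t) ^ k0 t \<and> norm (u z) \<le> K * (norm (z - t) ^ l0 t * (1 + norm (u z))))"
    by metis
  \<comment> \<open>Exponents vanish off \<open>D\<close>, so the local estimates of
    \<open>zero_prod\<close> hold at every point.\<close>
  define k where "k = (\<lambda>t. if t \<in> D then k0 t else 0)"
  define l where "l = (\<lambda>t. if t \<in> D then l0 t else 0)"
  have kl: "k x = 0 \<and> l x = 0" if "x \<notin> D" for x using that by (simp add: k_def l_def)
  have lu: "\<exists>e>0. \<exists>K. \<forall>z\<in>ball t e \<inter> unit_disc. norm (u z) * norm (z - t) ^ k t \<le> K * norm (z - t) ^ l t"
    and lv: "\<exists>e>0. \<exists>K. \<forall>z\<in>ball t e \<inter> unit_disc. norm (vp z) * norm (z - t) ^ l t \<le> K * norm (z - t) ^ k t"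
    and lq: "\<exists>e>0. \<exists>K. \<forall>z\<in>ball t e \<inter> unit_disc. norm (u z) \<le> K * (norm (z - t) ^ l t * (1 + norm (u z)))"
    if "t \<in> D" for t
    using loc[OF that] that by (auto simp: k_def l_def)
  have uq: "(\<lambda>z. u z / zero_prod D l z) \<in> hardy 2"
    by (rule hardy2_divide_zero_prod[OF u D _ lq]) (use kl in auto)
  obtain A where A: "AE \<zeta> in \<mu>. norm (bdry u \<zeta>) * norm (zero_prod D k \<zeta>) \<le> A * norm (zero_prod D l \<zeta>)"
    using hardy2_bdry_factor_bound[OF u D(1) _ kl lu] by (auto simp: D_def)
  have "\<exists>K. AE \<zeta> in \<mu>. norm (bdry vp \<zeta>) * norm (zero_prod D l \<zeta>) \<le> K * norm (zero_prod D k \<zeta>)"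
    by (rule hardy2_bdry_factor_bound[OF vp D(1) _ _ lv]) (use kl in \<open>auto simp: D_def\<close>)
  then obtain B where B: "AE \<zeta> in \<mu>. norm (bdry vp \<zeta>) * norm (zero_prod D l \<zeta>) \<le> B * norm (zero_prod D k \<zeta>)" ..
  have "AE \<zeta> in \<mu>. \<forall>t\<in>D. \<zeta> \<noteq> t" using D(1) by (intro AE_finite_allI AE_circle_neq)
  then have p0: "AE \<zeta> in \<mu>. zero_prod D k \<zeta> \<noteq> 0"
  proof eventually_elim
    case (elim \<zeta>)
    then show ?case using D by (intro zero_prod_nonzero) auto
  qed
  show "bounded_on_H2 (toeplitz_product u (bdry v))"
  proof (rule toeplitz_product_bounded_by_factors[OF u v zero_prod_holomorphic zero_prod_holomorphic p0 _ _ _ uq])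
    show "zero_prod D l z \<noteq> 0" if "z \<in> unit_disc" for z using that D by (intro zero_prod_nonzero) auto
    show "norm (u z) * norm (zero_prod D k z) \<le> A * norm (zero_prod D l z)" if "z \<in> unit_disc" for z
      by (rule hardy2_factor_bound_disc[OF u D uq A that])
    show "AE \<zeta> in \<mu>. norm (bdry v \<zeta>) * norm (zero_prod D l \<zeta>) \<le> B * norm (zero_prod D k \<zeta>)"
      using B AE_space
    proof eventually_elim
      case (elim \<zeta>)
      \<comment> \<open>Equality in the disc makes the radial limits agree at every point of the
        circle, so the bound for \<open>vp\<close> serves for the actual symbol.\<close>
      have "bdry v \<zeta> = bdry vp \<zeta>" by (rule bdry_cong) (use elim vpv in auto)
      then show ?case using elim by simp
    qed
  qed
qed

end
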